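(* Let $R$ be an integral domain, let $(\mathcal{C},\otimes,\mathbb{I},\alpha,\lambda,\rho)$ be a countable distributive $\mathrm{Mod}_R$-monoidal category, let $\xi\in R$ and $N\in\mathbb{N}$. If the triple $(\mathcal{C},N,\xi)$ allows the twisted Leibniz rule, then $(\mathrm{C}_N(\mathcal{C}),\otimes_\xi,\mathbb{I}_\xi,\alpha_\xi,\lambda_\xi,\rho_\xi)$ is a countable distributive monoidal category.
   Context: $N$-complexes. For a category $\mathcal{C}$ with zero object, an $N$-complex is a $\mathbb{Z}$-indexed diagram $\cdots\to X^{n-1}\xrightarrow{d_X}X^n\xrightarrow{d_X}X^{n+1}\to\cdots$ with $d_X^N=0$; morphisms are families $g^i:X^i\to Y^i$ commuting with the differentials. They form the category $\mathrm{C}_N(\mathcal{C})$. Distributivity. A monoidal category $\mathcal{C}$ is distributive if it is additive, the canonical morphisms $(X\otimes Y)\oplus(X\otimes Z)\to X\otimes(Y\oplus Z)$ and $(Y\otimes X)\oplus(Z\otimes X)\to(Y\oplus Z)\otimes X$ are isomorphisms for all $X,Y,Z$, and $X\otimes0\cong0\cong0\otimes X$ for all $X$. It is countable distributive if moreover it admits countable coproducts and for all $X$ and $(Y_i)_{i\in\mathbb{Z}}$ the canonical morphisms $\tau_{X,Y_i}:\bigoplus_{i}(X\otimes Y_i)\to X\otimes\bigoplus_iY_i$ and $\sigma_{Y_i,X}:\bigoplus_i(Y_i\otimes X)\to(\bigoplus_iY_i)\otimes X$ are isomorphisms. $\mathrm{Mod}_R$-monoidal. A monoidal category $\mathcal{C}$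 enriched over $\mathrm{Mod}_R$ is $\mathrm{Mod}_R$-monoidal if $\otimes:\mathcal{C}\times\mathcal{C}\to\mathcal{C}$ and the structure morphisms factor through the canonical functor $\mathcal{C}\times\mathcal{C}\to\mathcal{C}\otimes_{\mathrm{Mod}_R}\mathcal{C}$, where $\mathcal{C}\otimes_{\mathrm{Mod}_R}\mathcal{C}$ has objects pairs $(X,Y)$ and morphism modules $\mathcal{C}(X_1,X_2)\otimes_R\mathcal{C}(Y_1,Y_2)$; in particular $\otimes$ is $R$-bilinear on morphisms. The structure on complexes. - $(X\otimes_\xi Y)^n:=\bigoplus_{i+j=n}X^i\otimes Y^j$ with differential on the summand $X^i\otimes Y^j$ given by $\iota_{i+1,j}\circ(d_X\otimes\mathrm{Id})+\xi^i\,\iota_{i,j+1}\circ(\mathrm{Id}\otimes d_Y)$, where $\iota_{k,l}$ is the inclusion of the summand $X^k\otimes Y^l$; on morphisms $(f\otimes_\xi g)^n:=\bigoplus_{i+j=n}f^i\otimes g^j$. - $\mathbb{I}_\xi$ is the complex with $\mathbb{I}$ in degree $0$ and $0$ in all other degrees. - $\alpha_{\xi,X,Y,Z}:(X\otimes_\xi Y)\otimes_\xi Z\to X\otimes_\xi(Y\otimes_\xi Z)$ is, in degree $n$, the isomorphism corresponding to $\bigoplus_{i+k+l=n}\alpha_{X^i,Y^k,Z^l}$ under the isomorphisms $\big((X\otimes_\xi Y)\otimes_\xi Z\big)^n\cong\bigoplus_{i+k+l=n}(X^i\otimes Y^k)\otimes Z^l$ and $\big(X\otimes_\xi(Y\otimes_\xi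 Z)\big)^n\cong\bigoplus_{i+k+l=n}X^i\otimes(Y^k\otimes Z^l)$ induced by $\sigma$, $\tau$ and the canonical regrouping of iterated coproducts. - $\lambda_{\xi,X}:\mathbb{I}_\xi\otimes_\xi X\to X$ and $\rho_{\xi,X}:X\otimes_\xi\mathbb{I}_\xi\to X$ are given in degree $j$ by $\lambda_{X^j}$ and $\rho_{X^j}$. A triple $(\mathcal{C},N,\xi)$ (with $\mathcal{C}$ additive and enriched over $\mathrm{Mod}_R$) allows the twisted Leibniz rule if one of the following holds: (i) every morphism $f$ in $\mathcal{C}$ satisfies $pf=0$ for a fixed prime $p$, $\xi=1$ and $N=p^n$ for some $n\in\mathbb{N}$; (ii) $\xi$ is a primitive $N$-th root of unity in $R$ (i.e. $\xi^N=1$ and $\xi^j\ne1$ for $0<j<N$); (iii) every morphism $f$ in $\mathcal{C}$ satisfies $pf=0$ for a fixed prime $p$, $\xi$ is a primitive $k$-th root of unity in $R$, and $N=p^nk$ for some $n\in\mathbb{N}$. *)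

theory Defs
  imports "HOL-Computational_Algebra.Primes" "HOL-Algebra.Module"
begin

section \<open>Categories\<close>

text \<open>
  As for the structures of HOL-Algebra, the operations of a category are only meaningful on its
  objects and arrows. The composite of \<open>f : A \<rightarrow> B\<close> and \<open>g : B \<rightarrow> D\<close> is \<open>g \<cdot> f\<close>.
\<close>

record ('o, 'm) category =
  Obj :: "'o set"
  Arr :: "'m set"
  Dom :: "'m \<Rightarrow> 'o"
  Cod :: "'m \<Rightarrow> 'o"
  Idm :: "'o \<Rightarrow> 'm"
  cmp :: "'m \<Rightarrow> 'm \<Rightarrow> 'm" (infixl "\<cdot>\<index>" 70)

definition Hom :: "('o, 'm, 'x) category_scheme \<Rightarrow> 'o \<Rightarrow> 'o \<Rightarrow> 'm set"
  where "Hom C A B = {f \<in> Arr C. Dom C f = A \<and> Cod C f = B}"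

locale category =
  fixes C :: "('o, 'm, 'x) category_scheme" (structure)
  assumes Dom_closed: "f \<in> Arr C \<Longrightarrow> Dom C f \<in> Obj C"
    and Cod_closed: "f \<in> Arr C \<Longrightarrow> Cod C f \<in> Obj C"
    and Idm_closed: "A \<in> Obj C \<Longrightarrow> Idm C A \<in> Hom C A A"
    and cmp_closed: "\<lbrakk>f \<in> Hom C A B; g \<in> Hom C B D\<rbrakk> \<Longrightarrow> g \<cdot> f \<in> Hom C A D"
    and Idm_left: "f \<in> Hom C A B \<Longrightarrow> Idm C B \<cdot> f = f"
    and Idm_right: "f \<in> Hom C A B \<Longrightarrow> f \<cdot> Idm C A = f"
    and cmp_assoc: "\<lbrakk>f \<in> Hom C A B; g \<in> Hom C B D; h \<in> Hom C D E\<rbrakk>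
      \<Longrightarrow> (h \<cdot> g) \<cdot> f = h \<cdot> (g \<cdot> f)"

definition inverse_arrows :: "('o, 'm, 'x) category_scheme \<Rightarrow> 'm \<Rightarrow> 'm \<Rightarrow> bool"
  where "inverse_arrows C f g \<longleftrightarrow>
    f \<in> Arr C \<and> g \<in> Hom C (Cod C f) (Dom C f) \<and>
    g \<cdot>\<^bsub>C\<^esub> f = Idm C (Dom C f) \<and> f \<cdot>\<^bsub>C\<^esub> g = Idm C (Cod C f)"

definition is_iso :: "('o, 'm, 'x) category_scheme \<Rightarrow> 'm \<Rightarrow> bool"
  where "is_iso C f \<longleftrightarrow> (\<exists>g. inverse_arrows C f g)"

definition inv_arrow :: "('o, 'm, 'x) category_scheme \<Rightarrow> 'm \<Rightarrow> 'm"
  where "inv_arrow C f = (THE g. inverse_arrows C f g)"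

definition isomorphic :: "('o, 'm, 'x) category_scheme \<Rightarrow> 'o \<Rightarrow> 'o \<Rightarrow> bool"
  where "isomorphic C A B \<longleftrightarrow> (\<exists>f \<in> Hom C A B. is_iso C f)"

definition zero_object :: "('o, 'm, 'x) category_scheme \<Rightarrow> 'o \<Rightarrow> bool"
  where "zero_object C Z \<longleftrightarrow> Z \<in> Obj C \<and>
    (\<forall>A \<in> Obj C. (\<exists>!f. f \<in> Hom C Z A) \<and> (\<exists>!f. f \<in> Hom C A Z))"

definition is_coproduct ::
    "('o, 'm, 'x) category_scheme \<Rightarrow> 'i set \<Rightarrow> ('i \<Rightarrow> 'o) \<Rightarrow> 'o \<Rightarrow> ('i \<Rightarrow> 'm) \<Rightarrow> bool"
  where "is_coproduct C I Y P \<iota> \<longleftrightarrow>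
    P \<in> Obj C \<and> (\<forall>i \<in> I. Y i \<in> Obj C \<and> \<iota> i \<in> Hom C (Y i) P) \<and>
    (\<forall>T \<in> Obj C. \<forall>f. (\<forall>i \<in> I. f i \<in> Hom C (Y i) T) \<longrightarrow>
      (\<exists>!h. h \<in> Hom C P T \<and> (\<forall>i \<in> I. h \<cdot>\<^bsub>C\<^esub> \<iota> i = f i)))"

text \<open>The arrow \<open>P \<rightarrow> T\<close> induced by the \<open>f i\<close>, where \<open>P\<close> with inclusions \<open>\<iota>\<close> is a coproduct.\<close>

definition copair ::
    "('o, 'm, 'x) category_scheme \<Rightarrow> 'i set \<Rightarrow> 'o \<Rightarrow> ('i \<Rightarrow> 'm) \<Rightarrow> 'o \<Rightarrow> ('i \<Rightarrow> 'm) \<Rightarrow> 'm"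
  where "copair C I P \<iota> T f = (THE h. h \<in> Hom C P T \<and> (\<forall>i \<in> I. h \<cdot>\<^bsub>C\<^esub> \<iota> i = f i))"

text \<open>
  Every countable set is in bijection with a set of integers, so these index sets cover all
  countable coproducts.
\<close>

definition has_countable_coproducts :: "('o, 'm, 'x) category_scheme \<Rightarrow> bool"
  where "has_countable_coproducts C \<longleftrightarrow>
    (\<forall>(I :: int set) Y. (\<forall>i \<in> I. Y i \<in> Obj C) \<longrightarrow> (\<exists>P \<iota>. is_coproduct C I Y P \<iota>))"

text \<open>A simultaneous choice of a coproduct \<open>S Y\<close> with inclusions \<open>\<iota> Y i : Y i \<rightarrow> S Y\<close>.\<close>

definition coproduct_choice ::
    "('o, 'm, 'x) category_scheme \<Rightarrow> ((int \<Rightarrow> 'o) \<Rightarrow> 'o) \<Rightarrow> ((int \<Rightarrow> 'o) \<Rightarrow> int \<Rightarrow> 'm) \<Rightarrow> bool"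
  where "coproduct_choice C S \<iota> \<longleftrightarrow>
    (\<forall>Y. range Y \<subseteq> Obj C \<longrightarrow> is_coproduct C UNIV Y (S Y) (\<iota> Y))"


section \<open>Additive categories\<close>

record ('o, 'm) preadditive_category = "('o, 'm) category" +
  madd :: "'m \<Rightarrow> 'm \<Rightarrow> 'm"
  mzero :: "'o \<Rightarrow> 'o \<Rightarrow> 'm"

text \<open>The fields \<open>mult\<close> and \<open>one\<close> play no role in \<^const>\<open>abelian_group\<close>.\<close>

definition hom_group :: "('o, 'm, 'x) preadditive_category_scheme \<Rightarrow> 'o \<Rightarrow> 'o \<Rightarrow> 'm ring"
  where "hom_group C A B =
    \<lparr>carrier = Hom C A B, mult = undefined, one = undefined, zero = mzero C A B, add = madd C\<rparr>"

locale preadditive_category = category C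
  for C :: "('o, 'm, 'x) preadditive_category_scheme" (structure) +
  assumes hom_abelian: "\<lbrakk>A \<in> Obj C; B \<in> Obj C\<rbrakk> \<Longrightarrow> abelian_group (hom_group C A B)"
    and cmp_madd_left: "\<lbrakk>f \<in> Hom C A B; g \<in> Hom C B D; h \<in> Hom C B D\<rbrakk>
      \<Longrightarrow> madd C g h \<cdot> f = madd C (g \<cdot> f) (h \<cdot> f)"
    and cmp_madd_right: "\<lbrakk>f \<in> Hom C A B; g \<in> Hom C A B; h \<in> Hom C B D\<rbrakk>
      \<Longrightarrow> h \<cdot> madd C f g = madd C (h \<cdot> f) (h \<cdot> g)"

locale additive_category = preadditive_category C
  for C :: "('o, 'm, 'x) preadditive_category_scheme" (structure) +
  assumes ex_zero_object: "\<exists>Z. zero_object C Z"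
    and ex_binary_coproduct:
      "range Y \<subseteq> Obj C \<Longrightarrow> \<exists>P \<iota>. is_coproduct C (UNIV :: bool set) Y P \<iota>"


section \<open>Monoidal categories\<close>

record ('o, 'm) monoidal_category = "('o, 'm) preadditive_category" +
  tensor_obj :: "'o \<Rightarrow> 'o \<Rightarrow> 'o" (infixl "\<otimes>\<^sub>o\<index>" 75)
  tensor_arr :: "'m \<Rightarrow> 'm \<Rightarrow> 'm" (infixl "\<otimes>\<^sub>a\<index>" 75)
  unit_obj :: "'o"
  assoc :: "'o \<Rightarrow> 'o \<Rightarrow> 'o \<Rightarrow> 'm"
  lunit :: "'o \<Rightarrow> 'm"
  runit :: "'o \<Rightarrow> 'm"

text \<open>
  The record provides an addition of arrows, but the monoidal axioms do not refer to it:
  compatibility is only required in \<open>linear_monoidal_category\<close> below.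
\<close>

locale monoidal_category = category C
  for C :: "('o, 'm, 'x) monoidal_category_scheme" (structure) +
  assumes tensor_obj_closed: "\<lbrakk>X \<in> Obj C; Y \<in> Obj C\<rbrakk> \<Longrightarrow> X \<otimes>\<^sub>o Y \<in> Obj C"
    and tensor_arr_closed: "\<lbrakk>f \<in> Hom C X X'; g \<in> Hom C Y Y'\<rbrakk>
      \<Longrightarrow> f \<otimes>\<^sub>a g \<in> Hom C (X \<otimes>\<^sub>o Y) (X' \<otimes>\<^sub>o Y')"
    and tensor_Idm: "\<lbrakk>X \<in> Obj C; Y \<in> Obj C\<rbrakk> \<Longrightarrow> Idm C X \<otimes>\<^sub>a Idm C Y = Idm C (X \<otimes>\<^sub>o Y)"
    and tensor_cmp: "\<lbrakk>f \<in> Hom C X X'; f' \<in> Hom C X' X''; g \<in> Hom C Y Y'; g' \<in> Hom C Y' Y''\<rbrakk>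
      \<Longrightarrow> (f' \<cdot> f) \<otimes>\<^sub>a (g' \<cdot> g) = (f' \<otimes>\<^sub>a g') \<cdot> (f \<otimes>\<^sub>a g)"
    and unit_closed: "unit_obj C \<in> Obj C"
    and assoc_closed: "\<lbrakk>X \<in> Obj C; Y \<in> Obj C; Z \<in> Obj C\<rbrakk>
      \<Longrightarrow> assoc C X Y Z \<in> Hom C ((X \<otimes>\<^sub>o Y) \<otimes>\<^sub>o Z) (X \<otimes>\<^sub>o (Y \<otimes>\<^sub>o Z))"
    and assoc_iso: "\<lbrakk>X \<in> Obj C; Y \<in> Obj C; Z \<in> Obj C\<rbrakk> \<Longrightarrow> is_iso C (assoc C X Y Z)"
    and assoc_natural: "\<lbrakk>f \<in> Hom C X X'; g \<in> Hom C Y Y'; h \<in> Hom C Z Z'\<rbrakk>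
      \<Longrightarrow> assoc C X' Y' Z' \<cdot> ((f \<otimes>\<^sub>a g) \<otimes>\<^sub>a h) = (f \<otimes>\<^sub>a (g \<otimes>\<^sub>a h)) \<cdot> assoc C X Y Z"
    and lunit_closed: "X \<in> Obj C \<Longrightarrow> lunit C X \<in> Hom C (unit_obj C \<otimes>\<^sub>o X) X"
    and lunit_iso: "X \<in> Obj C \<Longrightarrow> is_iso C (lunit C X)"
    and lunit_natural: "f \<in> Hom C X X'
      \<Longrightarrow> lunit C X' \<cdot> (Idm C (unit_obj C) \<otimes>\<^sub>a f) = f \<cdot> lunit C X"
    and runit_closed: "X \<in> Obj C \<Longrightarrow> runit C X \<in> Hom C (X \<otimes>\<^sub>o unit_obj C) X"
    and runit_iso: "X \<in> Obj C \<Longrightarrow> is_iso C (runit C X)"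
    and runit_natural: "f \<in> Hom C X X'
      \<Longrightarrow> runit C X' \<cdot> (f \<otimes>\<^sub>a Idm C (unit_obj C)) = f \<cdot> runit C X"
    and pentagon: "\<lbrakk>W \<in> Obj C; X \<in> Obj C; Y \<in> Obj C; Z \<in> Obj C\<rbrakk>
      \<Longrightarrow> (Idm C W \<otimes>\<^sub>a assoc C X Y Z) \<cdot> assoc C W (X \<otimes>\<^sub>o Y) Z \<cdot> (assoc C W X Y \<otimes>\<^sub>a Idm C Z)
        = assoc C W X (Y \<otimes>\<^sub>o Z) \<cdot> assoc C (W \<otimes>\<^sub>o X) Y Z"
    and triangle: "\<lbrakk>X \<in> Obj C; Y \<in> Obj C\<rbrakk>
      \<Longrightarrow> (Idm C X \<otimes>\<^sub>a lunit C Y) \<cdot> assoc C X (unit_obj C) Y = runit C X \<otimes>\<^sub>a Idm C Y"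

text \<open>
  The canonical arrows \<open>\<tau> : \<Oplus>\<^sub>i (X \<otimes> Y i) \<rightarrow> X \<otimes> \<Oplus>\<^sub>i Y i\<close> and
  \<open>\<sigma> : \<Oplus>\<^sub>i (Y i \<otimes> X) \<rightarrow> (\<Oplus>\<^sub>i Y i) \<otimes> X\<close>, for a coproduct \<open>Q, \<kappa>\<close> of the tensor products and
  a coproduct \<open>P, \<iota>\<close> of the family \<open>Y\<close>.
\<close>

definition dist_left ::
    "('o, 'm, 'x) monoidal_category_scheme \<Rightarrow> 'i set \<Rightarrow> 'o \<Rightarrow>
      'o \<Rightarrow> ('i \<Rightarrow> 'm) \<Rightarrow> 'o \<Rightarrow> ('i \<Rightarrow> 'm) \<Rightarrow> 'm"
  where "dist_left C I X Q \<kappa> P \<iota> =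
    copair C I Q \<kappa> (X \<otimes>\<^sub>o\<^bsub>C\<^esub> P) (\<lambda>i. Idm C X \<otimes>\<^sub>a\<^bsub>C\<^esub> \<iota> i)"

definition dist_right ::
    "('o, 'm, 'x) monoidal_category_scheme \<Rightarrow> 'i set \<Rightarrow> 'o \<Rightarrow>
      'o \<Rightarrow> ('i \<Rightarrow> 'm) \<Rightarrow> 'o \<Rightarrow> ('i \<Rightarrow> 'm) \<Rightarrow> 'm"
  where "dist_right C I X Q \<kappa> P \<iota> =
    copair C I Q \<kappa> (P \<otimes>\<^sub>o\<^bsub>C\<^esub> X) (\<lambda>i. \<iota> i \<otimes>\<^sub>a\<^bsub>C\<^esub> Idm C X)"

definition distributes ::
    "('o, 'm, 'x) monoidal_category_scheme \<Rightarrow> 'i set \<Rightarrow> 'o \<Rightarrow> ('i \<Rightarrow> 'o) \<Rightarrow> bool"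
  where "distributes C I X Y \<longleftrightarrow>
    (\<forall>P \<iota>. is_coproduct C I Y P \<iota> \<longrightarrow>
      (\<forall>Q \<kappa>. is_coproduct C I (\<lambda>i. X \<otimes>\<^sub>o\<^bsub>C\<^esub> Y i) Q \<kappa> \<longrightarrow> is_iso C (dist_left C I X Q \<kappa> P \<iota>)) \<and>
      (\<forall>Q \<kappa>. is_coproduct C I (\<lambda>i. Y i \<otimes>\<^sub>o\<^bsub>C\<^esub> X) Q \<kappa> \<longrightarrow> is_iso C (dist_right C I X Q \<kappa> P \<iota>)))"

locale distributive_monoidal_category = monoidal_category C + additive_category C
  for C :: "('o, 'm, 'x) monoidal_category_scheme" (structure) +
  assumes finite_distributes:
      "\<lbrakk>X \<in> Obj C; range Y \<subseteq> Obj C\<rbrakk> \<Longrightarrow> distributes C (UNIV :: bool set) X Y"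
    and tensor_zero: "\<lbrakk>X \<in> Obj C; zero_object C Z\<rbrakk>
      \<Longrightarrow> isomorphic C (X \<otimes>\<^sub>o Z) Z \<and> isomorphic C (Z \<otimes>\<^sub>o X) Z"

locale countable_distributive_monoidal_category = distributive_monoidal_category C
  for C :: "('o, 'm, 'x) monoidal_category_scheme" (structure) +
  assumes countable_coproducts: "has_countable_coproducts C"
    and countable_distributes:
      "\<lbrakk>X \<in> Obj C; range Y \<subseteq> Obj C\<rbrakk> \<Longrightarrow> distributes C (UNIV :: int set) X Y"


section \<open>Monoidal categories over the modules of a ring\<close>

record ('o, 'm, 'r) linear_monoidal_category = "('o, 'm) monoidal_category" +
  scale :: "'r \<Rightarrow> 'm \<Rightarrow> 'm"

definition hom_module ::
    "('o, 'm, 'r, 'x) linear_monoidal_category_scheme \<Rightarrow> 'o \<Rightarrow> 'o \<Rightarrow> ('r, 'm) module"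
  where "hom_module C A B =
    \<lparr>carrier = Hom C A B, mult = undefined, one = undefined, zero = mzero C A B, add = madd C,
     smult = scale C\<rparr>"

text \<open>
  A family of maps \<open>Hom X X' \<times> Hom Y Y' \<rightarrow> Hom (X \<otimes> Y) (X' \<otimes> Y')\<close> factors through \<open>R\<close>-linear maps
  on \<open>Hom X X' \<otimes>\<^sub>R Hom Y Y'\<close> if and only if it is \<open>R\<close>-bilinear. Naturality of the structure
  arrows over the tensor product of categories adds nothing, since pure tensors generate.
\<close>

locale linear_monoidal_category = monoidal_category C + preadditive_category C
  for R :: "('r, 'y) ring_scheme"
    and C :: "('o, 'm, 'r, 'x) linear_monoidal_category_scheme" (structure) +
  assumes hom_module: "\<lbrakk>A \<in> Obj C; B \<in> Obj C\<rbrakk> \<Longrightarrow> module R (hom_module C A B)"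
    and cmp_scale_left: "\<lbrakk>r \<in> carrier R; f \<in> Hom C A B; g \<in> Hom C B D\<rbrakk>
      \<Longrightarrow> scale C r g \<cdot> f = scale C r (g \<cdot> f)"
    and cmp_scale_right: "\<lbrakk>r \<in> carrier R; f \<in> Hom C A B; g \<in> Hom C B D\<rbrakk>
      \<Longrightarrow> g \<cdot> scale C r f = scale C r (g \<cdot> f)"
    and tensor_madd_left: "\<lbrakk>f \<in> Hom C X X'; f' \<in> Hom C X X'; g \<in> Hom C Y Y'\<rbrakk>
      \<Longrightarrow> madd C f f' \<otimes>\<^sub>a g = madd C (f \<otimes>\<^sub>a g) (f' \<otimes>\<^sub>a g)"
    and tensor_madd_right: "\<lbrakk>f \<in> Hom C X X'; g \<in> Hom C Y Y'; g' \<in> Hom C Y Y'\<rbrakk>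
      \<Longrightarrow> f \<otimes>\<^sub>a madd C g g' = madd C (f \<otimes>\<^sub>a g) (f \<otimes>\<^sub>a g')"
    and tensor_scale_left: "\<lbrakk>r \<in> carrier R; f \<in> Hom C X X'; g \<in> Hom C Y Y'\<rbrakk>
      \<Longrightarrow> scale C r f \<otimes>\<^sub>a g = scale C r (f \<otimes>\<^sub>a g)"
    and tensor_scale_right: "\<lbrakk>r \<in> carrier R; f \<in> Hom C X X'; g \<in> Hom C Y Y'\<rbrakk>
      \<Longrightarrow> f \<otimes>\<^sub>a scale C r g = scale C r (f \<otimes>\<^sub>a g)"


section \<open>The twisted Leibniz rule\<close>

definition annihilates_arrows ::
    "nat \<Rightarrow> ('o, 'm, 'x) preadditive_category_scheme \<Rightarrow> bool"
  where "annihilates_arrows p C \<longleftrightarrow>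
    (\<forall>A \<in> Obj C. \<forall>B \<in> Obj C. \<forall>f \<in> Hom C A B. add_pow (hom_group C A B) p f = mzero C A B)"

definition primitive_root :: "('r, 'y) ring_scheme \<Rightarrow> nat \<Rightarrow> 'r \<Rightarrow> bool"
  where "primitive_root R k \<xi> \<longleftrightarrow> \<xi> \<in> carrier R \<and> \<xi> [^]\<^bsub>R\<^esub> k = \<one>\<^bsub>R\<^esub> \<and>
    (\<forall>j :: nat. 0 < j \<and> j < k \<longrightarrow> \<xi> [^]\<^bsub>R\<^esub> j \<noteq> \<one>\<^bsub>R\<^esub>)"

definition allows_twisted_Leibniz ::
    "('r, 'y) ring_scheme \<Rightarrow> ('o, 'm, 'x) preadditive_category_scheme \<Rightarrow> nat \<Rightarrow> 'r \<Rightarrow> bool"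
  where "allows_twisted_Leibniz R C N \<xi> \<longleftrightarrow>
    (\<exists>p n. prime p \<and> annihilates_arrows p C \<and> \<xi> = \<one>\<^bsub>R\<^esub> \<and> N = p ^ n) \<or>
    primitive_root R N \<xi> \<or>
    (\<exists>p k n. prime p \<and> annihilates_arrows p C \<and> primitive_root R k \<xi> \<and> N = p ^ n * k)"


section \<open>The category of \<open>N\<close>-complexes\<close>

record ('o, 'm) ncomplex =
  ob :: "int \<Rightarrow> 'o"
  dif :: "int \<Rightarrow> 'm"

record ('o, 'm) chain_map =
  src :: "('o, 'm) ncomplex"
  tgt :: "('o, 'm) ncomplex"
  comps :: "int \<Rightarrow> 'm"

text \<open>\<open>dif_pow C X k n\<close> is \<open>d\<^sup>k : X\<^sup>n \<rightarrow> X\<^sup>n\<^sup>+\<^sup>k\<close>.\<close>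

primrec dif_pow ::
    "('o, 'm, 'x) category_scheme \<Rightarrow> ('o, 'm) ncomplex \<Rightarrow> nat \<Rightarrow> int \<Rightarrow> 'm"
  where
    "dif_pow C X 0 n = Idm C (ob X n)"
  | "dif_pow C X (Suc k) n = dif X (n + int k) \<cdot>\<^bsub>C\<^esub> dif_pow C X k n"

definition is_ncomplex ::
    "('o, 'm, 'x) preadditive_category_scheme \<Rightarrow> nat \<Rightarrow> ('o, 'm) ncomplex \<Rightarrow> bool"
  where "is_ncomplex C N X \<longleftrightarrow>
    (\<forall>n. ob X n \<in> Obj C) \<and> (\<forall>n. dif X n \<in> Hom C (ob X n) (ob X (n + 1))) \<and>
    (\<forall>n. dif_pow C X N n = mzero C (ob X n) (ob X (n + int N)))"

definition is_chain_map ::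
    "('o, 'm, 'x) preadditive_category_scheme \<Rightarrow> nat \<Rightarrow> ('o, 'm) chain_map \<Rightarrow> bool"
  where "is_chain_map C N f \<longleftrightarrow>
    is_ncomplex C N (src f) \<and> is_ncomplex C N (tgt f) \<and>
    (\<forall>i. comps f i \<in> Hom C (ob (src f) i) (ob (tgt f) i)) \<and>
    (\<forall>i. comps f (i + 1) \<cdot>\<^bsub>C\<^esub> dif (src f) i = dif (tgt f) i \<cdot>\<^bsub>C\<^esub> comps f i)"

definition ncomplexes ::
    "('o, 'm, 'x) preadditive_category_scheme \<Rightarrow> nat \<Rightarrow>
      (('o, 'm) ncomplex, ('o, 'm) chain_map) preadditive_category"
  where "ncomplexes C N = \<lparr>
    Obj = {X. is_ncomplex C N X},
    Arr = {f. is_chain_map C N f},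
    Dom = src,
    Cod = tgt,
    Idm = (\<lambda>X. \<lparr>src = X, tgt = X, comps = (\<lambda>i. Idm C (ob X i))\<rparr>),
    cmp = (\<lambda>g f. \<lparr>src = src f, tgt = tgt g, comps = (\<lambda>i. comps g i \<cdot>\<^bsub>C\<^esub> comps f i)\<rparr>),
    madd = (\<lambda>f g. \<lparr>src = src f, tgt = tgt f, comps = (\<lambda>i. madd C (comps f i) (comps g i))\<rparr>),
    mzero = (\<lambda>X Y. \<lparr>src = X, tgt = Y, comps = (\<lambda>i. mzero C (ob X i) (ob Y i))\<rparr>)\<rparr>"


section \<open>The monoidal structure on \<open>N\<close>-complexes\<close>

text \<open>
  From here on, \<open>S\<close> and \<open>\<iota>\<close> are a choice of coproducts as in \<^const>\<open>coproduct_choice\<close>, and \<open>Z0\<close>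
  is a choice of a zero object.
\<close>

definition coprod_copair ::
    "('o, 'm, 'x) category_scheme \<Rightarrow> ((int \<Rightarrow> 'o) \<Rightarrow> 'o) \<Rightarrow> ((int \<Rightarrow> 'o) \<Rightarrow> int \<Rightarrow> 'm) \<Rightarrow>
      (int \<Rightarrow> 'o) \<Rightarrow> 'o \<Rightarrow> (int \<Rightarrow> 'm) \<Rightarrow> 'm"
  where "coprod_copair C S \<iota> Y T f = copair C UNIV (S Y) (\<iota> Y) T f"

text \<open>\<open>\<Oplus>\<^sub>i f i : \<Oplus>\<^sub>i Y i \<rightarrow> \<Oplus>\<^sub>i Y' i\<close>\<close>

definition coprod_map ::
    "('o, 'm, 'x) category_scheme \<Rightarrow> ((int \<Rightarrow> 'o) \<Rightarrow> 'o) \<Rightarrow> ((int \<Rightarrow> 'o) \<Rightarrow> int \<Rightarrow> 'm) \<Rightarrow>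
      (int \<Rightarrow> 'o) \<Rightarrow> (int \<Rightarrow> 'o) \<Rightarrow> (int \<Rightarrow> 'm) \<Rightarrow> 'm"
  where "coprod_map C S \<iota> Y Y' f = coprod_copair C S \<iota> Y (S Y') (\<lambda>i. \<iota> Y' i \<cdot>\<^bsub>C\<^esub> f i)"

definition tau ::
    "('o, 'm, 'x) monoidal_category_scheme \<Rightarrow> ((int \<Rightarrow> 'o) \<Rightarrow> 'o) \<Rightarrow>
      ((int \<Rightarrow> 'o) \<Rightarrow> int \<Rightarrow> 'm) \<Rightarrow> 'o \<Rightarrow> (int \<Rightarrow> 'o) \<Rightarrow> 'm"
  where "tau C S \<iota> X Y = (let W = (\<lambda>i. X \<otimes>\<^sub>o\<^bsub>C\<^esub> Y i) in dist_left C UNIV X (S W) (\<iota> W) (S Y) (\<iota> Y))"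

definition sigma ::
    "('o, 'm, 'x) monoidal_category_scheme \<Rightarrow> ((int \<Rightarrow> 'o) \<Rightarrow> 'o) \<Rightarrow>
      ((int \<Rightarrow> 'o) \<Rightarrow> int \<Rightarrow> 'm) \<Rightarrow> (int \<Rightarrow> 'o) \<Rightarrow> 'o \<Rightarrow> 'm"
  where "sigma C S \<iota> Y X = (let W = (\<lambda>i. Y i \<otimes>\<^sub>o\<^bsub>C\<^esub> X) in dist_right C UNIV X (S W) (\<iota> W) (S Y) (\<iota> Y))"

text \<open>
  A coproduct over the pairs \<open>(i, j)\<close> with \<open>i + j = n\<close> is indexed by \<open>i\<close> alone. Thus the inclusion
  of the summand \<open>X\<^sup>k \<otimes> Y\<^sup>l\<close> is \<open>\<iota> (summands C X Y (k + l)) k\<close>.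
\<close>

definition summands ::
    "('o, 'm, 'x) monoidal_category_scheme \<Rightarrow> ('o, 'm) ncomplex \<Rightarrow> ('o, 'm) ncomplex \<Rightarrow>
      int \<Rightarrow> int \<Rightarrow> 'o"
  where "summands C X Y n = (\<lambda>i. ob X i \<otimes>\<^sub>o\<^bsub>C\<^esub> ob Y (n - i))"

text \<open>
  The exponent \<open>i\<close> in \<open>\<xi>\<^sup>i\<close> is an arbitrary integer; for negative \<open>i\<close> the power of HOL-Algebra uses
  the inverse of \<open>\<xi>\<close> in \<open>R\<close>, and \<open>\<xi>\<close> is a unit whenever the twisted Leibniz rule is allowed and
  \<open>N > 0\<close>.
\<close>

definition complex_tensor_obj ::
    "('r, 'y) ring_scheme \<Rightarrow> ('o, 'm, 'r, 'x) linear_monoidal_category_scheme \<Rightarrow> 'r \<Rightarrow>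
      ((int \<Rightarrow> 'o) \<Rightarrow> 'o) \<Rightarrow> ((int \<Rightarrow> 'o) \<Rightarrow> int \<Rightarrow> 'm) \<Rightarrow>
      ('o, 'm) ncomplex \<Rightarrow> ('o, 'm) ncomplex \<Rightarrow> ('o, 'm) ncomplex"
  where "complex_tensor_obj R C \<xi> S \<iota> X Y = \<lparr>
    ob = (\<lambda>n. S (summands C X Y n)),
    dif = (\<lambda>n. let W = summands C X Y (n + 1) in
      coprod_copair C S \<iota> (summands C X Y n) (S W)
        (\<lambda>i. let j = n - i in
          madd C
            (\<iota> W (i + 1) \<cdot>\<^bsub>C\<^esub> (dif X i \<otimes>\<^sub>a\<^bsub>C\<^esub> Idm C (ob Y j)))
            (scale C (\<xi> [^]\<^bsub>R\<^esub> i) (\<iota> W i \<cdot>\<^bsub>C\<^esub> (Idm C (ob X i) \<otimes>\<^sub>a\<^bsub>C\<^esub> dif Y j)))))\<rparr>"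

definition complex_tensor_arr ::
    "('r, 'y) ring_scheme \<Rightarrow> ('o, 'm, 'r, 'x) linear_monoidal_category_scheme \<Rightarrow> 'r \<Rightarrow>
      ((int \<Rightarrow> 'o) \<Rightarrow> 'o) \<Rightarrow> ((int \<Rightarrow> 'o) \<Rightarrow> int \<Rightarrow> 'm) \<Rightarrow>
      ('o, 'm) chain_map \<Rightarrow> ('o, 'm) chain_map \<Rightarrow> ('o, 'm) chain_map"
  where "complex_tensor_arr R C \<xi> S \<iota> f g = \<lparr>
    src = complex_tensor_obj R C \<xi> S \<iota> (src f) (src g),
    tgt = complex_tensor_obj R C \<xi> S \<iota> (tgt f) (tgt g),
    comps = (\<lambda>n. coprod_map C S \<iota> (summands C (src f) (src g) n) (summands C (tgt f) (tgt g) n)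
      (\<lambda>i. comps f i \<otimes>\<^sub>a\<^bsub>C\<^esub> comps g (n - i)))\<rparr>"

definition complex_unit ::
    "('o, 'm, 'x) monoidal_category_scheme \<Rightarrow> 'o \<Rightarrow> ('o, 'm) ncomplex"
  where "complex_unit C Z0 = (let U = (\<lambda>i :: int. if i = 0 then unit_obj C else Z0) in
    \<lparr>ob = U, dif = (\<lambda>i. mzero C (U i) (U (i + 1)))\<rparr>)"

text \<open>
  The coproduct over all \<open>i + k + l = n\<close> is taken to be the iterated one, over \<open>i\<close> and then over
  \<open>k\<close>. In degree \<open>n\<close> the associator is the composite
  \<open>\<Oplus>\<^sub>m (\<Oplus>\<^sub>i X\<^sup>i \<otimes> Y\<^sup>m\<^sup>-\<^sup>i) \<otimes> Z\<^sup>n\<^sup>-\<^sup>m\<close>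
  \<open>\<rightarrow> \<Oplus>\<^sub>m \<Oplus>\<^sub>i (X\<^sup>i \<otimes> Y\<^sup>m\<^sup>-\<^sup>i) \<otimes> Z\<^sup>n\<^sup>-\<^sup>m\<close>
  \<open>\<rightarrow> \<Oplus>\<^sub>i \<Oplus>\<^sub>k (X\<^sup>i \<otimes> Y\<^sup>k) \<otimes> Z\<^sup>n\<^sup>-\<^sup>i\<^sup>-\<^sup>k\<close>
  \<open>\<rightarrow> \<Oplus>\<^sub>i \<Oplus>\<^sub>k X\<^sup>i \<otimes> (Y\<^sup>k \<otimes> Z\<^sup>n\<^sup>-\<^sup>i\<^sup>-\<^sup>k)\<close>
  \<open>\<rightarrow> \<Oplus>\<^sub>i X\<^sup>i \<otimes> (\<Oplus>\<^sub>k Y\<^sup>k \<otimes> Z\<^sup>n\<^sup>-\<^sup>i\<^sup>-\<^sup>k)\<close>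
  of the inverses of the arrows \<open>\<sigma>\<close>, the regrouping \<open>m = i + k\<close>, the associators of the given
  category, and the arrows \<open>\<tau>\<close>.
\<close>

definition complex_assoc ::
    "('r, 'y) ring_scheme \<Rightarrow> ('o, 'm, 'r, 'x) linear_monoidal_category_scheme \<Rightarrow> 'r \<Rightarrow>
      ((int \<Rightarrow> 'o) \<Rightarrow> 'o) \<Rightarrow> ((int \<Rightarrow> 'o) \<Rightarrow> int \<Rightarrow> 'm) \<Rightarrow>
      ('o, 'm) ncomplex \<Rightarrow> ('o, 'm) ncomplex \<Rightarrow> ('o, 'm) ncomplex \<Rightarrow> ('o, 'm) chain_map"
  where "complex_assoc R C \<xi> S \<iota> X Y Z = (
    let XY = complex_tensor_obj R C \<xi> S \<iota> X Y;
        YZ = complex_tensor_obj R C \<xi> S \<iota> Y Z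
    in \<lparr>
      src = complex_tensor_obj R C \<xi> S \<iota> XY Z,
      tgt = complex_tensor_obj R C \<xi> S \<iota> X YZ,
      comps = (\<lambda>n.
        let A = (\<lambda>m i. (ob X i \<otimes>\<^sub>o\<^bsub>C\<^esub> ob Y (m - i)) \<otimes>\<^sub>o\<^bsub>C\<^esub> ob Z (n - m));
            B = (\<lambda>i k. (ob X i \<otimes>\<^sub>o\<^bsub>C\<^esub> ob Y k) \<otimes>\<^sub>o\<^bsub>C\<^esub> ob Z (n - i - k));
            D = (\<lambda>i k. ob X i \<otimes>\<^sub>o\<^bsub>C\<^esub> (ob Y k \<otimes>\<^sub>o\<^bsub>C\<^esub> ob Z (n - i - k)));
            expand = coprod_map C S \<iota> (summands C XY Z n) (\<lambda>m. S (A m))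
              (\<lambda>m. inv_arrow C (sigma C S \<iota> (summands C X Y m) (ob Z (n - m))));
            regroup = coprod_copair C S \<iota> (\<lambda>m. S (A m)) (S (\<lambda>i. S (B i)))
              (\<lambda>m. coprod_copair C S \<iota> (A m) (S (\<lambda>i. S (B i)))
                (\<lambda>i. \<iota> (\<lambda>i. S (B i)) i \<cdot>\<^bsub>C\<^esub> \<iota> (B i) (m - i)));
            reassoc = coprod_map C S \<iota> (\<lambda>i. S (B i)) (\<lambda>i. S (D i))
              (\<lambda>i. coprod_map C S \<iota> (B i) (D i)
                (\<lambda>k. assoc C (ob X i) (ob Y k) (ob Z (n - i - k))));
            collect = coprod_map C S \<iota> (\<lambda>i. S (D i)) (summands C X YZ n)
              (\<lambda>i. tau C S \<iota> (ob X i) (summands C Y Z (n - i)))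
        in collect \<cdot>\<^bsub>C\<^esub> reassoc \<cdot>\<^bsub>C\<^esub> regroup \<cdot>\<^bsub>C\<^esub> expand)\<rparr>)"

text \<open>
  In degree \<open>j\<close> the only summand of \<open>\<I> \<otimes> X\<close> that is not a zero object is \<open>\<I> \<otimes> X\<^sup>j\<close> (index \<open>0\<close>),
  and the only such summand of \<open>X \<otimes> \<I>\<close> is \<open>X\<^sup>j \<otimes> \<I>\<close> (index \<open>j\<close>).
\<close>

definition complex_lunit ::
    "('r, 'y) ring_scheme \<Rightarrow> ('o, 'm, 'r, 'x) linear_monoidal_category_scheme \<Rightarrow> 'r \<Rightarrow>
      ((int \<Rightarrow> 'o) \<Rightarrow> 'o) \<Rightarrow> ((int \<Rightarrow> 'o) \<Rightarrow> int \<Rightarrow> 'm) \<Rightarrow> 'o \<Rightarrow>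
      ('o, 'm) ncomplex \<Rightarrow> ('o, 'm) chain_map"
  where "complex_lunit R C \<xi> S \<iota> Z0 X = \<lparr>
    src = complex_tensor_obj R C \<xi> S \<iota> (complex_unit C Z0) X,
    tgt = X,
    comps = (\<lambda>j. let W = summands C (complex_unit C Z0) X j in
      coprod_copair C S \<iota> W (ob X j)
        (\<lambda>i. if i = 0 then lunit C (ob X j) else mzero C (W i) (ob X j)))\<rparr>"

definition complex_runit ::
    "('r, 'y) ring_scheme \<Rightarrow> ('o, 'm, 'r, 'x) linear_monoidal_category_scheme \<Rightarrow> 'r \<Rightarrow>
      ((int \<Rightarrow> 'o) \<Rightarrow> 'o) \<Rightarrow> ((int \<Rightarrow> 'o) \<Rightarrow> int \<Rightarrow> 'm) \<Rightarrow> 'o \<Rightarrow>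
      ('o, 'm) ncomplex \<Rightarrow> ('o, 'm) chain_map"
  where "complex_runit R C \<xi> S \<iota> Z0 X = \<lparr>
    src = complex_tensor_obj R C \<xi> S \<iota> X (complex_unit C Z0),
    tgt = X,
    comps = (\<lambda>j. let W = summands C X (complex_unit C Z0) j in
      coprod_copair C S \<iota> W (ob X j)
        (\<lambda>i. if i = j then runit C (ob X j) else mzero C (W i) (ob X j)))\<rparr>"

definition ncomplexes_monoidal ::
    "('r, 'y) ring_scheme \<Rightarrow> ('o, 'm, 'r, 'x) linear_monoidal_category_scheme \<Rightarrow> nat \<Rightarrow> 'r \<Rightarrow>
      ((int \<Rightarrow> 'o) \<Rightarrow> 'o) \<Rightarrow> ((int \<Rightarrow> 'o) \<Rightarrow> int \<Rightarrow> 'm) \<Rightarrow> 'o \<Rightarrow>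
      (('o, 'm) ncomplex, ('o, 'm) chain_map) monoidal_category"
  where "ncomplexes_monoidal R C N \<xi> S \<iota> Z0 =
    preadditive_category.extend (ncomplexes C N) (monoidal_category.fields
      (complex_tensor_obj R C \<xi> S \<iota>)
      (complex_tensor_arr R C \<xi> S \<iota>)
      (complex_unit C Z0)
      (complex_assoc R C \<xi> S \<iota>)
      (complex_lunit R C \<xi> S \<iota> Z0)
      (complex_runit R C \<xi> S \<iota> Z0))"

end

theory Submission
  imports Defs
begin

text \<open>
  The differential of a tensor product of \<open>N\<close>-complexes is the sum of the operators \<open>A = d \<otimes> Id\<close> and
  \<open>B = \<xi>\<^sup>i (Id \<otimes> d)\<close>, which satisfy \<open>B A = \<xi> A B\<close>. The noncommutative binomial theorem expands
  \<open>(A + B)\<^sup>N\<close> with Gaussian binomial coefficients at \<open>\<xi>\<close> (\<open>tensor_dif_pow\<close>). The outer terms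
  vanish since both factors are \<open>N\<close>-complexes. The inner coefficients are zero or multiples of
  a prime that annihilates all arrows; this is the number-theoretic content of the twisted Leibniz
  rule (\<open>qbinomial_primitive_root\<close>, \<open>qbinomial_prime_power_multiple\<close>). So the tensor product is
  again an \<open>N\<close>-complex (\<open>is_ncomplex_tensor\<close>).

  Everything else is inherited from the base category degree by degree. Distributivity says that
  tensoring preserves coproducts. Hence iterated tensor products are coproducts of the iterated
  tensor products of the components, their inclusions are jointly epic, and every axiom can be
  checked on one summand, where it is the corresponding axiom of the base category. For the
  associator this rests on the description of its effect on summands (\<open>assoc_comps_props\<close>); the unit
  axioms only see the summands in which the unit complex has degree zero.

  Coproducts of complexes are degreewise (\<open>coproduct_M_degreewise\<close>). Distributivity for complexes
  therefore follows from distributivity in each degree and the fact that coproducts commute with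
  coproducts (\<open>tensor_M_coproduct\<close>).
\<close>

section \<open>Arrows, isomorphisms and coproducts\<close>

text \<open>
  Arrows are handled through \<open>Dom\<close> and \<open>Cod\<close> rather than through \<open>Hom\<close> sets: the source and
  target of a composite can then be computed by rewriting, which discharges the typing conditions
  of associativity and of all later rules.
\<close>

lemma in_Hom: "f \<in> Hom C A B \<longleftrightarrow> f \<in> Arr C \<and> Dom C f = A \<and> Cod C f = B"
  by (simp add: Hom_def)

context category
begin

lemma Dom_Obj [simp]: "f \<in> Arr C \<Longrightarrow> Dom C f \<in> Obj C"
  and Cod_Obj [simp]: "f \<in> Arr C \<Longrightarrow> Cod C f \<in> Obj C"
  by (simp_all add: Dom_closed Cod_closed)

lemma Idm_Arr [simp]: "A \<in> Obj C \<Longrightarrow> Idm C A \<in> Arr C"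
  and Idm_Dom [simp]: "A \<in> Obj C \<Longrightarrow> Dom C (Idm C A) = A"
  and Idm_Cod [simp]: "A \<in> Obj C \<Longrightarrow> Cod C (Idm C A) = A"
  using Idm_closed[of A] by (simp_all add: in_Hom)

lemma cmp_Arr [simp]: "\<lbrakk>f \<in> Arr C; g \<in> Arr C; Cod C f = Dom C g\<rbrakk> \<Longrightarrow> g \<cdot> f \<in> Arr C"
  and cmp_Dom [simp]: "\<lbrakk>f \<in> Arr C; g \<in> Arr C; Cod C f = Dom C g\<rbrakk> \<Longrightarrow> Dom C (g \<cdot> f) = Dom C f"
  and cmp_Cod [simp]: "\<lbrakk>f \<in> Arr C; g \<in> Arr C; Cod C f = Dom C g\<rbrakk> \<Longrightarrow> Cod C (g \<cdot> f) = Cod C g"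
  using cmp_closed[of f "Dom C f" "Cod C f" g "Cod C g"] by (simp_all add: in_Hom)

lemma Idm_cmp [simp]: "\<lbrakk>f \<in> Arr C; Cod C f = B\<rbrakk> \<Longrightarrow> Idm C B \<cdot> f = f"
  and cmp_Idm [simp]: "\<lbrakk>f \<in> Arr C; Dom C f = A\<rbrakk> \<Longrightarrow> f \<cdot> Idm C A = f"
  using Idm_left[of f "Dom C f" B] Idm_right[of f A "Cod C f"] by (simp_all add: in_Hom)

lemma cmp_cmp: "\<lbrakk>f \<in> Arr C; g \<in> Arr C; h \<in> Arr C; Cod C f = Dom C g; Cod C g = Dom C h\<rbrakk>
    \<Longrightarrow> (h \<cdot> g) \<cdot> f = h \<cdot> (g \<cdot> f)"
  using cmp_assoc[of f "Dom C f" "Cod C f" g "Cod C g" h "Cod C h"] by (simp add: in_Hom)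

lemma is_isoI:
  assumes "f \<in> Hom C A B" "g \<in> Hom C B A" "g \<cdot> f = Idm C A" "f \<cdot> g = Idm C B"
  shows "is_iso C f"
  using assms unfolding is_iso_def inverse_arrows_def by (auto simp: in_Hom)

lemma inverse_arrows_unique:
  assumes "inverse_arrows C f g" "inverse_arrows C f h"
  shows "g = h"
proof -
  have "g = g \<cdot> (f \<cdot> h)" "h = (g \<cdot> f) \<cdot> h"
    using assms by (auto simp: inverse_arrows_def in_Hom)
  moreover have "(g \<cdot> f) \<cdot> h = g \<cdot> (f \<cdot> h)"
    using assms by (intro cmp_cmp) (auto simp: inverse_arrows_def in_Hom)
  ultimately show ?thesis by simp
qed

lemma inverse_arrows_inv_arrow: "is_iso C f \<Longrightarrow> inverse_arrows C f (inv_arrow C f)"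
  unfolding is_iso_def inv_arrow_def by (rule theI') (blast intro: inverse_arrows_unique)

lemma inv_arrow_Arr [simp]: "is_iso C f \<Longrightarrow> inv_arrow C f \<in> Arr C"
  and inv_arrow_Dom [simp]: "is_iso C f \<Longrightarrow> Dom C (inv_arrow C f) = Cod C f"
  and inv_arrow_Cod [simp]: "is_iso C f \<Longrightarrow> Cod C (inv_arrow C f) = Dom C f"
  and inv_arrow_cmp [simp]: "is_iso C f \<Longrightarrow> inv_arrow C f \<cdot> f = Idm C (Dom C f)"
  and cmp_inv_arrow [simp]: "is_iso C f \<Longrightarrow> f \<cdot> inv_arrow C f = Idm C (Cod C f)"
  and is_iso_Arr: "is_iso C f \<Longrightarrow> f \<in> Arr C"
  using inverse_arrows_inv_arrow[of f] by (simp_all add: inverse_arrows_def in_Hom)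

lemma is_coproductI:
  assumes "P \<in> Obj C"
    and "\<And>i. i \<in> I \<Longrightarrow> \<iota> i \<in> Hom C (Y i) P"
    and "\<And>T f. \<lbrakk>T \<in> Obj C; \<And>i. i \<in> I \<Longrightarrow> f i \<in> Hom C (Y i) T\<rbrakk>
      \<Longrightarrow> \<exists>h \<in> Hom C P T. \<forall>i \<in> I. h \<cdot> \<iota> i = f i"
    and "\<And>T h h'. \<lbrakk>h \<in> Hom C P T; h' \<in> Hom C P T; \<And>i. i \<in> I \<Longrightarrow> h \<cdot> \<iota> i = h' \<cdot> \<iota> i\<rbrakk> \<Longrightarrow> h = h'"
  shows "is_coproduct C I Y P \<iota>"
proof -
  have "Y i \<in> Obj C" if "i \<in> I" for i
    using assms(2)[OF that] Dom_Obj[of "\<iota> i"] by (simp add: in_Hom)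
  moreover have "\<exists>!h. h \<in> Hom C P T \<and> (\<forall>i \<in> I. h \<cdot> \<iota> i = f i)"
    if "T \<in> Obj C" "\<forall>i \<in> I. f i \<in> Hom C (Y i) T" for T f
  proof -
    have "\<exists>h \<in> Hom C P T. \<forall>i \<in> I. h \<cdot> \<iota> i = f i"
      by (rule assms(3)) (use that in auto)
    then obtain h where "h \<in> Hom C P T" "\<forall>i \<in> I. h \<cdot> \<iota> i = f i" by blast
    then show ?thesis
      using assms(4)[of _ T] by (intro ex1I[of _ h]) auto
  qed
  ultimately show ?thesis
    using assms(1,2) unfolding is_coproduct_def by auto
qed

lemma coproduct_Obj: "is_coproduct C I Y P \<iota> \<Longrightarrow> P \<in> Obj C"
  and coproduct_summand_Obj: "\<lbrakk>is_coproduct C I Y P \<iota>; i \<in> I\<rbrakk> \<Longrightarrow> Y i \<in> Obj C"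
  and coproduct_incl: "\<lbrakk>is_coproduct C I Y P \<iota>; i \<in> I\<rbrakk> \<Longrightarrow> \<iota> i \<in> Hom C (Y i) P"
  and coproduct_incl_Arr: "\<lbrakk>is_coproduct C I Y P \<iota>; i \<in> I\<rbrakk> \<Longrightarrow> \<iota> i \<in> Arr C"
  and coproduct_incl_Dom: "\<lbrakk>is_coproduct C I Y P \<iota>; i \<in> I\<rbrakk> \<Longrightarrow> Dom C (\<iota> i) = Y i"
  and coproduct_incl_Cod: "\<lbrakk>is_coproduct C I Y P \<iota>; i \<in> I\<rbrakk> \<Longrightarrow> Cod C (\<iota> i) = P"
  by (auto simp: is_coproduct_def in_Hom)

lemma coproduct_UP:
  assumes "is_coproduct C I Y P \<iota>" "T \<in> Obj C" "\<And>i. i \<in> I \<Longrightarrow> f i \<in> Hom C (Y i) T"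
  shows "\<exists>!h. h \<in> Hom C P T \<and> (\<forall>i \<in> I. h \<cdot> \<iota> i = f i)"
proof -
  have "\<forall>f. (\<forall>i \<in> I. f i \<in> Hom C (Y i) T) \<longrightarrow> (\<exists>!h. h \<in> Hom C P T \<and> (\<forall>i \<in> I. h \<cdot> \<iota> i = f i))"
    using assms(1,2) unfolding is_coproduct_def by blast
  from this[THEN spec, of f] show ?thesis using assms(3) by simp
qed

lemma coproduct_ext:
  assumes P: "is_coproduct C I Y P \<iota>" and h: "h \<in> Hom C P T" "h' \<in> Hom C P T"
    and eq: "\<And>i. i \<in> I \<Longrightarrow> h \<cdot> \<iota> i = h' \<cdot> \<iota> i"
  shows "h = h'"
proof -
  have T: "T \<in> Obj C" using h(1) Cod_Obj[of h] by (simp add: in_Hom)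
  have "\<And>i. i \<in> I \<Longrightarrow> h' \<cdot> \<iota> i \<in> Hom C (Y i) T"
    using cmp_closed[OF coproduct_incl[OF P] h(2)] .
  then have "\<exists>!k. k \<in> Hom C P T \<and> (\<forall>i \<in> I. k \<cdot> \<iota> i = h' \<cdot> \<iota> i)"
    by (rule coproduct_UP[OF P T])
  then show ?thesis using h eq by (elim ex1E) metis
qed

lemma copair_props:
  assumes "is_coproduct C I Y P \<iota>" "T \<in> Obj C" "\<And>i. i \<in> I \<Longrightarrow> f i \<in> Hom C (Y i) T"
  shows "copair C I P \<iota> T f \<in> Hom C P T" "i \<in> I \<Longrightarrow> copair C I P \<iota> T f \<cdot> \<iota> i = f i"
  using theI'[OF coproduct_UP[OF assms]] unfolding copair_def by blast+

lemma is_coproduct_cong: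
  assumes "is_coproduct C I Y P \<iota>" "\<And>i. i \<in> I \<Longrightarrow> Y i = Y' i" "\<And>i. i \<in> I \<Longrightarrow> \<iota> i = \<iota>' i"
  shows "is_coproduct C I Y' P \<iota>'"
  using assms unfolding is_coproduct_def by (simp cong: ball_cong)

text \<open>
  An arrow that carries one coproduct cocone to another is invertible. This is how the associator and
  the distributivity arrows are recognised as isomorphisms.
\<close>

lemma copair_iso:
  assumes P: "is_coproduct C I Y P \<iota>" and Q: "is_coproduct C I Y Q \<kappa>"
  shows "is_iso C (copair C I P \<iota> Q \<kappa>)"
proof -
  let ?f = "copair C I P \<iota> Q \<kappa>" and ?g = "copair C I Q \<kappa> P \<iota>"
  note f = copair_props[OF P coproduct_Obj[OF Q] coproduct_incl[OF Q]]
  note g = copair_props[OF Q coproduct_Obj[OF P] coproduct_incl[OF P]]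
  note inc = coproduct_incl[OF P] coproduct_incl[OF Q]
  have "?g \<cdot> ?f = Idm C P"
  proof (rule coproduct_ext[OF P])
    show "?g \<cdot> ?f \<in> Hom C P P" "Idm C P \<in> Hom C P P"
      using f g coproduct_Obj[OF P] by (auto intro: cmp_closed Idm_closed)
    show "?g \<cdot> ?f \<cdot> \<iota> i = Idm C P \<cdot> \<iota> i" if "i \<in> I" for i
      using f g inc[OF that] that by (simp add: in_Hom cmp_cmp)
  qed
  moreover have "?f \<cdot> ?g = Idm C Q"
  proof (rule coproduct_ext[OF Q])
    show "?f \<cdot> ?g \<in> Hom C Q Q" "Idm C Q \<in> Hom C Q Q"
      using f g coproduct_Obj[OF Q] by (auto intro: cmp_closed Idm_closed)
    show "?f \<cdot> ?g \<cdot> \<kappa> i = Idm C Q \<cdot> \<kappa> i" if "i \<in> I" for i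
      using f g inc[OF that] that by (simp add: in_Hom cmp_cmp)
  qed
  ultimately show ?thesis
    using f(1) g(1) by (intro is_isoI)
qed

lemma coproduct_iso_target:
  assumes P: "is_coproduct C I Y P \<iota>" and u: "is_iso C u" "Dom C u = P"
  shows "is_coproduct C I Y (Cod C u) (\<lambda>i. u \<cdot> \<iota> i)"
proof (rule is_coproductI)
  note [simp] = is_iso_Arr[OF u(1)] u and inc = coproduct_incl[OF P]
  show "Cod C u \<in> Obj C" by simp
  show "u \<cdot> \<iota> i \<in> Hom C (Y i) (Cod C u)" if "i \<in> I" for i
    using inc[OF that] by (simp add: in_Hom)
  show "\<exists>h \<in> Hom C (Cod C u) T. \<forall>i \<in> I. h \<cdot> (u \<cdot> \<iota> i) = f i"
    if "T \<in> Obj C" "\<And>i. i \<in> I \<Longrightarrow> f i \<in> Hom C (Y i) T" for T f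
  proof (intro bexI ballI)
    note h = copair_props[OF P that]
    let ?h = "copair C I P \<iota> T f"
    show "?h \<cdot> inv_arrow C u \<in> Hom C (Cod C u) T"
      using h by (simp add: in_Hom)
    fix i assume i: "i \<in> I"
    have "inv_arrow C u \<cdot> (u \<cdot> \<iota> i) = (inv_arrow C u \<cdot> u) \<cdot> \<iota> i"
      by (subst cmp_cmp) (use inc[OF i] in \<open>simp_all add: in_Hom\<close>)
    then show "?h \<cdot> inv_arrow C u \<cdot> (u \<cdot> \<iota> i) = f i"
      using h i inc[OF i] by (simp add: in_Hom cmp_cmp)
  qed
  show "h = h'" if h: "h \<in> Hom C (Cod C u) T" "h' \<in> Hom C (Cod C u) T"
    and eq: "\<And>i. i \<in> I \<Longrightarrow> h \<cdot> (u \<cdot> \<iota> i) = h' \<cdot> (u \<cdot> \<iota> i)" for T h h'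
  proof -
    have "h \<cdot> u = h' \<cdot> u"
    proof (rule coproduct_ext[OF P])
      show "h \<cdot> u \<in> Hom C P T" "h' \<cdot> u \<in> Hom C P T" using h by (auto simp: in_Hom)
      show "h \<cdot> u \<cdot> \<iota> i = h' \<cdot> u \<cdot> \<iota> i" if "i \<in> I" for i
        using eq[OF that] h inc[OF that] by (simp add: in_Hom cmp_cmp)
    qed
    then have "h \<cdot> u \<cdot> inv_arrow C u = h' \<cdot> u \<cdot> inv_arrow C u" by simp
    then show ?thesis using h by (simp add: in_Hom cmp_cmp)
  qed
qed

lemma coproduct_iso_summands:
  assumes P: "is_coproduct C I Y P \<iota>"
    and a: "\<And>i. i \<in> I \<Longrightarrow> is_iso C (a i) \<and> Cod C (a i) = Y i"
  shows "is_coproduct C I (\<lambda>i. Dom C (a i)) P (\<lambda>i. \<iota> i \<cdot> a i)"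
proof (rule is_coproductI)
  note inc = coproduct_incl[OF P]
  have aArr: "a i \<in> Arr C" if "i \<in> I" for i using a[OF that] is_iso_Arr by blast
  show "P \<in> Obj C" by (rule coproduct_Obj[OF P])
  show "\<iota> i \<cdot> a i \<in> Hom C (Dom C (a i)) P" if "i \<in> I" for i
    using inc[OF that] a[OF that] aArr[OF that] by (simp add: in_Hom)
  show "\<exists>h \<in> Hom C P T. \<forall>i \<in> I. h \<cdot> (\<iota> i \<cdot> a i) = f i"
    if "T \<in> Obj C" and f: "\<And>i. i \<in> I \<Longrightarrow> f i \<in> Hom C (Dom C (a i)) T" for T f
  proof (intro bexI ballI)
    let ?f = "\<lambda>i. f i \<cdot> inv_arrow C (a i)"
    have f': "?f i \<in> Hom C (Y i) T" if "i \<in> I" for i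
      using f[OF that] a[OF that] by (simp add: in_Hom)
    note h = copair_props[OF P \<open>T \<in> Obj C\<close> f']
    show "copair C I P \<iota> T ?f \<in> Hom C P T" by (rule h)
    fix i assume i: "i \<in> I"
    have "copair C I P \<iota> T ?f \<cdot> (\<iota> i \<cdot> a i) = (copair C I P \<iota> T ?f \<cdot> \<iota> i) \<cdot> a i"
      using h inc[OF i] a[OF i] aArr[OF i] by (simp add: in_Hom cmp_cmp)
    also have "\<dots> = f i"
      using h i f[OF i] a[OF i] aArr[OF i] by (simp add: in_Hom cmp_cmp)
    finally show "copair C I P \<iota> T ?f \<cdot> (\<iota> i \<cdot> a i) = f i" .
  qed
  show "h = h'" if h: "h \<in> Hom C P T" "h' \<in> Hom C P T"
    and eq: "\<And>i. i \<in> I \<Longrightarrow> h \<cdot> (\<iota> i \<cdot> a i) = h' \<cdot> (\<iota> i \<cdot> a i)" for T h h'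
  proof (rule coproduct_ext[OF P h])
    fix i assume i: "i \<in> I"
    have "h \<cdot> (\<iota> i \<cdot> a i) \<cdot> inv_arrow C (a i) = h' \<cdot> (\<iota> i \<cdot> a i) \<cdot> inv_arrow C (a i)"
      using eq[OF i] by simp
    then show "h \<cdot> \<iota> i = h' \<cdot> \<iota> i"
      using h inc[OF i] a[OF i] aArr[OF i] by (simp add: in_Hom cmp_cmp)
  qed
qed

text \<open>
  Allows a coproduct indexed by \<open>i\<close> alone to be read as one over the pairs \<open>(i, j)\<close> with
  \<open>i + j = n\<close>, which is the natural index set for the tensor product.
\<close>

lemma coproduct_reindex:
  assumes P: "is_coproduct C I Y P \<iota>" and b: "bij_betw b J I"
  shows "is_coproduct C J (\<lambda>j. Y (b j)) P (\<lambda>j. \<iota> (b j))"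
proof (rule is_coproductI)
  have bI: "b j \<in> I" if "j \<in> J" for j using b that by (auto simp: bij_betw_def)
  note inc = coproduct_incl[OF P]
  show "P \<in> Obj C" by (rule coproduct_Obj[OF P])
  show "\<iota> (b j) \<in> Hom C (Y (b j)) P" if "j \<in> J" for j
    by (rule inc[OF bI[OF that]])
  let ?c = "the_inv_into J b"
  have c: "?c i \<in> J" "b (?c i) = i" if "i \<in> I" for i
    using that b by (auto simp: bij_betw_def f_the_inv_into_f the_inv_into_into)
  have cb: "?c (b j) = j" if "j \<in> J" for j
    using that b by (auto simp: bij_betw_def the_inv_into_f_f)
  show "\<exists>h \<in> Hom C P T. \<forall>j \<in> J. h \<cdot> \<iota> (b j) = f j"
    if "T \<in> Obj C" and f: "\<And>j. j \<in> J \<Longrightarrow> f j \<in> Hom C (Y (b j)) T" for T f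
  proof (intro bexI ballI)
    have f': "f (?c i) \<in> Hom C (Y i) T" if "i \<in> I" for i
      using f[of "?c i"] c[OF that] by simp
    note h = copair_props[OF P \<open>T \<in> Obj C\<close> f']
    show "copair C I P \<iota> T (\<lambda>i. f (?c i)) \<in> Hom C P T" by (rule h)
    show "copair C I P \<iota> T (\<lambda>i. f (?c i)) \<cdot> \<iota> (b j) = f j" if "j \<in> J" for j
      using h(2)[OF _ bI[OF that]] cb[OF that] by simp
  qed
  show "h = h'" if h: "h \<in> Hom C P T" "h' \<in> Hom C P T"
    and eq: "\<And>j. j \<in> J \<Longrightarrow> h \<cdot> \<iota> (b j) = h' \<cdot> \<iota> (b j)" for T h h'
    by (rule coproduct_ext[OF P h]) (use c eq in metis)
qed

lemma coproduct_iterate: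
  assumes P: "is_coproduct C A Q P \<kappa>"
    and Q: "\<And>a. a \<in> A \<Longrightarrow> is_coproduct C (B a) (F a) (Q a) (\<iota> a)"
  shows "is_coproduct C (Sigma A B) (\<lambda>(a, b). F a b) P (\<lambda>(a, b). \<kappa> a \<cdot> \<iota> a b)"
proof (rule is_coproductI)
  note kap = coproduct_incl[OF P] and iot = coproduct_incl[OF Q]
  show "P \<in> Obj C" by (rule coproduct_Obj[OF P])
  show "(case x of (a, b) \<Rightarrow> \<kappa> a \<cdot> \<iota> a b) \<in> Hom C (case x of (a, b) \<Rightarrow> F a b) P"
    if "x \<in> Sigma A B" for x
    using that kap iot by (auto simp: in_Hom)
  show "\<exists>h \<in> Hom C P T. \<forall>x \<in> Sigma A B. h \<cdot> (case x of (a, b) \<Rightarrow> \<kappa> a \<cdot> \<iota> a b) = f x"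
    if T: "T \<in> Obj C" and f: "\<And>x. x \<in> Sigma A B \<Longrightarrow> f x \<in> Hom C (case x of (a, b) \<Rightarrow> F a b) T" for T f
  proof (intro bexI ballI)
    have f': "f (a, b) \<in> Hom C (F a b) T" if "a \<in> A" "b \<in> B a" for a b
      using f[of "(a, b)"] that by simp
    let ?g = "\<lambda>a. copair C (B a) (Q a) (\<iota> a) T (\<lambda>b. f (a, b))"
    note g = copair_props[OF Q T f']
    note h = copair_props[OF P T g(1)]
    let ?h = "copair C A P \<kappa> T ?g"
    show "?h \<in> Hom C P T" by (rule h) auto
    fix x assume "x \<in> Sigma A B"
    then obtain a b where x: "x = (a, b)" "a \<in> A" "b \<in> B a" by blast
    have "?h \<cdot> (\<kappa> a \<cdot> \<iota> a b) = (?h \<cdot> \<kappa> a) \<cdot> \<iota> a b"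
      using h kap[OF x(2)] iot[OF x(2,3)] by (simp add: in_Hom cmp_cmp)
    also have "\<dots> = f (a, b)" using h(2) g(2) x(2,3) by simp
    finally show "?h \<cdot> (case x of (a, b) \<Rightarrow> \<kappa> a \<cdot> \<iota> a b) = f x" using x by simp
  qed
  show "h = h'" if h: "h \<in> Hom C P T" "h' \<in> Hom C P T"
    and eq: "\<And>x. x \<in> Sigma A B \<Longrightarrow>
      h \<cdot> (case x of (a, b) \<Rightarrow> \<kappa> a \<cdot> \<iota> a b) = h' \<cdot> (case x of (a, b) \<Rightarrow> \<kappa> a \<cdot> \<iota> a b)" for T h h'
  proof (rule coproduct_ext[OF P h])
    fix a assume a: "a \<in> A"
    show "h \<cdot> \<kappa> a = h' \<cdot> \<kappa> a"
    proof (rule coproduct_ext[OF Q[OF a]])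
      show "h \<cdot> \<kappa> a \<in> Hom C (Q a) T" "h' \<cdot> \<kappa> a \<in> Hom C (Q a) T"
        using h kap[OF a] by (auto simp: in_Hom)
      show "h \<cdot> \<kappa> a \<cdot> \<iota> a b = h' \<cdot> \<kappa> a \<cdot> \<iota> a b" if "b \<in> B a" for b
        using eq[of "(a, b)"] a that h kap[OF a] iot[OF a that] by (simp add: in_Hom cmp_cmp)
    qed
  qed
qed

text \<open>
  Coproducts commute with coproducts: if \<open>F a j\<close> is summed over \<open>j\<close> to \<open>Q a\<close> and over \<open>a\<close> to \<open>L j\<close>,
  then a coproduct \<open>P\<close> of the \<open>L j\<close> is also one of the \<open>Q a\<close>. It transfers distributivity from the
  summands of a tensor product of complexes to the tensor product itself.
\<close>

lemma coproduct_interchange: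
  assumes P: "is_coproduct C J L P \<nu>"
    and L: "\<And>j. j \<in> J \<Longrightarrow> is_coproduct C I (\<lambda>a. F a j) (L j) (\<mu> j)"
    and Q: "\<And>a. a \<in> I \<Longrightarrow> is_coproduct C J (F a) (Q a) (\<kappa> a)"
    and k: "\<And>a. a \<in> I \<Longrightarrow> k a \<in> Hom C (Q a) P"
    and comm: "\<And>a j. \<lbrakk>a \<in> I; j \<in> J\<rbrakk> \<Longrightarrow> k a \<cdot> \<kappa> a j = \<nu> j \<cdot> \<mu> j a"
  shows "is_coproduct C I Q P k"
proof (rule is_coproductI)
  note lam = coproduct_incl[OF P] and mu = coproduct_incl[OF L] and kap = coproduct_incl[OF Q]
  show "P \<in> Obj C" by (rule coproduct_Obj[OF P])
  show "k a \<in> Hom C (Q a) P" if "a \<in> I" for a by (rule k[OF that])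
  show "\<exists>h \<in> Hom C P T. \<forall>a \<in> I. h \<cdot> k a = f a"
    if T: "T \<in> Obj C" and f: "\<And>a. a \<in> I \<Longrightarrow> f a \<in> Hom C (Q a) T" for T f
  proof (intro bexI ballI)
    have fk: "f a \<cdot> \<kappa> a j \<in> Hom C (F a j) T" if "j \<in> J" "a \<in> I" for a j
      using f[of a] kap[of a j] that by (simp add: in_Hom)
    let ?g = "\<lambda>j. copair C I (L j) (\<mu> j) T (\<lambda>a. f a \<cdot> \<kappa> a j)"
    note g = copair_props[OF L T fk]
    note h = copair_props[OF P T g(1)]
    let ?h = "copair C J P \<nu> T ?g"
    have hP: "?h \<in> Hom C P T" by (rule h) auto
    show "?h \<in> Hom C P T" by (rule hP)
    fix a assume a: "a \<in> I"
    show "?h \<cdot> k a = f a"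
    proof (rule coproduct_ext[OF Q[OF a]])
      show "?h \<cdot> k a \<in> Hom C (Q a) T" using hP k[OF a] by (simp add: in_Hom)
      show "f a \<in> Hom C (Q a) T" by (rule f[OF a])
      fix j assume j: "j \<in> J"
      have "?h \<cdot> k a \<cdot> \<kappa> a j = ?h \<cdot> (\<nu> j \<cdot> \<mu> j a)"
        using hP k[OF a] kap[OF a j] comm[OF a j] by (simp add: in_Hom cmp_cmp)
      also have "\<dots> = (?h \<cdot> \<nu> j) \<cdot> \<mu> j a"
        using hP lam[OF j] mu[OF j a] by (simp add: in_Hom cmp_cmp)
      also have "\<dots> = f a \<cdot> \<kappa> a j"
        using h(2) g(2) a j by simp
      finally show "?h \<cdot> k a \<cdot> \<kappa> a j = f a \<cdot> \<kappa> a j" .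
    qed
  qed
  show "h = h'" if h: "h \<in> Hom C P T" "h' \<in> Hom C P T"
    and eq: "\<And>a. a \<in> I \<Longrightarrow> h \<cdot> k a = h' \<cdot> k a" for T h h'
  proof (rule coproduct_ext[OF P h])
    fix j assume j: "j \<in> J"
    show "h \<cdot> \<nu> j = h' \<cdot> \<nu> j"
    proof (rule coproduct_ext[OF L[OF j]])
      show "h \<cdot> \<nu> j \<in> Hom C (L j) T" "h' \<cdot> \<nu> j \<in> Hom C (L j) T"
        using h lam[OF j] by (auto simp: in_Hom)
      fix a assume a: "a \<in> I"
      have "g \<cdot> \<nu> j \<cdot> \<mu> j a = (g \<cdot> k a) \<cdot> \<kappa> a j" if "g \<in> Hom C P T" for g
        using that lam[OF j] mu[OF j a] k[OF a] kap[OF a j] comm[OF a j]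
        by (simp add: in_Hom cmp_cmp)
      then show "h \<cdot> \<nu> j \<cdot> \<mu> j a = h' \<cdot> \<nu> j \<cdot> \<mu> j a" using h eq[OF a] by simp
    qed
  qed
qed

end

section \<open>Preadditive, monoidal and linear categories\<close>

context preadditive_category
begin

lemma hom_group_sel [simp]:
  "carrier (hom_group C A B) = Hom C A B" "add (hom_group C A B) = madd C"
  "zero (hom_group C A B) = mzero C A B"
  by (simp_all add: hom_group_def)

lemma mzero_Arr [simp]: "\<lbrakk>A \<in> Obj C; B \<in> Obj C\<rbrakk> \<Longrightarrow> mzero C A B \<in> Arr C"
  and mzero_Dom [simp]: "\<lbrakk>A \<in> Obj C; B \<in> Obj C\<rbrakk> \<Longrightarrow> Dom C (mzero C A B) = A"
  and mzero_Cod [simp]: "\<lbrakk>A \<in> Obj C; B \<in> Obj C\<rbrakk> \<Longrightarrow> Cod C (mzero C A B) = B"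
  using abelian_group.axioms(1)[OF hom_abelian, THEN abelian_monoid.zero_closed, of A B]
  by (simp_all add: in_Hom)

lemma madd_Hom: "\<lbrakk>f \<in> Hom C A B; g \<in> Hom C A B\<rbrakk> \<Longrightarrow> madd C f g \<in> Hom C A B"
proof -
  assume f: "f \<in> Hom C A B" and g: "g \<in> Hom C A B"
  then have "A \<in> Obj C" "B \<in> Obj C" by (auto simp: in_Hom)
  then interpret abelian_group "hom_group C A B" by (rule hom_abelian)
  show ?thesis using a_closed[of f g] f g by simp
qed

lemma madd_Arr [simp]:
    "\<lbrakk>f \<in> Arr C; g \<in> Arr C; Dom C g = Dom C f; Cod C g = Cod C f\<rbrakk> \<Longrightarrow> madd C f g \<in> Arr C"
  and madd_Dom [simp]:
    "\<lbrakk>f \<in> Arr C; g \<in> Arr C; Dom C g = Dom C f; Cod C g = Cod C f\<rbrakk> \<Longrightarrow> Dom C (madd C f g) = Dom C f"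
  and madd_Cod [simp]:
    "\<lbrakk>f \<in> Arr C; g \<in> Arr C; Dom C g = Dom C f; Cod C g = Cod C f\<rbrakk> \<Longrightarrow> Cod C (madd C f g) = Cod C f"
  using madd_Hom[of f "Dom C f" "Cod C f" g] by (simp_all add: in_Hom)

lemma madd_cmp: "\<lbrakk>f \<in> Arr C; g \<in> Arr C; h \<in> Arr C; Cod C f = Dom C g; Dom C h = Dom C g; Cod C h = Cod C g\<rbrakk>
    \<Longrightarrow> madd C g h \<cdot> f = madd C (g \<cdot> f) (h \<cdot> f)"
  using cmp_madd_left[of f "Dom C f" "Dom C g" g "Cod C g" h] by (simp add: in_Hom)

lemma cmp_madd: "\<lbrakk>f \<in> Arr C; g \<in> Arr C; h \<in> Arr C; Dom C g = Dom C f; Cod C g = Cod C f; Cod C f = Dom C h\<rbrakk>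
    \<Longrightarrow> h \<cdot> madd C f g = madd C (h \<cdot> f) (h \<cdot> g)"
  using cmp_madd_right[of f "Dom C f" "Cod C f" g h "Cod C h"] by (simp add: in_Hom)

lemma madd_assoc: "\<lbrakk>f \<in> Arr C; g \<in> Arr C; h \<in> Arr C; Dom C g = Dom C f; Cod C g = Cod C f;
    Dom C h = Dom C f; Cod C h = Cod C f\<rbrakk> \<Longrightarrow> madd C (madd C f g) h = madd C f (madd C g h)"
proof -
  assume a: "f \<in> Arr C" "g \<in> Arr C" "h \<in> Arr C" "Dom C g = Dom C f" "Cod C g = Cod C f"
    "Dom C h = Dom C f" "Cod C h = Cod C f"
  then interpret abelian_group "hom_group C (Dom C f) (Cod C f)" by (intro hom_abelian) simp_all
  show ?thesis using a_assoc[of f g h] a by (simp add: in_Hom)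
qed

lemma madd_commute: "\<lbrakk>f \<in> Arr C; g \<in> Arr C; Dom C g = Dom C f; Cod C g = Cod C f\<rbrakk>
    \<Longrightarrow> madd C f g = madd C g f"
proof -
  assume a: "f \<in> Arr C" "g \<in> Arr C" "Dom C g = Dom C f" "Cod C g = Cod C f"
  then interpret abelian_group "hom_group C (Dom C f) (Cod C f)" by (intro hom_abelian) simp_all
  show ?thesis using a_comm[of f g] a by (simp add: in_Hom)
qed

lemma madd_mzero [simp]: "\<lbrakk>f \<in> Arr C; Dom C f = A; Cod C f = B\<rbrakk> \<Longrightarrow> madd C f (mzero C A B) = f"
  and mzero_madd [simp]: "\<lbrakk>f \<in> Arr C; Dom C f = A; Cod C f = B\<rbrakk> \<Longrightarrow> madd C (mzero C A B) f = f"
proof -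
  assume a: "f \<in> Arr C" "Dom C f = A" "Cod C f = B"
  then interpret abelian_group "hom_group C A B" by (intro hom_abelian) auto
  show "madd C f (mzero C A B) = f" "madd C (mzero C A B) f = f"
    using r_zero[of f] l_zero[of f] a by (simp_all add: in_Hom)
qed

text \<open>
  A biadditive operation sends zero to an arrow that equals its own double, hence to zero.
\<close>

lemma mzero_if_idem:
  assumes "f \<in> Arr C" "madd C f f = f"
  shows "f = mzero C (Dom C f) (Cod C f)"
proof -
  interpret abelian_group "hom_group C (Dom C f) (Cod C f)"
    using assms by (intro hom_abelian) simp_all
  show ?thesis using add.l_cancel_one[of f f] assms by (simp add: in_Hom)
qed

lemma cmp_mzero [simp]:
  assumes "A \<in> Obj C" "f \<in> Arr C" "Dom C f = B"
  shows "f \<cdot> mzero C A B = mzero C A (Cod C f)"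
proof -
  have B: "B \<in> Obj C" using assms by auto
  have "madd C (f \<cdot> mzero C A B) (f \<cdot> mzero C A B) = f \<cdot> madd C (mzero C A B) (mzero C A B)"
    using assms B by (subst cmp_madd) simp_all
  then have "madd C (f \<cdot> mzero C A B) (f \<cdot> mzero C A B) = f \<cdot> mzero C A B"
    using assms B by simp
  from mzero_if_idem[OF _ this] show ?thesis using assms B by simp
qed

lemma mzero_cmp [simp]:
  assumes "D \<in> Obj C" "f \<in> Arr C" "Cod C f = B"
  shows "mzero C B D \<cdot> f = mzero C (Dom C f) D"
proof -
  have B: "B \<in> Obj C" using assms by auto
  have "madd C (mzero C B D \<cdot> f) (mzero C B D \<cdot> f) = madd C (mzero C B D) (mzero C B D) \<cdot> f"
    using assms B by (subst madd_cmp) simp_all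
  then have "madd C (mzero C B D \<cdot> f) (mzero C B D \<cdot> f) = mzero C B D \<cdot> f"
    using assms B by simp
  from mzero_if_idem[OF _ this] show ?thesis using assms B by simp
qed

definition mneg :: "'m \<Rightarrow> 'm"
  where "mneg f = a_inv (hom_group C (Dom C f) (Cod C f)) f"

lemma mneg_Arr [simp]: "f \<in> Arr C \<Longrightarrow> mneg f \<in> Arr C"
  and mneg_Dom [simp]: "f \<in> Arr C \<Longrightarrow> Dom C (mneg f) = Dom C f"
  and mneg_Cod [simp]: "f \<in> Arr C \<Longrightarrow> Cod C (mneg f) = Cod C f"
  and madd_mneg [simp]: "f \<in> Arr C \<Longrightarrow> madd C f (mneg f) = mzero C (Dom C f) (Cod C f)"
proof -
  assume a: "f \<in> Arr C"
  then interpret abelian_group "hom_group C (Dom C f) (Cod C f)" by (intro hom_abelian) simp_all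
  have "f \<in> carrier (hom_group C (Dom C f) (Cod C f))" using a by (simp add: in_Hom)
  from a_inv_closed[OF this] r_neg[OF this]
  show "mneg f \<in> Arr C" "Dom C (mneg f) = Dom C f" "Cod C (mneg f) = Cod C f"
    "madd C f (mneg f) = mzero C (Dom C f) (Cod C f)"
    by (simp_all add: in_Hom mneg_def)
qed

lemma mneg_unique:
  assumes "f \<in> Arr C" "g \<in> Arr C" "Dom C g = Dom C f" "Cod C g = Cod C f"
    and "madd C f g = mzero C (Dom C f) (Cod C f)"
  shows "mneg f = g"
proof -
  interpret abelian_group "hom_group C (Dom C f) (Cod C f)"
    using assms by (intro hom_abelian) simp_all
  show ?thesis
    using minus_equality[of g f] madd_commute[of f g] assms
    by (simp add: in_Hom mneg_def)
qed

lemma mneg_cmp: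
  assumes "f \<in> Arr C" "g \<in> Arr C" "Cod C f = Dom C g"
  shows "mneg (g \<cdot> f) = mneg g \<cdot> f" "mneg (g \<cdot> f) = g \<cdot> mneg f"
proof -
  show "mneg (g \<cdot> f) = mneg g \<cdot> f"
    using assms by (intro mneg_unique) (simp_all flip: madd_cmp)
  show "mneg (g \<cdot> f) = g \<cdot> mneg f"
    using assms by (intro mneg_unique) (simp_all flip: cmp_madd)
qed

text \<open>
  This makes being a zero object an equation between arrows, so that it passes through tensor
  products and can be checked in each degree of a complex.
\<close>

lemma zero_object_iff:
  "zero_object C Z \<longleftrightarrow> Z \<in> Obj C \<and> Idm C Z = mzero C Z Z"
proof
  assume Z: "zero_object C Z"
  then have o: "Z \<in> Obj C" by (simp add: zero_object_def)
  with Z have "\<exists>!f. f \<in> Hom C Z Z" by (simp add: zero_object_def)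
  moreover have "Idm C Z \<in> Hom C Z Z" "mzero C Z Z \<in> Hom C Z Z" using o by (simp_all add: in_Hom)
  ultimately show "Z \<in> Obj C \<and> Idm C Z = mzero C Z Z" using o by blast
next
  assume Z: "Z \<in> Obj C \<and> Idm C Z = mzero C Z Z"
  have "\<exists>!f. f \<in> Hom C Z A" if "A \<in> Obj C" for A
  proof (rule ex1I)
    show "mzero C Z A \<in> Hom C Z A" using that Z by (simp add: in_Hom)
    show "f = mzero C Z A" if "f \<in> Hom C Z A" for f
      using that Z cmp_Idm[of f Z] cmp_mzero[of Z f Z] by (simp add: in_Hom)
  qed
  moreover have "\<exists>!f. f \<in> Hom C A Z" if "A \<in> Obj C" for A
  proof (rule ex1I)
    show "mzero C A Z \<in> Hom C A Z" using that Z by (simp add: in_Hom)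
    show "f = mzero C A Z" if "f \<in> Hom C A Z" for f
      using that Z Idm_cmp[of f Z] mzero_cmp[of Z f Z] by (simp add: in_Hom)
  qed
  ultimately show "zero_object C Z" using Z by (simp add: zero_object_def)
qed

lemma into_zero_object:
  assumes "zero_object C (Cod C f)" "f \<in> Arr C"
  shows "f = mzero C (Dom C f) (Cod C f)"
  using assms mzero_cmp[of "Cod C f" f "Cod C f"] Idm_cmp[of f "Cod C f"]
  by (simp add: zero_object_iff)

lemma from_zero_object:
  assumes "zero_object C (Dom C f)" "f \<in> Arr C"
  shows "f = mzero C (Dom C f) (Cod C f)"
  using assms cmp_mzero[of "Dom C f" f "Dom C f"] cmp_Idm[of f "Dom C f"]
  by (simp add: zero_object_iff)

lemma zero_objects_isomorphic:
  assumes "zero_object C A" "zero_object C B"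
  shows "isomorphic C A B"
  unfolding isomorphic_def
proof
  have AB: "A \<in> Obj C" "B \<in> Obj C" using assms by (simp_all add: zero_object_iff)
  then show "mzero C A B \<in> Hom C A B" by (simp add: in_Hom)
  show "is_iso C (mzero C A B)"
    by (rule is_isoI[of _ A B "mzero C B A"]) (use AB assms in \<open>simp_all add: in_Hom zero_object_iff\<close>)
qed

end

context monoidal_category
begin

lemma tensor_Obj [simp]: "\<lbrakk>X \<in> Obj C; Y \<in> Obj C\<rbrakk> \<Longrightarrow> X \<otimes>\<^sub>o Y \<in> Obj C"
  by (rule tensor_obj_closed)

lemma tensor_Arr [simp]: "\<lbrakk>f \<in> Arr C; g \<in> Arr C\<rbrakk> \<Longrightarrow> f \<otimes>\<^sub>a g \<in> Arr C"
  and tensor_Dom [simp]: "\<lbrakk>f \<in> Arr C; g \<in> Arr C\<rbrakk> \<Longrightarrow> Dom C (f \<otimes>\<^sub>a g) = Dom C f \<otimes>\<^sub>o Dom C g"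
  and tensor_Cod [simp]: "\<lbrakk>f \<in> Arr C; g \<in> Arr C\<rbrakk> \<Longrightarrow> Cod C (f \<otimes>\<^sub>a g) = Cod C f \<otimes>\<^sub>o Cod C g"
  using tensor_arr_closed[of f "Dom C f" "Cod C f" g "Dom C g" "Cod C g"] by (simp_all add: in_Hom)

lemma tensor_cmp_tensor: "\<lbrakk>f \<in> Arr C; f' \<in> Arr C; g \<in> Arr C; g' \<in> Arr C;
    Cod C f = Dom C f'; Cod C g = Dom C g'\<rbrakk>
    \<Longrightarrow> (f' \<otimes>\<^sub>a g') \<cdot> (f \<otimes>\<^sub>a g) = (f' \<cdot> f) \<otimes>\<^sub>a (g' \<cdot> g)"
  using tensor_cmp[of f "Dom C f" "Cod C f" f' "Cod C f'" g "Dom C g" "Cod C g" g' "Cod C g'"]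
  by (simp add: in_Hom)

lemma tensor_cmp_tensor_cmp: "\<lbrakk>f \<in> Arr C; f' \<in> Arr C; g \<in> Arr C; g' \<in> Arr C; h \<in> Arr C;
    Cod C f = Dom C f'; Cod C g = Dom C g'; Cod C h = Dom C f \<otimes>\<^sub>o Dom C g\<rbrakk>
    \<Longrightarrow> (f' \<otimes>\<^sub>a g') \<cdot> ((f \<otimes>\<^sub>a g) \<cdot> h) = ((f' \<cdot> f) \<otimes>\<^sub>a (g' \<cdot> g)) \<cdot> h"
  by (subst cmp_cmp[symmetric]) (simp_all add: tensor_cmp_tensor)

declare tensor_Idm [simp] unit_closed [simp]

lemma assoc_Arr [simp]: "\<lbrakk>X \<in> Obj C; Y \<in> Obj C; Z \<in> Obj C\<rbrakk> \<Longrightarrow> assoc C X Y Z \<in> Arr C"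
  and assoc_Dom [simp]: "\<lbrakk>X \<in> Obj C; Y \<in> Obj C; Z \<in> Obj C\<rbrakk>
    \<Longrightarrow> Dom C (assoc C X Y Z) = (X \<otimes>\<^sub>o Y) \<otimes>\<^sub>o Z"
  and assoc_Cod [simp]: "\<lbrakk>X \<in> Obj C; Y \<in> Obj C; Z \<in> Obj C\<rbrakk>
    \<Longrightarrow> Cod C (assoc C X Y Z) = X \<otimes>\<^sub>o (Y \<otimes>\<^sub>o Z)"
  using assoc_closed[of X Y Z] by (simp_all add: in_Hom)

lemma lunit_Arr [simp]: "X \<in> Obj C \<Longrightarrow> lunit C X \<in> Arr C"
  and lunit_Dom [simp]: "X \<in> Obj C \<Longrightarrow> Dom C (lunit C X) = unit_obj C \<otimes>\<^sub>o X"
  and lunit_Cod [simp]: "X \<in> Obj C \<Longrightarrow> Cod C (lunit C X) = X"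
  using lunit_closed[of X] by (simp_all add: in_Hom)

lemma runit_Arr [simp]: "X \<in> Obj C \<Longrightarrow> runit C X \<in> Arr C"
  and runit_Dom [simp]: "X \<in> Obj C \<Longrightarrow> Dom C (runit C X) = X \<otimes>\<^sub>o unit_obj C"
  and runit_Cod [simp]: "X \<in> Obj C \<Longrightarrow> Cod C (runit C X) = X"
  using runit_closed[of X] by (simp_all add: in_Hom)

lemma assoc_nat: "\<lbrakk>f \<in> Arr C; g \<in> Arr C; h \<in> Arr C; Cod C f = X; Cod C g = Y; Cod C h = Z\<rbrakk>
    \<Longrightarrow> assoc C X Y Z \<cdot> ((f \<otimes>\<^sub>a g) \<otimes>\<^sub>a h) = (f \<otimes>\<^sub>a (g \<otimes>\<^sub>a h)) \<cdot> assoc C (Dom C f) (Dom C g) (Dom C h)"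
  by (rule assoc_natural) (simp_all add: in_Hom)

text \<open>
  The distributivity arrow carries the coproduct \<open>Q\<close> to the cocone on \<open>X \<otimes> P\<close>, which is therefore a
  coproduct as well. Preservation of coproducts, unlike invertibility, is easily iterated.
\<close>

lemma tensor_left_coproduct:
  assumes d: "distributes C I X Y" and P: "is_coproduct C I Y P \<iota>" and X: "X \<in> Obj C"
    and ex: "\<exists>Q \<kappa>. is_coproduct C I (\<lambda>i. X \<otimes>\<^sub>o Y i) Q \<kappa>"
  shows "is_coproduct C I (\<lambda>i. X \<otimes>\<^sub>o Y i) (X \<otimes>\<^sub>o P) (\<lambda>i. Idm C X \<otimes>\<^sub>a \<iota> i)"
proof -
  obtain Q \<kappa> where Q: "is_coproduct C I (\<lambda>i. X \<otimes>\<^sub>o Y i) Q \<kappa>" using ex by blast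
  note inc = coproduct_incl_Arr[OF P] coproduct_incl_Dom[OF P] coproduct_incl_Cod[OF P]
  let ?t = "dist_left C I X Q \<kappa> P \<iota>"
  have inj: "Idm C X \<otimes>\<^sub>a \<iota> i \<in> Hom C (X \<otimes>\<^sub>o Y i) (X \<otimes>\<^sub>o P)" if "i \<in> I" for i
    using X inc that by (simp add: in_Hom)
  note t = copair_props[OF Q tensor_Obj[OF X coproduct_Obj[OF P]] inj, folded dist_left_def]
  have iso: "is_iso C ?t" using d P Q unfolding distributes_def by blast
  have "is_coproduct C I (\<lambda>i. X \<otimes>\<^sub>o Y i) (Cod C ?t) (\<lambda>i. ?t \<cdot> \<kappa> i)"
    using t(1) by (intro coproduct_iso_target[OF Q iso]) (simp add: in_Hom)
  then show ?thesis using t by (simp add: in_Hom is_coproduct_def)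
qed

lemma tensor_right_coproduct:
  assumes d: "distributes C I X Y" and P: "is_coproduct C I Y P \<iota>" and X: "X \<in> Obj C"
    and ex: "\<exists>Q \<kappa>. is_coproduct C I (\<lambda>i. Y i \<otimes>\<^sub>o X) Q \<kappa>"
  shows "is_coproduct C I (\<lambda>i. Y i \<otimes>\<^sub>o X) (P \<otimes>\<^sub>o X) (\<lambda>i. \<iota> i \<otimes>\<^sub>a Idm C X)"
proof -
  obtain Q \<kappa> where Q: "is_coproduct C I (\<lambda>i. Y i \<otimes>\<^sub>o X) Q \<kappa>" using ex by blast
  note inc = coproduct_incl_Arr[OF P] coproduct_incl_Dom[OF P] coproduct_incl_Cod[OF P]
  let ?t = "dist_right C I X Q \<kappa> P \<iota>"
  have inj: "\<iota> i \<otimes>\<^sub>a Idm C X \<in> Hom C (Y i \<otimes>\<^sub>o X) (P \<otimes>\<^sub>o X)" if "i \<in> I" for i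
    using X inc that by (simp add: in_Hom)
  note t = copair_props[OF Q tensor_Obj[OF coproduct_Obj[OF P] X] inj, folded dist_right_def]
  have iso: "is_iso C ?t" using d P Q unfolding distributes_def by blast
  have "is_coproduct C I (\<lambda>i. Y i \<otimes>\<^sub>o X) (Cod C ?t) (\<lambda>i. ?t \<cdot> \<kappa> i)"
    using t(1) by (intro coproduct_iso_target[OF Q iso]) (simp add: in_Hom)
  then show ?thesis using t by (simp add: in_Hom is_coproduct_def)
qed

lemma distributesI:
  assumes "\<And>P \<iota>. is_coproduct C I Y P \<iota> \<Longrightarrow>
      is_coproduct C I (\<lambda>i. X \<otimes>\<^sub>o Y i) (X \<otimes>\<^sub>o P) (\<lambda>i. Idm C X \<otimes>\<^sub>a \<iota> i)"
    and "\<And>P \<iota>. is_coproduct C I Y P \<iota> \<Longrightarrow>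
      is_coproduct C I (\<lambda>i. Y i \<otimes>\<^sub>o X) (P \<otimes>\<^sub>o X) (\<lambda>i. \<iota> i \<otimes>\<^sub>a Idm C X)"
  shows "distributes C I X Y"
  unfolding distributes_def dist_left_def dist_right_def
  using assms copair_iso by blast

end

context countable_distributive_monoidal_category
begin

text \<open>
  The summands of a tensor product of complexes will be indexed by the pairs \<open>(i, j)\<close> with
  \<open>i + j = n\<close>; distributivity over the integers carries over to them along a bijection.
\<close>

lemma countable_tensor_left:
  assumes P: "is_coproduct C J Y P \<iota>" and X: "X \<in> Obj C" and b: "bij_betw b (UNIV :: int set) J"
  shows "is_coproduct C J (\<lambda>i. X \<otimes>\<^sub>o Y i) (X \<otimes>\<^sub>o P) (\<lambda>i. Idm C X \<otimes>\<^sub>a \<iota> i)"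
proof -
  have bJ: "b i \<in> J" for i using b by (auto simp: bij_betw_def)
  note P' = coproduct_reindex[OF P b]
  have Y: "Y (b i) \<in> Obj C" for i by (rule coproduct_summand_Obj[OF P bJ])
  have ex: "\<exists>Q \<kappa>. is_coproduct C (UNIV :: int set) (\<lambda>i. X \<otimes>\<^sub>o Y (b i)) Q \<kappa>"
    using countable_coproducts X Y unfolding has_countable_coproducts_def by simp
  have d: "distributes C UNIV X (\<lambda>i. Y (b i))"
    using X Y by (intro countable_distributes) auto
  note c = bij_betw_the_inv_into[OF b]
  have "b (the_inv_into UNIV b j) = j" if "j \<in> J" for j
    using b that by (auto simp: bij_betw_def intro: f_the_inv_into_f)
  with coproduct_reindex[OF tensor_left_coproduct[OF d P' X ex] c] show ?thesis
    by (simp add: is_coproduct_def cong: ball_cong)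
qed

lemma countable_tensor_right:
  assumes P: "is_coproduct C J Y P \<iota>" and X: "X \<in> Obj C" and b: "bij_betw b (UNIV :: int set) J"
  shows "is_coproduct C J (\<lambda>i. Y i \<otimes>\<^sub>o X) (P \<otimes>\<^sub>o X) (\<lambda>i. \<iota> i \<otimes>\<^sub>a Idm C X)"
proof -
  have bJ: "b i \<in> J" for i using b by (auto simp: bij_betw_def)
  note P' = coproduct_reindex[OF P b]
  have Y: "Y (b i) \<in> Obj C" for i by (rule coproduct_summand_Obj[OF P bJ])
  have ex: "\<exists>Q \<kappa>. is_coproduct C (UNIV :: int set) (\<lambda>i. Y (b i) \<otimes>\<^sub>o X) Q \<kappa>"
    using countable_coproducts X Y unfolding has_countable_coproducts_def by simp
  have d: "distributes C UNIV X (\<lambda>i. Y (b i))"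
    using X Y by (intro countable_distributes) auto
  note c = bij_betw_the_inv_into[OF b]
  have "b (the_inv_into UNIV b j) = j" if "j \<in> J" for j
    using b that by (auto simp: bij_betw_def intro: f_the_inv_into_f)
  with coproduct_reindex[OF tensor_right_coproduct[OF d P' X ex] c] show ?thesis
    by (simp add: is_coproduct_def cong: ball_cong)
qed

end

context linear_monoidal_category
begin

lemma hom_module_sel [simp]:
  "carrier (hom_module C A B) = Hom C A B" "add (hom_module C A B) = madd C"
  "zero (hom_module C A B) = mzero C A B" "smult (hom_module C A B) = scale C"
  by (simp_all add: hom_module_def)

lemma scale_Arr [simp]: "\<lbrakk>r \<in> carrier R; f \<in> Arr C\<rbrakk> \<Longrightarrow> scale C r f \<in> Arr C"
  and scale_Dom [simp]: "\<lbrakk>r \<in> carrier R; f \<in> Arr C\<rbrakk> \<Longrightarrow> Dom C (scale C r f) = Dom C f"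
  and scale_Cod [simp]: "\<lbrakk>r \<in> carrier R; f \<in> Arr C\<rbrakk> \<Longrightarrow> Cod C (scale C r f) = Cod C f"
proof -
  assume a: "r \<in> carrier R" "f \<in> Arr C"
  then interpret module R "hom_module C (Dom C f) (Cod C f)" by (intro hom_module) simp_all
  show "scale C r f \<in> Arr C" "Dom C (scale C r f) = Dom C f" "Cod C (scale C r f) = Cod C f"
    using smult_closed[of r f] a by (simp_all add: in_Hom)
qed

lemma scale_cmp: "\<lbrakk>r \<in> carrier R; f \<in> Arr C; g \<in> Arr C; Cod C f = Dom C g\<rbrakk>
    \<Longrightarrow> scale C r g \<cdot> f = scale C r (g \<cdot> f)"
  and cmp_scale: "\<lbrakk>r \<in> carrier R; f \<in> Arr C; g \<in> Arr C; Cod C f = Dom C g\<rbrakk>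
    \<Longrightarrow> g \<cdot> scale C r f = scale C r (g \<cdot> f)"
  using cmp_scale_left[of r f "Dom C f" "Cod C f" g "Cod C g"]
    cmp_scale_right[of r f "Dom C f" "Cod C f" g "Cod C g"] by (simp_all add: in_Hom)

lemma scale_one [simp]: "f \<in> Arr C \<Longrightarrow> scale C \<one>\<^bsub>R\<^esub> f = f"
  and scale_zero [simp]: "f \<in> Arr C \<Longrightarrow> scale C \<zero>\<^bsub>R\<^esub> f = mzero C (Dom C f) (Cod C f)"
  and scale_scale: "\<lbrakk>r \<in> carrier R; s \<in> carrier R; f \<in> Arr C\<rbrakk>
    \<Longrightarrow> scale C r (scale C s f) = scale C (r \<otimes>\<^bsub>R\<^esub> s) f"
  and scale_add: "\<lbrakk>r \<in> carrier R; s \<in> carrier R; f \<in> Arr C\<rbrakk>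
    \<Longrightarrow> scale C (r \<oplus>\<^bsub>R\<^esub> s) f = madd C (scale C r f) (scale C s f)"
  and scale_mzero': "r \<in> carrier R \<Longrightarrow> f \<in> Arr C \<Longrightarrow> scale C r (mzero C (Dom C f) (Cod C f)) = mzero C (Dom C f) (Cod C f)"
proof -
  assume f: "f \<in> Arr C"
  then interpret module R "hom_module C (Dom C f) (Cod C f)" by (intro hom_module) simp_all
  have f': "f \<in> carrier (hom_module C (Dom C f) (Cod C f))" using f by (simp add: in_Hom)
  show "scale C \<one>\<^bsub>R\<^esub> f = f" using smult_one[OF f'] by simp
  show "scale C \<zero>\<^bsub>R\<^esub> f = mzero C (Dom C f) (Cod C f)" using smult_l_null[OF f'] by simp
  show "scale C r (scale C s f) = scale C (r \<otimes>\<^bsub>R\<^esub> s) f"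
    if "r \<in> carrier R" "s \<in> carrier R" using smult_assoc1[OF that f'] by simp
  show "scale C (r \<oplus>\<^bsub>R\<^esub> s) f = madd C (scale C r f) (scale C s f)"
    if "r \<in> carrier R" "s \<in> carrier R" using smult_l_distr[OF that f'] by simp
  show "scale C r (mzero C (Dom C f) (Cod C f)) = mzero C (Dom C f) (Cod C f)"
    if "r \<in> carrier R" using smult_r_null[OF that] by simp
qed

lemma scale_mzero [simp]: "\<lbrakk>r \<in> carrier R; A \<in> Obj C; B \<in> Obj C\<rbrakk> \<Longrightarrow> scale C r (mzero C A B) = mzero C A B"
  using scale_mzero'[of r "mzero C A B"] by simp

lemma scale_madd: "\<lbrakk>r \<in> carrier R; f \<in> Arr C; g \<in> Arr C; Dom C g = Dom C f; Cod C g = Cod C f\<rbrakk>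
    \<Longrightarrow> scale C r (madd C f g) = madd C (scale C r f) (scale C r g)"
proof -
  assume a: "r \<in> carrier R" "f \<in> Arr C" "g \<in> Arr C" "Dom C g = Dom C f" "Cod C g = Cod C f"
  then interpret module R "hom_module C (Dom C f) (Cod C f)" by (intro hom_module) simp_all
  show ?thesis using smult_r_distr[of r f g] a by (simp add: in_Hom)
qed

lemma madd_tensor: "\<lbrakk>f \<in> Arr C; f' \<in> Arr C; g \<in> Arr C; Dom C f' = Dom C f; Cod C f' = Cod C f\<rbrakk>
    \<Longrightarrow> madd C f f' \<otimes>\<^sub>a g = madd C (f \<otimes>\<^sub>a g) (f' \<otimes>\<^sub>a g)"
  by (rule tensor_madd_left) (simp_all add: in_Hom)

lemma tensor_madd: "\<lbrakk>f \<in> Arr C; g \<in> Arr C; g' \<in> Arr C; Dom C g' = Dom C g; Cod C g' = Cod C g\<rbrakk>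
    \<Longrightarrow> f \<otimes>\<^sub>a madd C g g' = madd C (f \<otimes>\<^sub>a g) (f \<otimes>\<^sub>a g')"
  by (rule tensor_madd_right) (simp_all add: in_Hom)

lemma scale_tensor: "\<lbrakk>r \<in> carrier R; f \<in> Arr C; g \<in> Arr C\<rbrakk> \<Longrightarrow> scale C r f \<otimes>\<^sub>a g = scale C r (f \<otimes>\<^sub>a g)"
  and tensor_scale: "\<lbrakk>r \<in> carrier R; f \<in> Arr C; g \<in> Arr C\<rbrakk> \<Longrightarrow> f \<otimes>\<^sub>a scale C r g = scale C r (f \<otimes>\<^sub>a g)"
  using tensor_scale_left tensor_scale_right by (simp_all add: in_Hom)

lemma mzero_tensor [simp]:
  assumes "A \<in> Obj C" "B \<in> Obj C" "f \<in> Arr C"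
  shows "mzero C A B \<otimes>\<^sub>a f = mzero C (A \<otimes>\<^sub>o Dom C f) (B \<otimes>\<^sub>o Cod C f)"
proof -
  have "madd C (mzero C A B \<otimes>\<^sub>a f) (mzero C A B \<otimes>\<^sub>a f) = mzero C A B \<otimes>\<^sub>a f"
    using assms by (simp flip: madd_tensor)
  from mzero_if_idem[OF _ this] show ?thesis using assms by simp
qed

lemma tensor_mzero [simp]:
  assumes "A \<in> Obj C" "B \<in> Obj C" "f \<in> Arr C"
  shows "f \<otimes>\<^sub>a mzero C A B = mzero C (Dom C f \<otimes>\<^sub>o A) (Cod C f \<otimes>\<^sub>o B)"
proof -
  have "madd C (f \<otimes>\<^sub>a mzero C A B) (f \<otimes>\<^sub>a mzero C A B) = f \<otimes>\<^sub>a mzero C A B"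
    using assms by (simp flip: tensor_madd)
  from mzero_if_idem[OF _ this] show ?thesis using assms by simp
qed

lemma zero_object_tensor:
  assumes "zero_object C Z" "X \<in> Obj C"
  shows "zero_object C (X \<otimes>\<^sub>o Z)" "zero_object C (Z \<otimes>\<^sub>o X)"
  using assms tensor_mzero[of Z Z "Idm C X"] mzero_tensor[of Z Z "Idm C X"]
  by (auto simp: zero_object_iff simp flip: tensor_Idm)

lemma scale_add_pow:
  assumes "r \<in> carrier R" "f \<in> Arr C"
  shows "scale C (add_pow R (p :: nat) r) f = add_pow (hom_group C (Dom C f) (Cod C f)) p (scale C r f)"
proof -
  interpret module R "hom_module C (Dom C f) (Cod C f)" using assms by (intro hom_module) simp_all
  interpret H: abelian_group "hom_group C (Dom C f) (Cod C f)" using assms by (intro hom_abelian) simp_all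
  have rf: "scale C r f \<in> carrier (hom_group C (Dom C f) (Cod C f))" using assms by (simp add: in_Hom)
  show ?thesis
  proof (induction p)
    case 0
    show ?case using assms by simp
  next
    case (Suc p)
    then show ?case
      using assms rf by (simp add: R.add.nat_pow_closed scale_add)
  qed
qed

end

section \<open>Gaussian binomial coefficients at roots of unity\<close>

text \<open>
  The Gaussian binomial coefficients at \<open>q\<close>, defined by the Pascal rule in which the exponent of \<open>q\<close>
  is the lower index. This is the rule that comes out of the differential of a tensor product.
\<close>

fun qbinomial :: "('r, 'y) ring_scheme \<Rightarrow> 'r \<Rightarrow> nat \<Rightarrow> nat \<Rightarrow> 'r" where
  "qbinomial R q n 0 = \<one>\<^bsub>R\<^esub>"
| "qbinomial R q 0 (Suc r) = \<zero>\<^bsub>R\<^esub>"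
| "qbinomial R q (Suc n) (Suc r) =
    qbinomial R q n r \<oplus>\<^bsub>R\<^esub> q [^]\<^bsub>R\<^esub> Suc r \<otimes>\<^bsub>R\<^esub> qbinomial R q n (Suc r)"

context cring
begin

lemma qbinomial_closed [simp]: "q \<in> carrier R \<Longrightarrow> qbinomial R q n r \<in> carrier R"
proof (induction n arbitrary: r)
  case 0
  then show ?case by (cases r) simp_all
next
  case (Suc n)
  then show ?case by (cases r) simp_all
qed

lemma qbinomial_eq_0: "q \<in> carrier R \<Longrightarrow> n < r \<Longrightarrow> qbinomial R q n r = \<zero>"
proof (induction n arbitrary: r)
  case 0
  then show ?case by (cases r) simp_all
next
  case (Suc n)
  then show ?case by (cases r) simp_all
qed

lemma qbinomial_same: "q \<in> carrier R \<Longrightarrow> qbinomial R q n n = \<one>"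
  by (induction n) (simp_all add: qbinomial_eq_0)

text \<open>
  The identity \<open>[r + 1] [n + 1 choose r + 1] = [n + 1] [n choose r]\<close> for \<open>q\<close>-integers, multiplied
  by \<open>q - 1\<close> so that it makes sense for every \<open>q\<close>.
\<close>

lemma qbinomial_absorb:
  assumes q: "q \<in> carrier R"
  shows "(q [^] Suc r \<ominus> \<one>) \<otimes> qbinomial R q (Suc n) (Suc r)
    = (q [^] Suc n \<ominus> \<one>) \<otimes> qbinomial R q n r"
proof (induction n arbitrary: r)
  case 0
  show ?case
  proof (cases r)
    case 0
    then show ?thesis using q by simp
  next
    case (Suc s)
    then show ?thesis using q by (simp add: a_minus_def r_neg)
  qed
next
  case (Suc m)
  show ?case
  proof (cases r)
    case 0
    have IH: "(q [^] Suc 0 \<ominus> \<one>) \<otimes> qbinomial R q (Suc m) (Suc 0) = q [^] Suc m \<ominus> \<one>"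
      using Suc.IH[of 0] q by simp
    have alg: "(a \<ominus> \<one>) \<otimes> (\<one> \<oplus> a \<otimes> b) = c \<otimes> a \<ominus> \<one>"
      if "(a \<ominus> \<one>) \<otimes> b = c \<ominus> \<one>" "a \<in> carrier R" "b \<in> carrier R" "c \<in> carrier R" for a b c
    proof -
      have "(a \<ominus> \<one>) \<otimes> (\<one> \<oplus> a \<otimes> b) = (a \<ominus> \<one>) \<oplus> a \<otimes> ((a \<ominus> \<one>) \<otimes> b)"
        using that(2-4) by algebra
      also have "\<dots> = c \<otimes> a \<ominus> \<one>"
        unfolding that(1) using that(2-4) by algebra
      finally show ?thesis .
    qed
    show ?thesis
      using alg[OF IH] q 0 by (simp add: m_ac)
  next
    case (Suc s)
    let ?A = "qbinomial R q (Suc m) (Suc s)" and ?B = "qbinomial R q (Suc m) (Suc (Suc s))"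
      and ?Cc = "qbinomial R q m s" and ?D = "qbinomial R q m (Suc s)"
    let ?u = "q [^] Suc s" and ?w = "q [^] Suc m"
    have c: "?A \<in> carrier R" "?B \<in> carrier R" "?Cc \<in> carrier R" "?D \<in> carrier R"
      "?u \<in> carrier R" "?w \<in> carrier R"
      using q by simp_all
    have A: "?A = ?Cc \<oplus> ?u \<otimes> ?D" by simp
    have h1: "(?u \<otimes> q \<ominus> \<one>) \<otimes> ?B = (?w \<ominus> \<one>) \<otimes> ?D"
      using Suc.IH[of "Suc s"] by simp
    have h2: "(?u \<ominus> \<one>) \<otimes> ?A = (?w \<ominus> \<one>) \<otimes> ?Cc"
      using Suc.IH[of s] by simp
    \<comment> \<open>the identity for \<open>m\<close> is used twice: at \<open>s + 1\<close> to remove \<open>?B\<close>, at \<open>s\<close> to remove \<open>?Cc\<close>\<close>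
    have "(?u \<otimes> q \<ominus> \<one>) \<otimes> (?A \<oplus> ?u \<otimes> q \<otimes> ?B)
        = (?u \<otimes> q \<ominus> \<one>) \<otimes> ?A \<oplus> ?u \<otimes> q \<otimes> ((?u \<otimes> q \<ominus> \<one>) \<otimes> ?B)"
      using c q by algebra
    also have "\<dots> = (?u \<otimes> q \<ominus> \<one>) \<otimes> ?A \<oplus> q \<otimes> ((?w \<ominus> \<one>) \<otimes> (?Cc \<oplus> ?u \<otimes> ?D) \<ominus> (?w \<ominus> \<one>) \<otimes> ?Cc)"
      unfolding h1 using c(3-6) q c(1) by algebra
    also have "\<dots> = (?u \<otimes> q \<ominus> \<one>) \<otimes> ?A \<oplus> q \<otimes> ((?w \<ominus> \<one>) \<otimes> ?A \<ominus> (?u \<ominus> \<one>) \<otimes> ?A)"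
      unfolding h2 A[symmetric] ..
    also have "\<dots> = (?w \<otimes> q \<ominus> \<one>) \<otimes> ?A"
      using c q by algebra
    finally show ?thesis using Suc by simp
  qed
qed

end

text \<open>
  In the absorption identity the right-hand factor \<open>q ^ k - 1\<close> is zero while \<open>q ^ r - 1\<close> is not, and
  the ring has no zero divisors.
\<close>

lemma (in domain) qbinomial_primitive_root:
  assumes "primitive_root R k q" "0 < r" "r < k"
  shows "qbinomial R q k r = \<zero>"
proof -
  obtain s m where s: "r = Suc s" "k = Suc m" using assms by (cases r; cases k) auto
  have q: "q \<in> carrier R" "q [^] k = \<one>" "q [^] r \<noteq> \<one>"
    using assms by (auto simp: primitive_root_def)
  have "(q [^] r \<ominus> \<one>) \<otimes> qbinomial R q k r = \<zero>"
    using qbinomial_absorb[OF q(1), of s m] q(1,2) unfolding s by (simp add: a_minus_def r_neg)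
  moreover have "q [^] r \<ominus> \<one> \<noteq> \<zero>" using q minus_equality[of "q [^] r" "\<ominus> \<one>"]
    by (auto simp: a_minus_def)
  ultimately show ?thesis
    using q(1) integral_iff[of "q [^] r \<ominus> \<one>" "qbinomial R q k r"] by simp
qed

text \<open>
  This is the \<open>q\<close>-Vandermonde identity for \<open>n + k\<close>, in which only the two extreme terms survive
  because the inner coefficients \<open>[k choose j]\<close> are zero.
\<close>

lemma (in domain) qbinomial_add_order:
  assumes prim: "primitive_root R k q" and k: "0 < k"
  shows "qbinomial R q (n + k) r
    = qbinomial R q n r \<oplus> (if k \<le> r then qbinomial R q n (r - k) else \<zero>)"
proof (induction n arbitrary: r)
  case 0
  have q: "q \<in> carrier R" using prim by (simp add: primitive_root_def)
  consider "r = 0" | "0 < r" "r < k" | "r = k" | "k < r" by linarith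
  then show ?case
  proof cases
    case 2
    then show ?thesis
      using q qbinomial_primitive_root[OF prim 2] by (simp add: qbinomial_eq_0)
  qed (use k q in \<open>simp_all add: qbinomial_eq_0 qbinomial_same\<close>)
next
  case (Suc n)
  have q: "q \<in> carrier R" "q [^] k = \<one>" using prim by (auto simp: primitive_root_def)
  show ?case
  proof (cases r)
    case 0
    then show ?thesis using k q by simp
  next
    case r: (Suc s)
    have step: "qbinomial R q (Suc n + k) (Suc s) =
        (qbinomial R q n s \<oplus> (if k \<le> s then qbinomial R q n (s - k) else \<zero>))
        \<oplus> q [^] Suc s \<otimes> (qbinomial R q n (Suc s) \<oplus>
          (if k \<le> Suc s then qbinomial R q n (Suc s - k) else \<zero>))"
      using Suc.IH by simp
    consider "Suc s < k" | "Suc s = k" | "k \<le> s" by linarith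
    then show ?thesis
    proof cases
      case 1
      then show ?thesis using q step r by simp
    next
      case 2
      show ?thesis
        using q step unfolding r 2[symmetric] by (simp add: a_assoc)
    next
      case 3
      then obtain t where t: "s = k + t" using le_Suc_ex by blast
      have "q [^] Suc s = q [^] Suc t"
        using q nat_pow_mult[OF q(1), of k "Suc t"] t by simp
      then show ?thesis
        unfolding r step using 3 t q by (simp add: r_distr a_ac)
    qed
  qed
qed

text \<open>
  A case of the \<open>q\<close>-Lucas theorem; by the previous lemma these coefficients satisfy the ordinary
  Pascal rule.
\<close>

lemma (in domain) qbinomial_multiple_of_order:
  assumes prim: "primitive_root R k q" and k: "0 < k"
  shows "qbinomial R q (m * k) r
    = (if k dvd r then add_pow R (m choose (r div k)) \<one> else \<zero>)"
proof (induction m arbitrary: r)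
  case 0
  show ?case
  proof (cases r)
    case (Suc s)
    then have "r div k > 0" if "k dvd r"
      using that Suc k by (simp add: div_greater_zero_iff dvd_imp_le)
    then show ?thesis using Suc by (auto simp: binomial_eq_0)
  qed simp
next
  case (Suc m)
  have step: "qbinomial R q (Suc m * k) r = qbinomial R q (m * k) r
      \<oplus> (if k \<le> r then qbinomial R q (m * k) (r - k) else \<zero>)"
    using qbinomial_add_order[OF prim k, of "m * k" r] by (simp add: add.commute)
  show ?case
  proof (cases "k dvd r")
    case False
    then have "\<not> k dvd r - k" if "k \<le> r" using that by (simp add: dvd_minus_self)
    then show ?thesis using False step Suc.IH by simp
  next
    case True
    then obtain t where t: "r = k * t" by blast
    show ?thesis
    proof (cases t)
      case 0
      then show ?thesis using t k by simp
    next
      case (Suc u)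
      then have "r - k = k * u" "k \<le> r" using t by simp_all
      then show ?thesis
        unfolding step using Suc.IH t Suc k
        by (simp add: add.nat_pow_mult add.commute)
    qed
  qed
qed

lemma prime_dvd_binomial_prime_power:
  fixes p :: nat
  assumes "prime p" "0 < j" "j < p ^ n"
  shows "p dvd (p ^ n choose j)"
proof (rule ccontr)
  assume "\<not> p dvd (p ^ n choose j)"
  then have "coprime (p ^ n) (p ^ n choose j)"
    using assms(1) by (simp add: prime_imp_coprime)
  moreover have "p ^ n dvd j * (p ^ n choose j)"
    using times_binomial_minus1_eq[OF assms(2), of "p ^ n"] by simp
  ultimately have "p ^ n dvd j" by (simp add: coprime_dvd_mult_left_iff)
  then show False using assms(2,3) by (simp add: nat_dvd_not_less)
qed

text \<open>
  The \<open>q\<close>-Lucas theorem reduces the claim to ordinary binomial coefficients of \<open>p ^ n\<close>. Being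
  multiples of \<open>p\<close>, the inner coefficients act as zero on every module that \<open>p\<close> annihilates, even
  when the ring itself has characteristic zero.
\<close>

lemma (in domain) qbinomial_prime_power_multiple:
  assumes prim: "primitive_root R k q" and p: "prime p" and r: "0 < r" "r < p ^ n * k"
  shows "\<exists>y \<in> carrier R. qbinomial R q (p ^ n * k) r = add_pow R p y"
proof -
  have k: "0 < k" using r by (cases k) auto
  note * = qbinomial_multiple_of_order[OF prim k, of "p ^ n" r]
  show ?thesis
  proof (cases "k dvd r")
    case False
    then show ?thesis using * by (intro bexI[of _ \<zero>]) simp_all
  next
    case True
    then obtain j where j: "r = k * j" by blast
    then have "0 < j" "j < p ^ n" using r by (auto simp: mult.commute)
    from prime_dvd_binomial_prime_power[OF p this]
    obtain c where "(p ^ n choose j) = c * p" by (metis dvd_def mult.commute)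
    then have "qbinomial R q (p ^ n * k) r = add_pow R p (add_pow R c \<one>)"
      using * j k by (simp add: add.nat_pow_pow)
    then show ?thesis by blast
  qed
qed

section \<open>The differential of a tensor product\<close>

lemma (in monoid) int_pow_Units:
  assumes "x \<in> Units G"
  shows "x [^]\<^bsub>units_of G\<^esub> (i :: int) = x [^] i"
proof (cases "i < 0")
  case True
  have "x [^] (nat (- i)) \<in> Units G"
    using assms monoid.nat_pow_closed[OF group.is_monoid[OF units_group], of x "nat (- i)"]
    unfolding units_of_carrier units_of_pow[OF assms] by blast
  then show ?thesis unfolding int_pow_def2 using True by (simp only: if_True units_of_pow[OF assms] units_of_inv)
next
  case False
  then show ?thesis unfolding int_pow_def2 by (simp only: if_False units_of_pow[OF assms])
qed

lemma (in monoid) int_pow_Units_closed: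
  assumes "x \<in> Units G"
  shows "x [^] (i :: int) \<in> Units G"
  using group.int_pow_closed[OF units_group, of x i] assms
  unfolding int_pow_Units[OF assms] units_of_carrier by simp

lemma (in monoid) int_pow_Units_add:
  assumes "x \<in> Units G"
  shows "x [^] (i + j :: int) = x [^] i \<otimes> x [^] j"
  using group.int_pow_mult[OF units_group, of x i j] assms
  unfolding int_pow_Units[OF assms] units_of_carrier units_of_mult by simp

text \<open>
  The summation step of the binomial theorem: each term of the old sum contributes \<open>U a\<close> to the new
  term \<open>a + 1\<close> and \<open>V a\<close> to the new term \<open>a\<close>.
\<close>

lemma (in abelian_monoid) finsum_shift:
  fixes m :: nat
  assumes U: "\<And>a. a \<le> m \<Longrightarrow> U a \<in> carrier G" and V: "\<And>a. a \<le> Suc m \<Longrightarrow> V a \<in> carrier G"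
    and V0: "V (Suc m) = \<zero>" and W: "W 0 = V 0" "\<And>a. a \<le> m \<Longrightarrow> W (Suc a) = U a \<oplus> V (Suc a)"
  shows "finsum G (\<lambda>a. U a \<oplus> V a) {..m} = finsum G W {..Suc m}"
proof -
  have "W a \<in> carrier G" if "a \<le> Suc m" for a
    using that U V W by (cases a) simp_all
  then have UV: "U \<in> {..m} \<rightarrow> carrier G" "V \<in> {..Suc m} \<rightarrow> carrier G" "V \<in> {..m} \<rightarrow> carrier G"
    "(\<lambda>a. V (Suc a)) \<in> {..m} \<rightarrow> carrier G" "W \<in> {..Suc m} \<rightarrow> carrier G"
    using U V by (simp_all add: Pi_def)
  have "finsum G (\<lambda>a. U a \<oplus> V a) {..m} = finsum G U {..m} \<oplus> finsum G V {..m}"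
    using UV by (simp add: finsum_addf)
  also have "finsum G V {..m} = finsum G V {..Suc m}"
    using UV V0 by (simp add: finsum_Suc)
  also have "\<dots> = finsum G (\<lambda>a. V (Suc a)) {..m} \<oplus> V 0"
    using UV by (intro finsum_Suc2)
  also have "finsum G U {..m} \<oplus> \<dots> = finsum G U {..m} \<oplus> finsum G (\<lambda>a. V (Suc a)) {..m} \<oplus> V 0"
    using UV V[of 0] by (simp add: a_assoc)
  also have "finsum G U {..m} \<oplus> finsum G (\<lambda>a. V (Suc a)) {..m} = finsum G (\<lambda>a. U a \<oplus> V (Suc a)) {..m}"
    using UV by (simp add: finsum_addf)
  also have "\<dots> = finsum G (\<lambda>a. W (Suc a)) {..m}"
    using UV U V W by (intro finsum_cong') (auto simp: Pi_def)
  also have "\<dots> \<oplus> V 0 = finsum G W {..Suc m}"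
    using UV W by (simp only: finsum_Suc2)
  finally show ?thesis .
qed

context preadditive_category
begin

lemma sum_Hom:
  "(\<And>a. a \<le> (m :: nat) \<Longrightarrow> f a \<in> Hom C A B) \<Longrightarrow> A \<in> Obj C \<Longrightarrow> B \<in> Obj C
    \<Longrightarrow> finsum (hom_group C A B) f {..m} \<in> Hom C A B"
  using abelian_monoid.finsum_closed[OF abelian_group.axioms(1)[OF hom_abelian], of A B f "{..m}"]
  by (simp add: Pi_def)

lemma cmp_sum:
  assumes "\<And>a. a \<le> (m :: nat) \<Longrightarrow> f a \<in> Hom C A B" and h: "h \<in> Hom C B D"
    and AB: "A \<in> Obj C" "B \<in> Obj C"
  shows "h \<cdot> finsum (hom_group C A B) f {..m} = finsum (hom_group C A D) (\<lambda>a. h \<cdot> f a) {..m}"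
  using assms(1)
proof (induction m)
  have D: "D \<in> Obj C" using h by (auto simp: in_Hom)
  interpret H: abelian_group "hom_group C A B" by (rule hom_abelian[OF AB])
  interpret K: abelian_group "hom_group C A D" by (rule hom_abelian[OF AB(1) D])
  case 0
  then have "h \<cdot> f 0 \<in> Hom C A D" using h cmp_closed by blast
  then show ?case using 0 h D by (simp add: Pi_def in_Hom)
next
  have D: "D \<in> Obj C" using h by (auto simp: in_Hom)
  interpret H: abelian_group "hom_group C A B" by (rule hom_abelian[OF AB])
  interpret K: abelian_group "hom_group C A D" by (rule hom_abelian[OF AB(1) D])
  case (Suc m)
  have hf: "h \<cdot> f a \<in> Hom C A D" if "a \<le> Suc m" for a
    using Suc.prems[OF that] h cmp_closed by blast
  have s: "finsum (hom_group C A B) f {..m} \<in> Hom C A B"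
    using sum_Hom[of m f A B] Suc.prems AB by simp
  have "h \<cdot> finsum (hom_group C A B) f {..Suc m}
      = h \<cdot> madd C (f (Suc m)) (finsum (hom_group C A B) f {..m})"
    using Suc.prems by (subst H.finsum_Suc) (simp_all add: Pi_def)
  also have "\<dots> = madd C (h \<cdot> f (Suc m)) (h \<cdot> finsum (hom_group C A B) f {..m})"
    using s Suc.prems[of "Suc m"] h by (intro cmp_madd_right) auto
  also have "\<dots> = madd C (h \<cdot> f (Suc m)) (finsum (hom_group C A D) (\<lambda>a. h \<cdot> f a) {..m})"
    using Suc by simp
  also have "\<dots> = finsum (hom_group C A D) (\<lambda>a. h \<cdot> f a) {..Suc m}"
    using hf by (subst K.finsum_Suc) (simp_all add: Pi_def)
  finally show ?case .
qed

text \<open>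
  Tensor products, associators and unit arrows only involve the underlying graded objects, and the
  formula for the differential makes sense without nilpotency. Hence the three layers of
  structure: graded objects, graded objects with a differential, and \<open>N\<close>-complexes.
\<close>

definition graded :: "('o, 'm) ncomplex \<Rightarrow> bool"
  where "graded X \<longleftrightarrow> (\<forall>n. ob X n \<in> Obj C)"

definition differential :: "('o, 'm) ncomplex \<Rightarrow> bool"
  where "differential X \<longleftrightarrow> graded X \<and> (\<forall>n. dif X n \<in> Hom C (ob X n) (ob X (n + 1)))"

lemma graded_Obj [simp]: "graded X \<Longrightarrow> ob X n \<in> Obj C"
  by (simp add: graded_def)

lemma differential_graded [simp]: "differential X \<Longrightarrow> graded X"
  by (simp add: differential_def)

lemma dif_Arr [simp]: "differential X \<Longrightarrow> dif X n \<in> Arr C"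
  and dif_Dom [simp]: "differential X \<Longrightarrow> Dom C (dif X n) = ob X n"
  and dif_Cod [simp]: "differential X \<Longrightarrow> Cod C (dif X n) = ob X (n + 1)"
  by (auto simp: differential_def in_Hom)

lemma dif_pow_Hom: "differential X \<Longrightarrow> dif_pow C X k n \<in> Hom C (ob X n) (ob X (n + int k))"
  by (induction k) (simp_all add: in_Hom algebra_simps)

lemma dif_pow_Arr [simp]: "differential X \<Longrightarrow> dif_pow C X k n \<in> Arr C"
  and dif_pow_Dom [simp]: "differential X \<Longrightarrow> Dom C (dif_pow C X k n) = ob X n"
  and dif_pow_Cod [simp]: "differential X \<Longrightarrow> Cod C (dif_pow C X k n) = ob X (n + int k)"
  using dif_pow_Hom[of X k n] by (simp_all add: in_Hom)

lemma is_ncomplex_iff: "is_ncomplex C N X \<longleftrightarrow> differential X \<and>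
    (\<forall>n. dif_pow C X N n = mzero C (ob X n) (ob X (n + int N)))"
  by (auto simp: is_ncomplex_def differential_def graded_def)

end

locale graded_tensor = countable_distributive_monoidal_category C + linear_monoidal_category R C + R: domain R
  for R :: "('r, 'y) ring_scheme"
    and C :: "('o, 'm, 'r, 'x) linear_monoidal_category_scheme" (structure) +
  fixes \<xi> :: 'r and S :: "(int \<Rightarrow> 'o) \<Rightarrow> 'o" and \<iota> :: "(int \<Rightarrow> 'o) \<Rightarrow> int \<Rightarrow> 'm"
  assumes choice: "coproduct_choice C S \<iota>"
    and xi_Units: "\<xi> \<in> Units R"
begin

abbreviation ctensor (infixl "\<odot>" 75)
  where "X \<odot> Y \<equiv> complex_tensor_obj R C \<xi> S \<iota> X Y"

text \<open>
  The inclusion of \<open>X\<^sup>i \<otimes> Y\<^sup>j\<close> into degree \<open>i + j\<close>. Taking both \<open>i\<close> and \<open>j\<close> as arguments keeps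
  subtractions of degrees out of the equations below.
\<close>

definition incl :: "('o, 'm) ncomplex \<Rightarrow> ('o, 'm) ncomplex \<Rightarrow> int \<Rightarrow> int \<Rightarrow> 'm"
  where "incl X Y i j = \<iota> (summands C X Y (i + j)) i"

lemma xi_pow_closed [simp]: "\<xi> [^]\<^bsub>R\<^esub> (i :: int) \<in> carrier R"
  using R.int_pow_Units_closed[OF xi_Units] by (auto intro: R.Units_closed)

lemma xi_pow_add: "\<xi> [^]\<^bsub>R\<^esub> (i + j :: int) = \<xi> [^]\<^bsub>R\<^esub> i \<otimes>\<^bsub>R\<^esub> \<xi> [^]\<^bsub>R\<^esub> j"
  by (rule R.int_pow_Units_add[OF xi_Units])

lemma xi_closed [simp]: "\<xi> \<in> carrier R"
  using xi_Units by (rule R.Units_closed)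

lemma chosen_coproduct: "(\<And>i. Y i \<in> Obj C) \<Longrightarrow> is_coproduct C UNIV Y (S Y) (\<iota> Y)"
  using choice by (auto simp: coproduct_choice_def)

lemma chosen_props [simp]:
  assumes "\<And>i. Y i \<in> Obj C"
  shows "S Y \<in> Obj C" "\<iota> Y i \<in> Arr C" "Dom C (\<iota> Y i) = Y i" "Cod C (\<iota> Y i) = S Y"
proof -
  note P = chosen_coproduct[of Y, OF assms]
  show "S Y \<in> Obj C" by (rule coproduct_Obj[OF P])
  show "\<iota> Y i \<in> Arr C" by (rule coproduct_incl_Arr[OF P]) simp
  show "Dom C (\<iota> Y i) = Y i" by (rule coproduct_incl_Dom[OF P]) simp
  show "Cod C (\<iota> Y i) = S Y" by (rule coproduct_incl_Cod[OF P]) simp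
qed

lemma coprod_copair_props:
  assumes "\<And>i. Y i \<in> Obj C" "T \<in> Obj C"
    and "\<And>i. f i \<in> Arr C" "\<And>i. Dom C (f i) = Y i" "\<And>i. Cod C (f i) = T"
  shows "coprod_copair C S \<iota> Y T f \<in> Arr C" "Dom C (coprod_copair C S \<iota> Y T f) = S Y"
    "Cod C (coprod_copair C S \<iota> Y T f) = T" "coprod_copair C S \<iota> Y T f \<cdot> \<iota> Y i = f i"
  using copair_props[OF chosen_coproduct[of Y, OF assms(1)] assms(2), where f = f] assms(3-5)
  by (simp_all add: coprod_copair_def in_Hom)

lemma coprod_map_props:
  assumes "\<And>i. f i \<in> Arr C" "\<And>i. Dom C (f i) = Y i" "\<And>i. Cod C (f i) = Y' i"
  shows "coprod_map C S \<iota> Y Y' f \<in> Arr C" "Dom C (coprod_map C S \<iota> Y Y' f) = S Y"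
    "Cod C (coprod_map C S \<iota> Y Y' f) = S Y'" "coprod_map C S \<iota> Y Y' f \<cdot> \<iota> Y i = \<iota> Y' i \<cdot> f i"
proof -
  have Y: "Y i \<in> Obj C" "Y' i \<in> Obj C" for i
    using assms(2,3)[of i] Dom_Obj[OF assms(1), of i] Cod_Obj[OF assms(1), of i] by simp_all
  show "coprod_map C S \<iota> Y Y' f \<in> Arr C" "Dom C (coprod_map C S \<iota> Y Y' f) = S Y"
    "Cod C (coprod_map C S \<iota> Y Y' f) = S Y'" "coprod_map C S \<iota> Y Y' f \<cdot> \<iota> Y i = \<iota> Y' i \<cdot> f i"
    using coprod_copair_props[of Y "S Y'" "\<lambda>i. \<iota> Y' i \<cdot> f i"] Y assms
    by (simp_all add: coprod_map_def)
qed

lemma summands_apply: "summands C X Y n i = ob X i \<otimes>\<^sub>o ob Y (n - i)"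
  by (simp add: summands_def)

lemma summands_Obj [simp]: "\<lbrakk>graded X; graded Y\<rbrakk> \<Longrightarrow> summands C X Y n i \<in> Obj C"
  by (simp add: summands_apply)

lemma ob_tensor: "ob (X \<odot> Y) n = S (summands C X Y n)"
  by (simp add: complex_tensor_obj_def)

lemma graded_tensor [simp]: "\<lbrakk>graded X; graded Y\<rbrakk> \<Longrightarrow> graded (X \<odot> Y)"
  by (simp add: graded_def[of "X \<odot> Y"] ob_tensor)

lemma incl_eq: "n = i + j \<Longrightarrow> \<iota> (summands C X Y n) i = incl X Y i j"
  by (simp add: incl_def)

lemma incl_Arr [simp]: "\<lbrakk>graded X; graded Y\<rbrakk> \<Longrightarrow> incl X Y i j \<in> Arr C"
  and incl_Dom [simp]: "\<lbrakk>graded X; graded Y\<rbrakk> \<Longrightarrow> Dom C (incl X Y i j) = ob X i \<otimes>\<^sub>o ob Y j"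
  and incl_Cod [simp]: "\<lbrakk>graded X; graded Y\<rbrakk> \<Longrightarrow> Cod C (incl X Y i j) = ob (X \<odot> Y) (i + j)"
  by (simp_all add: incl_def ob_tensor) (simp_all add: summands_apply)

definition antidiagonal :: "int \<Rightarrow> (int \<times> int) set"
  where "antidiagonal n = {(i, j). i + j = n}"

lemma antidiagonal_bij:
  "bij_betw fst (antidiagonal n) UNIV" "bij_betw (\<lambda>i. (i, n - i)) UNIV (antidiagonal n)"
  by (rule bij_betw_byWitness[where f' = "\<lambda>i. (i, n - i)"], auto simp: antidiagonal_def)
    (rule bij_betw_byWitness[where f' = fst], auto simp: antidiagonal_def)

lemma tensor_coproduct:
  assumes "graded X" "graded Y"
  shows "is_coproduct C (antidiagonal n) (\<lambda>(i, j). ob X i \<otimes>\<^sub>o ob Y j) (ob (X \<odot> Y) n)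
    (\<lambda>(i, j). incl X Y i j)"
proof -
  have "is_coproduct C (antidiagonal n) (\<lambda>p. summands C X Y n (fst p)) (ob (X \<odot> Y) n)
      (\<lambda>p. \<iota> (summands C X Y n) (fst p))"
    unfolding ob_tensor
    by (rule coproduct_reindex[OF chosen_coproduct antidiagonal_bij(1)]) (use assms in simp)
  then show ?thesis
    by (rule is_coproduct_cong) (auto simp: antidiagonal_def summands_apply incl_eq)
qed

text \<open>
  The inclusions are jointly epic, so every equation of arrows out of a tensor product is checked on
  the summands \<open>X\<^sup>i \<otimes> Y\<^sup>j\<close>.
\<close>

lemma tensor_ext:
  assumes X: "graded X" "graded Y"
    and h: "h \<in> Arr C" "h' \<in> Arr C" "Dom C h = ob (X \<odot> Y) n" "Dom C h' = ob (X \<odot> Y) n"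
      "Cod C h' = Cod C h"
    and eq: "\<And>i j. n = i + j \<Longrightarrow> h \<cdot> incl X Y i j = h' \<cdot> incl X Y i j"
  shows "h = h'"
  by (rule coproduct_ext[OF tensor_coproduct[OF X, of n], of h "Cod C h"])
    (use h eq in \<open>auto simp: in_Hom antidiagonal_def\<close>)

lemma tensor_dif_props:
  assumes "differential X" "differential Y"
  shows "dif (X \<odot> Y) n \<in> Hom C (ob (X \<odot> Y) n) (ob (X \<odot> Y) (n + 1))"
    and "n = i + j \<Longrightarrow> dif (X \<odot> Y) n \<cdot> incl X Y i j =
      madd C (incl X Y (i + 1) j \<cdot> (dif X i \<otimes>\<^sub>a Idm C (ob Y j)))
        (scale C (\<xi> [^]\<^bsub>R\<^esub> i) (incl X Y i (j + 1) \<cdot> (Idm C (ob X i) \<otimes>\<^sub>a dif Y j)))"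
proof -
  let ?f = "\<lambda>i. madd C (incl X Y (i + 1) (n - i) \<cdot> (dif X i \<otimes>\<^sub>a Idm C (ob Y (n - i))))
        (scale C (\<xi> [^]\<^bsub>R\<^esub> i) (incl X Y i (n - i + 1) \<cdot> (Idm C (ob X i) \<otimes>\<^sub>a dif Y (n - i))))"
  have d: "dif (X \<odot> Y) n = coprod_copair C S \<iota> (summands C X Y n) (ob (X \<odot> Y) (n + 1)) ?f"
    by (simp add: complex_tensor_obj_def Let_def incl_def algebra_simps)
  have f: "?f i \<in> Arr C" "Dom C (?f i) = summands C X Y n i" "Cod C (?f i) = ob (X \<odot> Y) (n + 1)" for i
    using assms by (simp_all add: summands_apply algebra_simps)
  have c: "summands C X Y n i \<in> Obj C" "ob (X \<odot> Y) (n + 1) \<in> Obj C" for i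
    using assms by simp_all
  note p = coprod_copair_props[of "summands C X Y n" "ob (X \<odot> Y) (n + 1)" ?f, OF c f, folded d]
  show "dif (X \<odot> Y) n \<in> Hom C (ob (X \<odot> Y) n) (ob (X \<odot> Y) (n + 1))"
    using p by (simp add: in_Hom ob_tensor[of _ _ n])
  show "dif (X \<odot> Y) n \<cdot> incl X Y i j =
      madd C (incl X Y (i + 1) j \<cdot> (dif X i \<otimes>\<^sub>a Idm C (ob Y j)))
        (scale C (\<xi> [^]\<^bsub>R\<^esub> i) (incl X Y i (j + 1) \<cdot> (Idm C (ob X i) \<otimes>\<^sub>a dif Y j)))" if "n = i + j"
    using p(4)[of i] that by (simp add: incl_eq)
qed

lemmas tensor_dif = tensor_dif_props(2)

lemma differential_tensor [simp]: "\<lbrakk>differential X; differential Y\<rbrakk> \<Longrightarrow> differential (X \<odot> Y)"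
  by (simp add: differential_def[of "X \<odot> Y"] tensor_dif_props(1))

text \<open>
  On \<open>X\<^sup>i \<otimes> Y\<^sup>j\<close>, the power \<open>d ^ m\<close> is the sum over \<open>a + b = m\<close> of
  \<open>[m choose a] \<xi> ^ (i b) (d ^ a \<otimes> d ^ b)\<close>; the following definitions name its terms and
  coefficients.
\<close>

definition leibniz_term :: "('o, 'm) ncomplex \<Rightarrow> ('o, 'm) ncomplex \<Rightarrow> int \<Rightarrow> int \<Rightarrow> nat \<Rightarrow> nat \<Rightarrow> 'm"
  where "leibniz_term X Y i j a b = incl X Y (i + int a) (j + int b) \<cdot> (dif_pow C X a i \<otimes>\<^sub>a dif_pow C Y b j)"

definition leibniz_coeff :: "int \<Rightarrow> nat \<Rightarrow> nat \<Rightarrow> 'r"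
  where "leibniz_coeff i m a = qbinomial R \<xi> m a \<otimes>\<^bsub>R\<^esub> (\<xi> [^]\<^bsub>R\<^esub> i) [^]\<^bsub>R\<^esub> (m - a)"

lemma leibniz_term_props:
  assumes "differential X" "differential Y"
  shows "leibniz_term X Y i j a b \<in> Arr C" "Dom C (leibniz_term X Y i j a b) = ob X i \<otimes>\<^sub>o ob Y j"
    "Cod C (leibniz_term X Y i j a b) = ob (X \<odot> Y) (i + j + int (a + b))"
  using assms by (simp_all add: leibniz_term_def algebra_simps)

lemma leibniz_term_dif:
  assumes X: "differential X" "differential Y" and n: "n = i + j + int (a + b)"
  shows "dif (X \<odot> Y) n \<cdot> leibniz_term X Y i j a b =
    madd C (leibniz_term X Y i j (Suc a) b) (scale C (\<xi> [^]\<^bsub>R\<^esub> (i + int a)) (leibniz_term X Y i j a (Suc b)))"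
proof -
  let ?p = "dif_pow C X a i" and ?q = "dif_pow C Y b j" and ?i = "i + int a" and ?j = "j + int b"
  note [simp] = tensor_cmp_tensor
  have "dif (X \<odot> Y) n \<cdot> leibniz_term X Y i j a b = (dif (X \<odot> Y) n \<cdot> incl X Y ?i ?j) \<cdot> (?p \<otimes>\<^sub>a ?q)"
    using X n by (simp add: leibniz_term_def cmp_cmp algebra_simps)
  also have "\<dots> = madd C (incl X Y (?i + 1) ?j \<cdot> ((dif X ?i \<cdot> ?p) \<otimes>\<^sub>a ?q))
      (scale C (\<xi> [^]\<^bsub>R\<^esub> ?i) (incl X Y ?i (?j + 1) \<cdot> (?p \<otimes>\<^sub>a (dif Y ?j \<cdot> ?q))))"
    using X n by (subst tensor_dif) (simp_all add: madd_cmp scale_cmp cmp_cmp algebra_simps)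
  also have "\<dots> = madd C (leibniz_term X Y i j (Suc a) b) (scale C (\<xi> [^]\<^bsub>R\<^esub> ?i) (leibniz_term X Y i j a (Suc b)))"
    by (simp add: leibniz_term_def algebra_simps)
  finally show ?thesis .
qed

lemma leibniz_coeff_closed [simp]: "leibniz_coeff i m a \<in> carrier R"
  by (simp add: leibniz_coeff_def)

lemma leibniz_coeff_0: "leibniz_coeff i (Suc m) 0 = leibniz_coeff i m 0 \<otimes>\<^bsub>R\<^esub> \<xi> [^]\<^bsub>R\<^esub> i"
  by (simp add: leibniz_coeff_def)

text \<open>
  The Pascal rule in the form required by \<open>finsum_shift\<close>: a step of the first differential does not
  change the coefficient, and one of the second, starting in degree \<open>i + a + 1\<close>, multiplies it by
  the corresponding power of \<open>\<xi>\<close>.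
\<close>

lemma leibniz_coeff_Suc: "a \<le> m \<Longrightarrow> leibniz_coeff i (Suc m) (Suc a)
  = leibniz_coeff i m a \<oplus>\<^bsub>R\<^esub> leibniz_coeff i m (Suc a) \<otimes>\<^bsub>R\<^esub> \<xi> [^]\<^bsub>R\<^esub> (i + int (Suc a))"
proof (cases "a = m")
  case True
  then show ?thesis by (simp add: leibniz_coeff_def R.qbinomial_eq_0)
next
  case False
  assume "a \<le> m"
  then obtain d where d: "m - a = Suc d" "m - Suc a = d" using False by (cases "m - a") auto
  have "\<xi> [^]\<^bsub>R\<^esub> (i + int (Suc a)) = \<xi> [^]\<^bsub>R\<^esub> i \<otimes>\<^bsub>R\<^esub> \<xi> [^]\<^bsub>R\<^esub> Suc a"
    by (simp only: xi_pow_add int_pow_int)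
  then show ?thesis
    by (simp add: leibniz_coeff_def d R.l_distr R.r_distr R.m_ac del: of_nat_Suc)
qed

lemma tensor_dif_pow:
  assumes X: "differential X" "differential Y"
  shows "dif_pow C (X \<odot> Y) m (i + j) \<cdot> incl X Y i j =
    finsum (hom_group C (ob X i \<otimes>\<^sub>o ob Y j) (ob (X \<odot> Y) (i + j + int m)))
      (\<lambda>a. scale C (leibniz_coeff i m a) (leibniz_term X Y i j a (m - a))) {..m}"
proof (induction m)
  case 0
  interpret H: abelian_group "hom_group C (ob X i \<otimes>\<^sub>o ob Y j) (ob (X \<odot> Y) (i + j))"
    using X by (intro hom_abelian) simp_all
  have 1: "scale C (leibniz_coeff i 0 0) (leibniz_term X Y i j 0 0) = incl X Y i j"
    using X by (simp add: leibniz_coeff_def leibniz_term_def)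
  have "incl X Y i j \<in> carrier (hom_group C (ob X i \<otimes>\<^sub>o ob Y j) (ob (X \<odot> Y) (i + j)))"
    using X by (simp add: in_Hom)
  then show ?case using X 1 by simp
next
  case (Suc m)
  let ?A = "ob X i \<otimes>\<^sub>o ob Y j" and ?B = "ob (X \<odot> Y) (i + j + int m)"
    and ?B' = "ob (X \<odot> Y) (i + j + int (Suc m))"
  let ?D = "dif (X \<odot> Y) (i + j + int m)"
  let ?s = "\<lambda>a. scale C (leibniz_coeff i m a) (leibniz_term X Y i j a (m - a))"
  let ?U = "\<lambda>a. scale C (leibniz_coeff i m a) (leibniz_term X Y i j (Suc a) (m - a))"
  let ?V = "\<lambda>a. scale C (leibniz_coeff i m a \<otimes>\<^bsub>R\<^esub> \<xi> [^]\<^bsub>R\<^esub> (i + int a)) (leibniz_term X Y i j a (Suc m - a))"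
  let ?W = "\<lambda>a. scale C (leibniz_coeff i (Suc m) a) (leibniz_term X Y i j a (Suc m - a))"
  note [simp] = leibniz_term_props[OF X]
  interpret K: abelian_group "hom_group C ?A ?B'"
    using X by (intro hom_abelian) simp_all
  have s: "?s a \<in> Hom C ?A ?B" if "a \<le> m" for a
    using X that by (simp add: in_Hom)
  have U: "?U a \<in> Hom C ?A ?B'" if "a \<le> m" for a
    using X that by (simp add: in_Hom)
  have V: "?V a \<in> Hom C ?A ?B'" "?W a \<in> Hom C ?A ?B'" if "a \<le> Suc m" for a
    using X that by (simp_all add: in_Hom of_nat_diff)
  have D: "?D \<in> Hom C ?B ?B'"
    using tensor_dif_props(1)[OF X, of "i + j + int m"] by (simp add: algebra_simps)
  have step: "?D \<cdot> ?s a = madd C (?U a) (?V a)" if "a \<le> m" for a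
    using X that leibniz_term_dif[OF X, of "i + j + int m" i j a "m - a"]
    by (simp add: cmp_scale scale_madd scale_scale Suc_diff_le algebra_simps)
  have Vm: "?V (Suc m) = mzero C ?A ?B'"
    using X by (simp add: leibniz_coeff_def R.qbinomial_eq_0)
  \<comment> \<open>for \<open>a = m\<close> the arrow \<open>?V (Suc a)\<close> is zero, by \<open>Vm\<close>\<close>
  have W: "?W (Suc a) = madd C (?U a) (?V (Suc a))" if "a \<le> m" for a
  proof -
    have "?W (Suc a) = scale C (leibniz_coeff i m a \<oplus>\<^bsub>R\<^esub> leibniz_coeff i m (Suc a) \<otimes>\<^bsub>R\<^esub> \<xi> [^]\<^bsub>R\<^esub> (i + int (Suc a)))
        (leibniz_term X Y i j (Suc a) (m - a))"
      by (simp only: leibniz_coeff_Suc[OF that] diff_Suc_Suc)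
    also have "\<dots> = madd C (?U a) (?V (Suc a))"
      by (subst scale_add) simp_all
    finally show ?thesis .
  qed
  have W0: "?W 0 = ?V 0" by (simp add: leibniz_coeff_0)
  have "dif_pow C (X \<odot> Y) (Suc m) (i + j) \<cdot> incl X Y i j = ?D \<cdot> (dif_pow C (X \<odot> Y) m (i + j) \<cdot> incl X Y i j)"
    using X by (simp add: cmp_cmp)
  also have "\<dots> = finsum (hom_group C ?A ?B') (\<lambda>a. ?D \<cdot> ?s a) {..m}"
    unfolding Suc.IH using X s D by (intro cmp_sum) simp_all
  also have "\<dots> = finsum (hom_group C ?A ?B') (\<lambda>a. add (hom_group C ?A ?B') (?U a) (?V a)) {..m}"
    by (rule K.finsum_cong') (use U V(1) step madd_Hom in auto)
  also have "\<dots> = finsum (hom_group C ?A ?B') ?W {..Suc m}"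
    by (rule K.finsum_shift) (use U V(1) Vm W W0 in \<open>simp_all only: hom_group_sel\<close>)
  finally show ?case .
qed

text \<open>
  In \<open>d ^ N\<close> the inner terms have vanishing coefficients, and the two outer terms contain
  \<open>d ^ N\<close> of one of the factors.
\<close>

lemma is_ncomplex_tensor:
  assumes X: "is_ncomplex C N X" "is_ncomplex C N Y"
    and coeff: "\<And>a f. \<lbrakk>0 < a; a < N; f \<in> Arr C\<rbrakk>
      \<Longrightarrow> scale C (qbinomial R \<xi> N a) f = mzero C (Dom C f) (Cod C f)"
  shows "is_ncomplex C N (X \<odot> Y)"
proof -
  have d: "differential X" "differential Y" using X by (simp_all add: is_ncomplex_iff)
  note [simp] = leibniz_term_props[OF d]
  have "dif_pow C (X \<odot> Y) N n = mzero C (ob (X \<odot> Y) n) (ob (X \<odot> Y) (n + int N))" for n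
  proof (rule tensor_ext[of X Y _ _ n])
    fix i j assume n: "n = i + j"
    let ?A = "ob X i \<otimes>\<^sub>o ob Y j" and ?B = "ob (X \<odot> Y) (i + j + int N)"
    interpret K: abelian_group "hom_group C ?A ?B"
      using d by (intro hom_abelian) simp_all
    have z: "scale C (leibniz_coeff i N a) (leibniz_term X Y i j a (N - a)) = mzero C ?A ?B" if le: "a \<le> N" for a
    proof -
      consider "a = 0" | "a = N" | "0 < a" "a < N" using le by linarith
      then show ?thesis
      proof cases
        case 1
        then show ?thesis using d X(2) by (simp add: leibniz_term_def is_ncomplex_iff algebra_simps)
      next
        case 2
        then show ?thesis using d X(1) by (simp add: leibniz_term_def is_ncomplex_iff algebra_simps)
      next
        case 3
        then show ?thesis
          using d coeff[OF 3] by (simp add: leibniz_coeff_def flip: scale_scale)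
      qed
    qed
    have "dif_pow C (X \<odot> Y) N n \<cdot> incl X Y i j = mzero C ?A ?B"
      unfolding n tensor_dif_pow[OF d]
      using z K.finsum_zero[of "{..N}"] K.zero_closed
      by (subst K.finsum_cong'[OF refl, where g = "\<lambda>_. mzero C ?A ?B"]) simp_all
    then show "dif_pow C (X \<odot> Y) N n \<cdot> incl X Y i j
        = mzero C (ob (X \<odot> Y) n) (ob (X \<odot> Y) (n + int N)) \<cdot> incl X Y i j"
      using d n by simp
  qed (use d in simp_all)
  then show ?thesis using d by (simp add: is_ncomplex_iff)
qed

section \<open>The associator\<close>

lemma countable_tensor_left_antidiagonal:
  assumes "graded X" "graded Y" "B \<in> Obj C"
  shows "is_coproduct C (antidiagonal n) (\<lambda>(i, j). B \<otimes>\<^sub>o (ob X i \<otimes>\<^sub>o ob Y j)) (B \<otimes>\<^sub>o ob (X \<odot> Y) n)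
    (\<lambda>(i, j). Idm C B \<otimes>\<^sub>a incl X Y i j)"
  by (rule is_coproduct_cong[OF countable_tensor_left[OF tensor_coproduct[OF assms(1,2)] assms(3)
      antidiagonal_bij(2)]]) auto

lemma countable_tensor_right_antidiagonal:
  assumes "graded X" "graded Y" "B \<in> Obj C"
  shows "is_coproduct C (antidiagonal n) (\<lambda>(i, j). (ob X i \<otimes>\<^sub>o ob Y j) \<otimes>\<^sub>o B) (ob (X \<odot> Y) n \<otimes>\<^sub>o B)
    (\<lambda>(i, j). incl X Y i j \<otimes>\<^sub>a Idm C B)"
  by (rule is_coproduct_cong[OF countable_tensor_right[OF tensor_coproduct[OF assms(1,2)] assms(3)
      antidiagonal_bij(2)]]) auto

lemma countable_tensor_right_right_antidiagonal:
  assumes "graded X" "graded Y" "B \<in> Obj C" "D \<in> Obj C"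
  shows "is_coproduct C (antidiagonal n) (\<lambda>(i, j). ((ob X i \<otimes>\<^sub>o ob Y j) \<otimes>\<^sub>o B) \<otimes>\<^sub>o D)
    ((ob (X \<odot> Y) n \<otimes>\<^sub>o B) \<otimes>\<^sub>o D) (\<lambda>(i, j). (incl X Y i j \<otimes>\<^sub>a Idm C B) \<otimes>\<^sub>a Idm C D)"
  by (rule is_coproduct_cong[OF countable_tensor_right[OF
      countable_tensor_right_antidiagonal[OF assms(1-3)] assms(4) antidiagonal_bij(2)]]) auto

text \<open>
  The inclusions of the summands of the two triple tensor products. By distributivity both objects
  are coproducts over all triples \<open>i + j + k = n\<close>.
\<close>

definition lincl where
  "lincl X Y Z i j k = incl (X \<odot> Y) Z (i + j) k \<cdot> (incl X Y i j \<otimes>\<^sub>a Idm C (ob Z k))"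

definition rincl where
  "rincl X Y Z i j k = incl X (Y \<odot> Z) i (j + k) \<cdot> (Idm C (ob X i) \<otimes>\<^sub>a incl Y Z j k)"

lemma lincl_Arr [simp]: "\<lbrakk>graded X; graded Y; graded Z\<rbrakk> \<Longrightarrow> lincl X Y Z i j k \<in> Arr C"
  and lincl_Dom [simp]: "\<lbrakk>graded X; graded Y; graded Z\<rbrakk>
    \<Longrightarrow> Dom C (lincl X Y Z i j k) = (ob X i \<otimes>\<^sub>o ob Y j) \<otimes>\<^sub>o ob Z k"
  and lincl_Cod [simp]: "\<lbrakk>graded X; graded Y; graded Z\<rbrakk>
    \<Longrightarrow> Cod C (lincl X Y Z i j k) = ob ((X \<odot> Y) \<odot> Z) (i + j + k)"
  by (simp_all add: lincl_def)

lemma rincl_Arr [simp]: "\<lbrakk>graded X; graded Y; graded Z\<rbrakk> \<Longrightarrow> rincl X Y Z i j k \<in> Arr C"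
  and rincl_Dom [simp]: "\<lbrakk>graded X; graded Y; graded Z\<rbrakk>
    \<Longrightarrow> Dom C (rincl X Y Z i j k) = ob X i \<otimes>\<^sub>o (ob Y j \<otimes>\<^sub>o ob Z k)"
  and rincl_Cod [simp]: "\<lbrakk>graded X; graded Y; graded Z\<rbrakk>
    \<Longrightarrow> Cod C (rincl X Y Z i j k) = ob (X \<odot> (Y \<odot> Z)) (i + j + k)"
  by (simp_all add: rincl_def add.assoc)

definition triples :: "int \<Rightarrow> (int \<times> int \<times> int) set"
  where "triples n = {(i, j, k). i + j + k = n}"

lemma lincl_coproduct:
  assumes X: "graded X" "graded Y" "graded Z"
  shows "is_coproduct C (triples n) (\<lambda>(i, j, k). (ob X i \<otimes>\<^sub>o ob Y j) \<otimes>\<^sub>o ob Z k)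
    (ob ((X \<odot> Y) \<odot> Z) n) (\<lambda>(i, j, k). lincl X Y Z i j k)"
proof -
  have "is_coproduct C (Sigma (antidiagonal n) (\<lambda>(m, k). antidiagonal m))
      (\<lambda>(p, q). (case p of (m, k) \<Rightarrow> \<lambda>(i, j). (ob X i \<otimes>\<^sub>o ob Y j) \<otimes>\<^sub>o ob Z k) q) (ob ((X \<odot> Y) \<odot> Z) n)
      (\<lambda>(p, q). (case p of (m, k) \<Rightarrow> incl (X \<odot> Y) Z m k) \<cdot>
        (case p of (m, k) \<Rightarrow> \<lambda>(i, j). incl X Y i j \<otimes>\<^sub>a Idm C (ob Z k)) q)"
  proof (rule coproduct_iterate[OF tensor_coproduct])
    show "is_coproduct C (case p of (m, k) \<Rightarrow> antidiagonal m)
        (case p of (m, k) \<Rightarrow> \<lambda>(i, j). (ob X i \<otimes>\<^sub>o ob Y j) \<otimes>\<^sub>o ob Z k)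
        (case p of (m, k) \<Rightarrow> ob (X \<odot> Y) m \<otimes>\<^sub>o ob Z k)
        (case p of (m, k) \<Rightarrow> \<lambda>(i, j). incl X Y i j \<otimes>\<^sub>a Idm C (ob Z k))" for p
      using X countable_tensor_right_antidiagonal[of X Y] by (cases p) simp
  qed (use X in simp_all)
  moreover have "bij_betw (\<lambda>(i, j, k). ((i + j, k), (i, j))) (triples n)
      (Sigma (antidiagonal n) (\<lambda>(m, k). antidiagonal m))"
    by (rule bij_betw_byWitness[where f' = "\<lambda>((m, k), (i, j)). (i, j, k)"])
      (auto simp: antidiagonal_def triples_def)
  ultimately show ?thesis
    by (rule is_coproduct_cong[OF coproduct_reindex]) (auto simp: lincl_def)
qed

lemma rincl_coproduct:
  assumes X: "graded X" "graded Y" "graded Z"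
  shows "is_coproduct C (triples n) (\<lambda>(i, j, k). ob X i \<otimes>\<^sub>o (ob Y j \<otimes>\<^sub>o ob Z k))
    (ob (X \<odot> (Y \<odot> Z)) n) (\<lambda>(i, j, k). rincl X Y Z i j k)"
proof -
  have "is_coproduct C (Sigma (antidiagonal n) (\<lambda>(i, m). antidiagonal m))
      (\<lambda>(p, q). (case p of (i, m) \<Rightarrow> \<lambda>(j, k). ob X i \<otimes>\<^sub>o (ob Y j \<otimes>\<^sub>o ob Z k)) q) (ob (X \<odot> (Y \<odot> Z)) n)
      (\<lambda>(p, q). (case p of (i, m) \<Rightarrow> incl X (Y \<odot> Z) i m) \<cdot>
        (case p of (i, m) \<Rightarrow> \<lambda>(j, k). Idm C (ob X i) \<otimes>\<^sub>a incl Y Z j k) q)"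
  proof (rule coproduct_iterate[OF tensor_coproduct])
    show "is_coproduct C (case p of (i, m) \<Rightarrow> antidiagonal m)
        (case p of (i, m) \<Rightarrow> \<lambda>(j, k). ob X i \<otimes>\<^sub>o (ob Y j \<otimes>\<^sub>o ob Z k))
        (case p of (i, m) \<Rightarrow> ob X i \<otimes>\<^sub>o ob (Y \<odot> Z) m)
        (case p of (i, m) \<Rightarrow> \<lambda>(j, k). Idm C (ob X i) \<otimes>\<^sub>a incl Y Z j k)" for p
      using X countable_tensor_left_antidiagonal[of Y Z] by (cases p) simp
  qed (use X in simp_all)
  moreover have "bij_betw (\<lambda>(i, j, k). ((i, j + k), (j, k))) (triples n)
      (Sigma (antidiagonal n) (\<lambda>(i, m). antidiagonal m))"
    by (rule bij_betw_byWitness[where f' = "\<lambda>((i, m), (j, k)). (i, j, k)"])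
      (auto simp: antidiagonal_def triples_def)
  ultimately show ?thesis
    by (rule is_coproduct_cong[OF coproduct_reindex]) (auto simp: rincl_def)
qed

lemma lincl_ext:
  assumes X: "graded X" "graded Y" "graded Z"
    and h: "h \<in> Arr C" "h' \<in> Arr C" "Dom C h = ob ((X \<odot> Y) \<odot> Z) n" "Dom C h' = ob ((X \<odot> Y) \<odot> Z) n"
      "Cod C h' = Cod C h"
    and eq: "\<And>i j k. n = i + j + k \<Longrightarrow> h \<cdot> lincl X Y Z i j k = h' \<cdot> lincl X Y Z i j k"
  shows "h = h'"
  by (rule coproduct_ext[OF lincl_coproduct[OF X, of n], of h "Cod C h"])
    (use h eq in \<open>auto simp: in_Hom triples_def\<close>)

text \<open>
  The inclusions of \<open>((W\<^sup>i \<otimes> X\<^sup>j) \<otimes> Y\<^sup>k) \<otimes> Z\<^sup>l\<close> into the fourfold tensor product are jointly epic,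
  since tensoring twice on the right preserves the coproduct that defines the tensor product of
  \<open>W\<close> and \<open>X\<close>.
\<close>

lemma lincl_lincl_ext:
  assumes X: "graded W" "graded X" "graded Y" "graded Z"
    and h: "h \<in> Arr C" "h' \<in> Arr C" "Dom C h = ob (((W \<odot> X) \<odot> Y) \<odot> Z) n"
      "Dom C h' = ob (((W \<odot> X) \<odot> Y) \<odot> Z) n" "Cod C h' = Cod C h"
    and eq: "\<And>i j k l. n = i + j + k + l \<Longrightarrow>
      h \<cdot> (lincl (W \<odot> X) Y Z (i + j) k l \<cdot> ((incl W X i j \<otimes>\<^sub>a Idm C (ob Y k)) \<otimes>\<^sub>a Idm C (ob Z l)))
      = h' \<cdot> (lincl (W \<odot> X) Y Z (i + j) k l \<cdot> ((incl W X i j \<otimes>\<^sub>a Idm C (ob Y k)) \<otimes>\<^sub>a Idm C (ob Z l)))"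
  shows "h = h'"
proof (rule lincl_ext[of "W \<odot> X" Y Z _ _ n])
  fix m k l assume n: "n = m + k + l"
  show "h \<cdot> lincl (W \<odot> X) Y Z m k l = h' \<cdot> lincl (W \<odot> X) Y Z m k l"
  proof (rule coproduct_ext[OF countable_tensor_right_right_antidiagonal[of W X "ob Y k" "ob Z l" m]])
    fix p assume p: "p \<in> antidiagonal m"
    then obtain i j where p: "p = (i, j)" "m = i + j" by (auto simp: antidiagonal_def)
    show "h \<cdot> lincl (W \<odot> X) Y Z m k l \<cdot> (case p of (i, j) \<Rightarrow> (incl W X i j \<otimes>\<^sub>a Idm C (ob Y k)) \<otimes>\<^sub>a Idm C (ob Z l))
      = h' \<cdot> lincl (W \<odot> X) Y Z m k l \<cdot> (case p of (i, j) \<Rightarrow> (incl W X i j \<otimes>\<^sub>a Idm C (ob Y k)) \<otimes>\<^sub>a Idm C (ob Z l))"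
      using eq[of i j k l] n p h X by (simp add: cmp_cmp)
  qed (use X h n in \<open>simp_all add: in_Hom\<close>)
qed (use X h in simp_all)

lemma sigma_props:
  assumes Y: "\<And>i. Y i \<in> Obj C" and X: "X \<in> Obj C"
  shows "is_iso C (sigma C S \<iota> Y X)" "Dom C (sigma C S \<iota> Y X) = S (\<lambda>i. Y i \<otimes>\<^sub>o X)"
    "Cod C (sigma C S \<iota> Y X) = S Y \<otimes>\<^sub>o X"
    "inv_arrow C (sigma C S \<iota> Y X) \<cdot> (\<iota> Y i \<otimes>\<^sub>a Idm C X) = \<iota> (\<lambda>i. Y i \<otimes>\<^sub>o X) i"
proof -
  let ?W = "\<lambda>i. Y i \<otimes>\<^sub>o X" and ?s = "sigma C S \<iota> Y X"
  have W: "?W i \<in> Obj C" for i using Y X by simp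
  note P = chosen_coproduct[of Y, OF Y] and Q = chosen_coproduct[of ?W, OF W]
  have s: "?s = copair C UNIV (S ?W) (\<iota> ?W) (S Y \<otimes>\<^sub>o X) (\<lambda>i. \<iota> Y i \<otimes>\<^sub>a Idm C X)"
    by (simp add: sigma_def dist_right_def Let_def)
  have "distributes C (UNIV :: int set) X Y"
    using Y X by (intro countable_distributes) auto
  then show iso: "is_iso C ?s"
    using P Q unfolding distributes_def sigma_def Let_def by blast
  have h: "\<iota> Y i \<otimes>\<^sub>a Idm C X \<in> Hom C (?W i) (S Y \<otimes>\<^sub>o X)" for i
    using Y X by (simp add: in_Hom)
  have o: "S Y \<otimes>\<^sub>o X \<in> Obj C" using Y X by simp
  note c = copair_props[OF Q o h, folded s]
  show d: "Dom C ?s = S ?W" "Cod C ?s = S Y \<otimes>\<^sub>o X" using c(1) by (simp_all add: in_Hom)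
  have "inv_arrow C ?s \<cdot> (\<iota> Y i \<otimes>\<^sub>a Idm C X) = inv_arrow C ?s \<cdot> (?s \<cdot> \<iota> ?W i)"
    using c(2)[of i] by simp
  also have "\<dots> = (inv_arrow C ?s \<cdot> ?s) \<cdot> \<iota> ?W i"
    using iso d W is_iso_Arr[OF iso] chosen_props[of ?W, OF W] by (subst cmp_cmp) simp_all
  also have "\<dots> = \<iota> ?W i"
    using iso d W is_iso_Arr[OF iso] chosen_props[of ?W, OF W] by simp
  finally show "inv_arrow C ?s \<cdot> (\<iota> Y i \<otimes>\<^sub>a Idm C X) = \<iota> ?W i" .
qed

lemma tau_props:
  assumes Y: "\<And>i. Y i \<in> Obj C" and X: "X \<in> Obj C"
  shows "tau C S \<iota> X Y \<in> Arr C" "Dom C (tau C S \<iota> X Y) = S (\<lambda>i. X \<otimes>\<^sub>o Y i)"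
    "Cod C (tau C S \<iota> X Y) = X \<otimes>\<^sub>o S Y"
    "tau C S \<iota> X Y \<cdot> \<iota> (\<lambda>i. X \<otimes>\<^sub>o Y i) i = Idm C X \<otimes>\<^sub>a \<iota> Y i"
proof -
  let ?W = "\<lambda>i. X \<otimes>\<^sub>o Y i"
  have W: "?W i \<in> Obj C" for i using Y X by simp
  have h: "Idm C X \<otimes>\<^sub>a \<iota> Y i \<in> Hom C (?W i) (X \<otimes>\<^sub>o S Y)" for i
    using Y X by (simp add: in_Hom)
  have o: "X \<otimes>\<^sub>o S Y \<in> Obj C" using Y X by simp
  have s: "tau C S \<iota> X Y = copair C UNIV (S ?W) (\<iota> ?W) (X \<otimes>\<^sub>o S Y) (\<lambda>i. Idm C X \<otimes>\<^sub>a \<iota> Y i)"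
    by (simp add: tau_def dist_left_def Let_def)
  note c = copair_props[OF chosen_coproduct[of ?W, OF W] o h, folded s]
  show "tau C S \<iota> X Y \<in> Arr C" "Dom C (tau C S \<iota> X Y) = S ?W" "Cod C (tau C S \<iota> X Y) = X \<otimes>\<^sub>o S Y"
    "tau C S \<iota> X Y \<cdot> \<iota> ?W i = Idm C X \<otimes>\<^sub>a \<iota> Y i"
    using c by (simp_all add: in_Hom)
qed

abbreviation asc where "asc X Y Z \<equiv> complex_assoc R C \<xi> S \<iota> X Y Z"

text \<open>
  The four-step composite that defines the associator is characterised by its effect on summands:
  it carries \<open>(X\<^sup>i \<otimes> Y\<^sup>j) \<otimes> Z\<^sup>k\<close> to \<open>X\<^sup>i \<otimes> (Y\<^sup>j \<otimes> Z\<^sup>k)\<close> by the associator of the base category.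
  All later facts about the associator are derived from this description.
\<close>

lemma assoc_comps_props:
  assumes X: "graded X" "graded Y" "graded Z"
  shows "comps (asc X Y Z) n \<in> Hom C (ob ((X \<odot> Y) \<odot> Z) n) (ob (X \<odot> (Y \<odot> Z)) n)"
    and "n = i + j + k \<Longrightarrow> comps (asc X Y Z) n \<cdot> lincl X Y Z i j k
      = rincl X Y Z i j k \<cdot> assoc C (ob X i) (ob Y j) (ob Z k)"
proof -
  define A where "A = (\<lambda>m i. (ob X i \<otimes>\<^sub>o ob Y (m - i)) \<otimes>\<^sub>o ob Z (n - m))"
  define B where "B = (\<lambda>i k. (ob X i \<otimes>\<^sub>o ob Y k) \<otimes>\<^sub>o ob Z (n - i - k))"
  define D where "D = (\<lambda>i k. ob X i \<otimes>\<^sub>o (ob Y k \<otimes>\<^sub>o ob Z (n - i - k)))"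
  define sg where "sg = (\<lambda>m. sigma C S \<iota> (summands C X Y m) (ob Z (n - m)))"
  define ta where "ta = (\<lambda>i. tau C S \<iota> (ob X i) (summands C Y Z (n - i)))"
  define as where "as = (\<lambda>i k. assoc C (ob X i) (ob Y k) (ob Z (n - i - k)))"
  define re where "re = (\<lambda>i. coprod_map C S \<iota> (B i) (D i) (as i))"
  define rg where "rg = (\<lambda>m. coprod_copair C S \<iota> (A m) (S (\<lambda>i. S (B i)))
                (\<lambda>i. \<iota> (\<lambda>i. S (B i)) i \<cdot> \<iota> (B i) (m - i)))"
  let ?SA = "\<lambda>m. S (A m)" and ?SB = "\<lambda>i. S (B i)" and ?SD = "\<lambda>i. S (D i)"
  define expand where "expand = coprod_map C S \<iota> (summands C (X \<odot> Y) Z n) ?SA (\<lambda>m. inv_arrow C (sg m))"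
  define regroup where "regroup = coprod_copair C S \<iota> ?SA (S ?SB) rg"
  define reassoc where "reassoc = coprod_map C S \<iota> ?SB ?SD re"
  define collect where "collect = coprod_map C S \<iota> ?SD (summands C X (Y \<odot> Z) n) ta"
  have comps: "comps (asc X Y Z) n = collect \<cdot> reassoc \<cdot> regroup \<cdot> expand"
    unfolding complex_assoc_def Let_def collect_def reassoc_def regroup_def expand_def
      rg_def re_def as_def ta_def sg_def D_def B_def A_def by simp
  have sg_eq: "sg m = sigma C S \<iota> (summands C X Y m) (ob Z (n - m))" for m by (simp add: sg_def)
  have ta_eq: "ta i = tau C S \<iota> (ob X i) (summands C Y Z (n - i))" for i by (simp add: ta_def)
  have re_eq: "re i = coprod_map C S \<iota> (B i) (D i) (as i)" for i by (simp add: re_def)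
  have rg_eq: "rg m = coprod_copair C S \<iota> (A m) (S (\<lambda>i. S (B i)))
                (\<lambda>i. \<iota> (\<lambda>i. S (B i)) i \<cdot> \<iota> (B i) (m - i))" for m by (simp add: rg_def)
  have o: "A m i \<in> Obj C" "B i j \<in> Obj C" "D i j \<in> Obj C" for m i j
    using X by (simp_all add: A_def B_def D_def)
  note oS = chosen_props[of "A m" for m, OF o(1)] chosen_props[of "B i" for i, OF o(2)]
    chosen_props[of "D i" for i, OF o(3)]
  note oSS = chosen_props[of ?SA, OF oS(1)] chosen_props[of ?SB, OF oS(5)] chosen_props[of ?SD, OF oS(9)]
  have W: "(\<lambda>i. summands C X Y m i \<otimes>\<^sub>o ob Z (n - m)) = A m" for m
    by (simp add: A_def summands_apply)
  have "summands C X Y m i \<in> Obj C" for m i using X by simp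
  note sg = sigma_props[of "summands C X Y m" "ob Z (n - m)" for m, OF this, folded sg_eq, unfolded W]
  have V: "(\<lambda>j. ob X i \<otimes>\<^sub>o summands C Y Z (n - i) j) = D i" for i
    by (simp add: D_def summands_apply)
  have "summands C Y Z m i \<in> Obj C" for m i using X by simp
  note ta = tau_props[of "summands C Y Z (n - i)" "ob X i" for i, OF this, folded ta_eq, unfolded V]
  have as: "as i j \<in> Arr C" "Dom C (as i j) = B i j" "Cod C (as i j) = D i j" for i j
    using X by (simp_all add: as_def B_def D_def)
  note re = coprod_map_props[of "as i" "B i" "D i" for i, OF as, folded re_eq]
  \<comment> \<open>the regrouping \<open>m = i + k\<close> identifies the two families of summands\<close>
  have AB: "A m i = B i (m - i)" for m i by (simp add: A_def B_def)
  have rgc: "\<iota> ?SB i \<cdot> \<iota> (B i) (m - i) \<in> Arr C" "Dom C (\<iota> ?SB i \<cdot> \<iota> (B i) (m - i)) = A m i"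
    "Cod C (\<iota> ?SB i \<cdot> \<iota> (B i) (m - i)) = S ?SB" for m i
    using oS oSS by (simp_all add: AB)
  note rg = coprod_copair_props[of "A m" "S ?SB" "\<lambda>i. \<iota> ?SB i \<cdot> \<iota> (B i) (m - i)" for m,
      OF o(1) oSS(5) rgc, folded rg_eq]
  have sm: "summands C (X \<odot> Y) Z n m = ob (X \<odot> Y) m \<otimes>\<^sub>o ob Z (n - m)"
    "summands C X (Y \<odot> Z) n m = ob X m \<otimes>\<^sub>o ob (Y \<odot> Z) (n - m)" for m
    by (simp_all add: summands_apply)
  have "inv_arrow C (sg m) \<in> Arr C" "Dom C (inv_arrow C (sg m)) = summands C (X \<odot> Y) Z n m"
    "Cod C (inv_arrow C (sg m)) = S (A m)" for m
    using X sg[of m] by (simp_all add: sm ob_tensor[of X Y])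
  note ex = coprod_map_props[of "\<lambda>m. inv_arrow C (sg m)" "summands C (X \<odot> Y) Z n" ?SA, OF this, folded expand_def]
  note rgr = coprod_copair_props[of ?SA "S ?SB" rg, OF oS(1) oSS(5) rg(1-3), folded regroup_def]
  note rea = coprod_map_props[of re ?SB ?SD, OF re(1-3), folded reassoc_def]
  have "ta i \<in> Arr C" "Dom C (ta i) = S (D i)" "Cod C (ta i) = summands C X (Y \<odot> Z) n i" for i
    using X ta[of i] by (simp_all add: sm ob_tensor[of Y Z])
  note col = coprod_map_props[of ta ?SD "summands C X (Y \<odot> Z) n", OF this, folded collect_def]
  show "comps (asc X Y Z) n \<in> Hom C (ob ((X \<odot> Y) \<odot> Z) n) (ob (X \<odot> (Y \<odot> Z)) n)"
    unfolding comps in_Hom using ex(1-3) rgr(1-3) rea(1-3) col(1-3)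
    by (simp add: ob_tensor[of "X \<odot> Y" Z] ob_tensor[of X "Y \<odot> Z"])
  assume n: "n = i + j + k"
  have k: "k = n - (i + j)" "k = n - i - j" using n by simp_all
  let ?i1 = "\<iota> (summands C (X \<odot> Y) Z n) (i + j)" and ?i2 = "\<iota> (summands C X Y (i + j)) i \<otimes>\<^sub>a Idm C (ob Z k)"
  have i1: "?i1 = incl (X \<odot> Y) Z (i + j) k" "?i2 = incl X Y i j \<otimes>\<^sub>a Idm C (ob Z k)"
    using n by (simp_all add: incl_eq)
  have t1: "?i1 \<in> Arr C" "Dom C ?i1 = ob (X \<odot> Y) (i + j) \<otimes>\<^sub>o ob Z k" "Cod C ?i1 = S (summands C (X \<odot> Y) Z n)"
    using X n unfolding i1 by (simp_all add: ob_tensor[of "X \<odot> Y" Z])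
  have t2: "?i2 \<in> Arr C" "Cod C ?i2 = ob (X \<odot> Y) (i + j) \<otimes>\<^sub>o ob Z k" "Dom C ?i2 = A (i + j) i"
    using X n unfolding i1 by (simp_all add: A_def)
  note tys = ex(1-3) rgr(1-3) rea(1-3) col(1-3) t1 t2 oS oSS rg(1-3) re(1-3) as
  have sgt: "inv_arrow C (sg (i + j)) \<in> Arr C" "Dom C (inv_arrow C (sg (i + j))) = ob (X \<odot> Y) (i + j) \<otimes>\<^sub>o ob Z k"
    "Cod C (inv_arrow C (sg (i + j))) = S (A (i + j))"
    using X sg[of "i + j"] k(1) by (simp_all add: ob_tensor[of X Y])
  have e1: "expand \<cdot> (?i1 \<cdot> ?i2) = \<iota> ?SA (i + j) \<cdot> \<iota> (A (i + j)) i"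
  proof -
    have "expand \<cdot> (?i1 \<cdot> ?i2) = (\<iota> ?SA (i + j) \<cdot> inv_arrow C (sg (i + j))) \<cdot> ?i2"
      using tys ex(4)[of "i + j"] by (simp flip: cmp_cmp)
    also have "\<dots> = \<iota> ?SA (i + j) \<cdot> (inv_arrow C (sg (i + j)) \<cdot> ?i2)"
      using tys sgt by (subst cmp_cmp) simp_all
    also have "inv_arrow C (sg (i + j)) \<cdot> ?i2 = \<iota> (A (i + j)) i"
      using sg(4)[of "i + j" i] X k(1) by simp
    finally show ?thesis .
  qed
  have e2: "regroup \<cdot> (\<iota> ?SA (i + j) \<cdot> \<iota> (A (i + j)) i) = \<iota> ?SB i \<cdot> \<iota> (B i) j"
  proof -
    have "regroup \<cdot> (\<iota> ?SA (i + j) \<cdot> \<iota> (A (i + j)) i) = rg (i + j) \<cdot> \<iota> (A (i + j)) i"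
      using tys rgr(4)[of "i + j"] by (simp flip: cmp_cmp)
    then show ?thesis using rg(4)[of "i + j" i] by simp
  qed
  have e3: "reassoc \<cdot> (\<iota> ?SB i \<cdot> \<iota> (B i) j) = \<iota> ?SD i \<cdot> (\<iota> (D i) j \<cdot> as i j)"
  proof -
    have "reassoc \<cdot> (\<iota> ?SB i \<cdot> \<iota> (B i) j) = (\<iota> ?SD i \<cdot> re i) \<cdot> \<iota> (B i) j"
      using tys rea(4)[of i] by (simp flip: cmp_cmp)
    also have "\<dots> = \<iota> ?SD i \<cdot> (re i \<cdot> \<iota> (B i) j)"
      using tys by (subst cmp_cmp) simp_all
    finally show ?thesis using re(4)[of i j] by simp
  qed
  have tat: "ta i \<in> Arr C" "Dom C (ta i) = S (D i)" "Cod C (ta i) = ob X i \<otimes>\<^sub>o ob (Y \<odot> Z) (j + k)"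
    using X ta[of i] n by (simp_all add: ob_tensor[of Y Z])
  have i3: "\<iota> (summands C X (Y \<odot> Z) n) i = incl X (Y \<odot> Z) i (j + k)" "\<iota> (summands C Y Z (n - i)) j = incl Y Z j k"
    using n by (simp_all add: incl_eq)
  have e4: "collect \<cdot> (\<iota> ?SD i \<cdot> (\<iota> (D i) j \<cdot> as i j)) = rincl X Y Z i j k \<cdot> as i j"
  proof -
    have "collect \<cdot> (\<iota> ?SD i \<cdot> (\<iota> (D i) j \<cdot> as i j)) = (\<iota> (summands C X (Y \<odot> Z) n) i \<cdot> ta i) \<cdot> (\<iota> (D i) j \<cdot> as i j)"
      using tys by (subst cmp_cmp[symmetric]) (simp_all add: col(4))
    also have "\<dots> = incl X (Y \<odot> Z) i (j + k) \<cdot> ((ta i \<cdot> \<iota> (D i) j) \<cdot> as i j)"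
      unfolding i3 using X tys tat by (simp add: cmp_cmp)
    also have "ta i \<cdot> \<iota> (D i) j = Idm C (ob X i) \<otimes>\<^sub>a incl Y Z j k"
      using ta(4)[of i j] i3(2) X by simp
    also have "incl X (Y \<odot> Z) i (j + k) \<cdot> ((Idm C (ob X i) \<otimes>\<^sub>a incl Y Z j k) \<cdot> as i j)
        = rincl X Y Z i j k \<cdot> as i j"
      using X n as[of i j] by (simp add: rincl_def cmp_cmp D_def)
    finally show ?thesis .
  qed
  have "comps (asc X Y Z) n \<cdot> lincl X Y Z i j k = collect \<cdot> (reassoc \<cdot> (regroup \<cdot> (expand \<cdot> (?i1 \<cdot> ?i2))))"
    unfolding comps lincl_def i1[symmetric] using tys by (simp add: cmp_cmp)
  also have "\<dots> = rincl X Y Z i j k \<cdot> as i j" unfolding e1 e2 e3 e4 ..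
  finally show "comps (asc X Y Z) n \<cdot> lincl X Y Z i j k = rincl X Y Z i j k \<cdot> assoc C (ob X i) (ob Y j) (ob Z k)"
    by (simp add: as_def k(2))
qed

section \<open>Naturality and coherence of the associator\<close>

text \<open>
  The axioms are proved degreewise on the components of chain maps, and separately from the
  compatibility with differentials.
\<close>

abbreviation ctensor_arr (infixl "\<odot>\<^sub>a" 75)
  where "f \<odot>\<^sub>a g \<equiv> complex_tensor_arr R C \<xi> S \<iota> f g"

abbreviation chain_id :: "('o, 'm) ncomplex \<Rightarrow> ('o, 'm) chain_map"
  where "chain_id X \<equiv> \<lparr>src = X, tgt = X, comps = (\<lambda>i. Idm C (ob X i))\<rparr>"

abbreviation chain_cmp :: "('o, 'm) chain_map \<Rightarrow> ('o, 'm) chain_map \<Rightarrow> ('o, 'm) chain_map"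
  where "chain_cmp g f \<equiv> \<lparr>src = src f, tgt = tgt g, comps = (\<lambda>i. comps g i \<cdot> comps f i)\<rparr>"

definition graded_map :: "('o, 'm) chain_map \<Rightarrow> bool"
  where "graded_map f \<longleftrightarrow> graded (src f) \<and> graded (tgt f) \<and>
    (\<forall>i. comps f i \<in> Hom C (ob (src f) i) (ob (tgt f) i))"

lemma graded_map_src [simp]: "graded_map f \<Longrightarrow> graded (src f)"
  and graded_map_tgt [simp]: "graded_map f \<Longrightarrow> graded (tgt f)"
  and comps_Arr [simp]: "graded_map f \<Longrightarrow> comps f i \<in> Arr C"
  and comps_Dom [simp]: "graded_map f \<Longrightarrow> Dom C (comps f i) = ob (src f) i"
  and comps_Cod [simp]: "graded_map f \<Longrightarrow> Cod C (comps f i) = ob (tgt f) i"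
  by (simp_all add: graded_map_def in_Hom)

lemma graded_map_chain_id: "graded X \<Longrightarrow> graded_map (chain_id X)"
  by (simp add: graded_map_def in_Hom)

lemma src_tensor [simp]: "src (f \<odot>\<^sub>a g) = src f \<odot> src g"
  and tgt_tensor [simp]: "tgt (f \<odot>\<^sub>a g) = tgt f \<odot> tgt g"
  by (simp_all add: complex_tensor_arr_def)

lemma src_asc [simp]: "src (asc X Y Z) = (X \<odot> Y) \<odot> Z"
  and tgt_asc [simp]: "tgt (asc X Y Z) = X \<odot> (Y \<odot> Z)"
  by (simp_all add: complex_assoc_def Let_def)

lemma tensor_comps_props:
  assumes f: "graded_map f" "graded_map g"
  shows "comps (f \<odot>\<^sub>a g) n \<in> Hom C (ob (src f \<odot> src g) n) (ob (tgt f \<odot> tgt g) n)"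
    and "n = i + j \<Longrightarrow> comps (f \<odot>\<^sub>a g) n \<cdot> incl (src f) (src g) i j
      = incl (tgt f) (tgt g) i j \<cdot> (comps f i \<otimes>\<^sub>a comps g j)"
proof -
  let ?t = "\<lambda>i. comps f i \<otimes>\<^sub>a comps g (n - i)"
  have c: "comps (f \<odot>\<^sub>a g) n
      = coprod_map C S \<iota> (summands C (src f) (src g) n) (summands C (tgt f) (tgt g) n) ?t"
    by (simp add: complex_tensor_arr_def)
  have "?t i \<in> Arr C" "Dom C (?t i) = summands C (src f) (src g) n i"
    "Cod C (?t i) = summands C (tgt f) (tgt g) n i" for i
    using f by (simp_all add: summands_apply)
  note p = coprod_map_props[of ?t, OF this, folded c]
  show "comps (f \<odot>\<^sub>a g) n \<in> Hom C (ob (src f \<odot> src g) n) (ob (tgt f \<odot> tgt g) n)"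
    using p(1-3) by (simp add: in_Hom ob_tensor)
  show "comps (f \<odot>\<^sub>a g) n \<cdot> incl (src f) (src g) i j
      = incl (tgt f) (tgt g) i j \<cdot> (comps f i \<otimes>\<^sub>a comps g j)" if "n = i + j"
    using p(4)[of i] that by (simp add: incl_eq)
qed

lemma graded_map_tensor [simp]: "\<lbrakk>graded_map f; graded_map g\<rbrakk> \<Longrightarrow> graded_map (f \<odot>\<^sub>a g)"
  by (simp add: graded_map_def[of "f \<odot>\<^sub>a g"] tensor_comps_props(1))

lemma graded_map_asc [simp]: "\<lbrakk>graded X; graded Y; graded Z\<rbrakk> \<Longrightarrow> graded_map (asc X Y Z)"
  by (simp add: graded_map_def assoc_comps_props(1))

text \<open>
  The equations \<open>src f = X\<close> are premises, so that the rule also applies by rewriting when \<open>f\<close> is a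
  structure arrow whose source is a compound term.
\<close>

lemma tensor_comps:
  "\<lbrakk>graded_map f; graded_map g; src f = X; src g = Y; n = i + j\<rbrakk>
    \<Longrightarrow> comps (f \<odot>\<^sub>a g) n \<cdot> incl X Y i j = incl (tgt f) (tgt g) i j \<cdot> (comps f i \<otimes>\<^sub>a comps g j)"
  using tensor_comps_props(2) by blast

lemma tensor_comps_cmp:
  assumes "graded_map f" "graded_map g" "src f = X" "src g = Y" "n = i + j"
    and "x \<in> Arr C" "Cod C x = ob X i \<otimes>\<^sub>o ob Y j"
  shows "comps (f \<odot>\<^sub>a g) n \<cdot> (incl X Y i j \<cdot> x)
    = incl (tgt f) (tgt g) i j \<cdot> ((comps f i \<otimes>\<^sub>a comps g j) \<cdot> x)"
proof -
  have "comps (f \<odot>\<^sub>a g) n \<cdot> (incl X Y i j \<cdot> x) = (comps (f \<odot>\<^sub>a g) n \<cdot> incl X Y i j) \<cdot> x"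
    using assms by (subst cmp_cmp) auto
  then show ?thesis using assms by (simp add: tensor_comps cmp_cmp)
qed

lemma tensor_comps_lincl:
  assumes "graded_map f" "graded_map g" "graded_map h" "src f = X" "src g = Y" "src h = Z" "n = i + j + k"
  shows "comps ((f \<odot>\<^sub>a g) \<odot>\<^sub>a h) n \<cdot> lincl X Y Z i j k
    = lincl (tgt f) (tgt g) (tgt h) i j k \<cdot> ((comps f i \<otimes>\<^sub>a comps g j) \<otimes>\<^sub>a comps h k)"
proof -
  have X: "graded X" "graded Y" "graded Z" using assms by auto
  show ?thesis
    using assms X unfolding lincl_def
    by (simp add: tensor_comps_cmp tensor_cmp_tensor tensor_comps cmp_cmp)
qed

lemma tensor_comps_rincl:
  assumes "graded_map f" "graded_map g" "graded_map h" "src f = X" "src g = Y" "src h = Z" "n = i + j + k"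
  shows "comps (f \<odot>\<^sub>a (g \<odot>\<^sub>a h)) n \<cdot> rincl X Y Z i j k
    = rincl (tgt f) (tgt g) (tgt h) i j k \<cdot> (comps f i \<otimes>\<^sub>a (comps g j \<otimes>\<^sub>a comps h k))"
proof -
  have X: "graded X" "graded Y" "graded Z" using assms by auto
  show ?thesis
    using assms X unfolding rincl_def
    by (simp add: tensor_comps_cmp tensor_cmp_tensor tensor_comps cmp_cmp)
qed

lemma asc_lincl:
  "\<lbrakk>graded X; graded Y; graded Z; n = i + j + k\<rbrakk> \<Longrightarrow> comps (asc X Y Z) n \<cdot> lincl X Y Z i j k
      = rincl X Y Z i j k \<cdot> assoc C (ob X i) (ob Y j) (ob Z k)"
  by (rule assoc_comps_props(2))

lemma asc_lincl_cmp:
  assumes "graded X" "graded Y" "graded Z" "n = i + j + k"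
    and "x \<in> Arr C" "Cod C x = (ob X i \<otimes>\<^sub>o ob Y j) \<otimes>\<^sub>o ob Z k"
  shows "comps (asc X Y Z) n \<cdot> (lincl X Y Z i j k \<cdot> x)
      = rincl X Y Z i j k \<cdot> (assoc C (ob X i) (ob Y j) (ob Z k) \<cdot> x)"
proof -
  have "comps (asc X Y Z) n \<cdot> (lincl X Y Z i j k \<cdot> x) = (comps (asc X Y Z) n \<cdot> lincl X Y Z i j k) \<cdot> x"
    using assms by (subst cmp_cmp) auto
  then show ?thesis using assms by (simp add: asc_lincl cmp_cmp)
qed

lemma tensor_chain_id: "\<lbrakk>graded X; graded Y\<rbrakk> \<Longrightarrow> comps (chain_id X \<odot>\<^sub>a chain_id Y) n = Idm C (ob (X \<odot> Y) n)"
  by (rule tensor_ext[of X Y _ _ n]) (simp_all add: graded_map_chain_id tensor_comps)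

lemma tensor_chain_cmp:
  assumes "graded_map f" "graded_map f'" "graded_map g" "graded_map g'"
    "src f' = tgt f" "src g' = tgt g"
  shows "comps (chain_cmp f' f \<odot>\<^sub>a chain_cmp g' g) n = comps (f' \<odot>\<^sub>a g') n \<cdot> comps (f \<odot>\<^sub>a g) n"
proof -
  have c: "graded_map (chain_cmp f' f)" "graded_map (chain_cmp g' g)"
    using assms by (simp_all add: graded_map_def[of "chain_cmp f' f"] graded_map_def[of "chain_cmp g' g"] in_Hom)
  note s1 = tensor_comps_props(1)[OF assms(1,3), of n]
    and s2 = tensor_comps_props(1)[OF assms(2,4), of n, unfolded assms(5,6)]
    and s3 = tensor_comps_props(1)[OF c, of n, simplified]
  show ?thesis
  proof (rule tensor_ext[of "src f" "src g" _ _ n])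
    fix i j assume n: "n = i + j"
    let ?l = "comps (f' \<odot>\<^sub>a g') n \<cdot> comps (f \<odot>\<^sub>a g) n \<cdot> incl (src f) (src g) i j"
      and ?r = "comps (chain_cmp f' f \<odot>\<^sub>a chain_cmp g' g) n \<cdot> incl (src f) (src g) i j"
    have "?l = comps (f' \<odot>\<^sub>a g') n \<cdot> (incl (tgt f) (tgt g) i j \<cdot> (comps f i \<otimes>\<^sub>a comps g j))"
      using s1 s2 n assms(1,3) tensor_comps_props(2)[OF assms(1,3) n] by (simp add: in_Hom cmp_cmp)
    also have "\<dots> = incl (tgt f') (tgt g') i j \<cdot> ((comps f' i \<otimes>\<^sub>a comps g' j) \<cdot> (comps f i \<otimes>\<^sub>a comps g j))"
      using assms by (intro tensor_comps_cmp n) simp_all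
    also have "\<dots> = incl (tgt f') (tgt g') i j \<cdot> ((comps f' i \<cdot> comps f i) \<otimes>\<^sub>a (comps g' j \<cdot> comps g j))"
      using assms by (simp add: tensor_cmp_tensor)
    also have "\<dots> = ?r"
      using tensor_comps_props(2)[OF c n] by simp
    finally show "?r = ?l" ..
  qed (use s1 s2 s3 assms(1,3) in \<open>simp_all add: in_Hom\<close>)
qed

lemma asc_natural:
  assumes "graded_map f" "graded_map g" "graded_map h"
  shows "comps (asc (tgt f) (tgt g) (tgt h)) n \<cdot> comps ((f \<odot>\<^sub>a g) \<odot>\<^sub>a h) n
    = comps (f \<odot>\<^sub>a (g \<odot>\<^sub>a h)) n \<cdot> comps (asc (src f) (src g) (src h)) n"
proof (rule lincl_ext[of "src f" "src g" "src h" _ _ n])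
  fix i j k assume n: "n = i + j + k"
  let ?f = "comps f i" and ?g = "comps g j" and ?h = "comps h k"
  let ?a = "assoc C (ob (src f) i) (ob (src g) j) (ob (src h) k)"
  let ?l = "comps (asc (tgt f) (tgt g) (tgt h)) n \<cdot> comps ((f \<odot>\<^sub>a g) \<odot>\<^sub>a h) n \<cdot> lincl (src f) (src g) (src h) i j k"
    and ?r = "comps (f \<odot>\<^sub>a (g \<odot>\<^sub>a h)) n \<cdot> comps (asc (src f) (src g) (src h)) n \<cdot> lincl (src f) (src g) (src h) i j k"
  have "?l = rincl (tgt f) (tgt g) (tgt h) i j k \<cdot> (assoc C (ob (tgt f) i) (ob (tgt g) j) (ob (tgt h) k) \<cdot> ((?f \<otimes>\<^sub>a ?g) \<otimes>\<^sub>a ?h))"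
    using assms n by (simp add: cmp_cmp tensor_comps_lincl asc_lincl_cmp)
  also have "\<dots> = (rincl (tgt f) (tgt g) (tgt h) i j k \<cdot> (?f \<otimes>\<^sub>a (?g \<otimes>\<^sub>a ?h))) \<cdot> ?a"
    using assms by (simp add: assoc_nat cmp_cmp)
  also have "\<dots> = comps (f \<odot>\<^sub>a (g \<odot>\<^sub>a h)) n \<cdot> (rincl (src f) (src g) (src h) i j k \<cdot> ?a)"
    using assms n by (simp add: tensor_comps_rincl flip: cmp_cmp)
  also have "\<dots> = ?r"
    using assms n by (simp add: cmp_cmp asc_lincl)
  finally show "?l = ?r" .
qed (use assms in simp_all)

text \<open>
  Both triple tensor products are coproducts over the same triples, of families that correspond
  under the associators of the base category.
\<close>

lemma asc_iso:
  assumes X: "graded X" "graded Y" "graded Z"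
  shows "is_iso C (comps (asc X Y Z) n)"
proof -
  let ?a = "\<lambda>(i, j, k). assoc C (ob X i) (ob Y j) (ob Z k)"
  let ?l = "\<lambda>(i, j, k). lincl X Y Z i j k" and ?r = "\<lambda>(i, j, k). rincl X Y Z i j k"
  note L = lincl_coproduct[OF X, of n] and R = rincl_coproduct[OF X, of n]
  have "is_coproduct C (triples n) (\<lambda>p. Dom C (?a p)) (ob (X \<odot> (Y \<odot> Z)) n) (\<lambda>p. ?r p \<cdot> ?a p)"
    by (rule coproduct_iso_summands[OF R]) (use X assoc_iso in auto)
  then have R': "is_coproduct C (triples n) (\<lambda>(i, j, k). (ob X i \<otimes>\<^sub>o ob Y j) \<otimes>\<^sub>o ob Z k)
      (ob (X \<odot> (Y \<odot> Z)) n) (\<lambda>p. ?r p \<cdot> ?a p)"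
    by (rule is_coproduct_cong) (use X in auto)
  let ?c = "copair C (triples n) (ob ((X \<odot> Y) \<odot> Z) n) ?l (ob (X \<odot> (Y \<odot> Z)) n) (\<lambda>p. ?r p \<cdot> ?a p)"
  note c = copair_props[OF L coproduct_Obj[OF R'] coproduct_incl[OF R']]
  have "?c = comps (asc X Y Z) n"
  proof (rule coproduct_ext[OF L c(1) assoc_comps_props(1)[OF X]])
    fix p assume p: "p \<in> triples n"
    then show "?c \<cdot> ?l p = comps (asc X Y Z) n \<cdot> ?l p"
      using c(2)[OF _ p] asc_lincl[OF X] by (auto simp: triples_def)
  qed
  then show ?thesis using copair_iso[OF L R'] by simp
qed

text \<open>
  On a summand \<open>((W\<^sup>i \<otimes> X\<^sup>j) \<otimes> Y\<^sup>k) \<otimes> Z\<^sup>l\<close> both sides are one and the same inclusion, composed with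
  the two sides of the pentagon in the base category.
\<close>

lemma asc_pentagon:
  assumes X: "graded W" "graded X" "graded Y" "graded Z"
  shows "comps (chain_id W \<odot>\<^sub>a asc X Y Z) n \<cdot> comps (asc W (X \<odot> Y) Z) n \<cdot> comps (asc W X Y \<odot>\<^sub>a chain_id Z) n
    = comps (asc W X (Y \<odot> Z)) n \<cdot> comps (asc (W \<odot> X) Y Z) n"
    (is "?p \<cdot> ?q \<cdot> ?r = ?s \<cdot> ?t")
proof (rule lincl_lincl_ext[OF X, of _ _ n])
  fix i j k l assume n: "n = i + j + k + l"
  let ?W = "ob W i" and ?X = "ob X j" and ?Y = "ob Y k" and ?Z = "ob Z l"
  let ?id = "Idm C"
  let ?e = "lincl (W \<odot> X) Y Z (i + j) k l \<cdot> ((incl W X i j \<otimes>\<^sub>a ?id ?Y) \<otimes>\<^sub>a ?id ?Z)"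
  let ?end = "incl W (X \<odot> (Y \<odot> Z)) i (j + k + l) \<cdot> (?id ?W \<otimes>\<^sub>a rincl X Y Z j k l)"
  note [simp] = graded_map_chain_id
  \<comment> \<open>the left-hand side is followed one associator at a time: first \<open>?r\<close>, then \<open>?q\<close>, then \<open>?p\<close>\<close>
  have r: "?r \<cdot> ?e = lincl W (X \<odot> Y) Z i (j + k) l \<cdot>
      (((?id ?W \<otimes>\<^sub>a incl X Y j k) \<otimes>\<^sub>a ?id ?Z) \<cdot> (assoc C ?W ?X ?Y \<otimes>\<^sub>a ?id ?Z))"
  proof -
    have "?e = incl ((W \<odot> X) \<odot> Y) Z (i + j + k) l \<cdot> (lincl W X Y i j k \<otimes>\<^sub>a ?id ?Z)"
      using X by (simp add: lincl_def cmp_cmp tensor_cmp_tensor)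
    then have "?r \<cdot> ?e = incl (W \<odot> (X \<odot> Y)) Z (i + j + k) l \<cdot> ((rincl W X Y i j k \<cdot> assoc C ?W ?X ?Y) \<otimes>\<^sub>a ?id ?Z)"
      using X n by (simp add: tensor_comps_cmp tensor_cmp_tensor asc_lincl)
    then show ?thesis
      using X by (simp add: rincl_def lincl_def cmp_cmp tensor_cmp_tensor add.assoc)
  qed
  have q: "?q \<cdot> (?r \<cdot> ?e) = rincl W (X \<odot> Y) Z i (j + k) l \<cdot>
      ((?id ?W \<otimes>\<^sub>a (incl X Y j k \<otimes>\<^sub>a ?id ?Z)) \<cdot> (assoc C ?W (?X \<otimes>\<^sub>o ?Y) ?Z \<cdot> (assoc C ?W ?X ?Y \<otimes>\<^sub>a ?id ?Z)))"
  proof -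
    have "?q \<cdot> (?r \<cdot> ?e) = rincl W (X \<odot> Y) Z i (j + k) l \<cdot> ((assoc C ?W (ob (X \<odot> Y) (j + k)) ?Z \<cdot>
        ((?id ?W \<otimes>\<^sub>a incl X Y j k) \<otimes>\<^sub>a ?id ?Z)) \<cdot> (assoc C ?W ?X ?Y \<otimes>\<^sub>a ?id ?Z))"
      unfolding r using X n by (simp add: asc_lincl_cmp cmp_cmp)
    then show ?thesis using X by (simp add: assoc_nat cmp_cmp)
  qed
  have p: "?p \<cdot> (?q \<cdot> (?r \<cdot> ?e)) = ?end \<cdot> ((?id ?W \<otimes>\<^sub>a assoc C ?X ?Y ?Z) \<cdot>
      (assoc C ?W (?X \<otimes>\<^sub>o ?Y) ?Z \<cdot> (assoc C ?W ?X ?Y \<otimes>\<^sub>a ?id ?Z)))"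
  proof -
    let ?y = "assoc C ?W (?X \<otimes>\<^sub>o ?Y) ?Z \<cdot> (assoc C ?W ?X ?Y \<otimes>\<^sub>a ?id ?Z)"
    have "?q \<cdot> (?r \<cdot> ?e) = incl W ((X \<odot> Y) \<odot> Z) i (j + k + l) \<cdot> ((?id ?W \<otimes>\<^sub>a lincl X Y Z j k l) \<cdot> ?y)"
      unfolding q using X by (simp add: rincl_def lincl_def cmp_cmp tensor_cmp_tensor_cmp)
    then have "?p \<cdot> (?q \<cdot> (?r \<cdot> ?e)) = incl W (X \<odot> (Y \<odot> Z)) i (j + k + l) \<cdot>
        ((?id ?W \<otimes>\<^sub>a (rincl X Y Z j k l \<cdot> assoc C ?X ?Y ?Z)) \<cdot> ?y)"
      using X n by (simp add: tensor_comps_cmp tensor_cmp_tensor_cmp asc_lincl add.assoc)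
    then show ?thesis using X by (simp add: cmp_cmp tensor_cmp_tensor_cmp add.assoc)
  qed
  \<comment> \<open>the right-hand side: first \<open>?t\<close>, then \<open>?s\<close>\<close>
  have t: "?t \<cdot> ?e = lincl W X (Y \<odot> Z) i j (k + l) \<cdot> ((?id (?W \<otimes>\<^sub>o ?X) \<otimes>\<^sub>a incl Y Z k l) \<cdot>
      assoc C (?W \<otimes>\<^sub>o ?X) ?Y ?Z)"
  proof -
    have "?t \<cdot> ?e = rincl (W \<odot> X) Y Z (i + j) k l \<cdot> ((incl W X i j \<otimes>\<^sub>a ?id (?Y \<otimes>\<^sub>o ?Z)) \<cdot> assoc C (?W \<otimes>\<^sub>o ?X) ?Y ?Z)"
      using X n by (simp add: asc_lincl_cmp assoc_nat)
    then show ?thesis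
      using X by (simp add: rincl_def lincl_def cmp_cmp tensor_cmp_tensor_cmp)
  qed
  have s: "?s \<cdot> (?t \<cdot> ?e) = ?end \<cdot> (assoc C ?W ?X (?Y \<otimes>\<^sub>o ?Z) \<cdot> assoc C (?W \<otimes>\<^sub>o ?X) ?Y ?Z)"
  proof -
    have "?s \<cdot> (?t \<cdot> ?e) = rincl W X (Y \<odot> Z) i j (k + l) \<cdot> ((assoc C ?W ?X (ob (Y \<odot> Z) (k + l)) \<cdot>
        ((?id ?W \<otimes>\<^sub>a ?id ?X) \<otimes>\<^sub>a incl Y Z k l)) \<cdot> assoc C (?W \<otimes>\<^sub>o ?X) ?Y ?Z)"
      unfolding t using X n by (simp add: asc_lincl_cmp cmp_cmp add.assoc)
    also have "\<dots> = rincl W X (Y \<odot> Z) i j (k + l) \<cdot> ((?id ?W \<otimes>\<^sub>a (?id ?X \<otimes>\<^sub>a incl Y Z k l)) \<cdot>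
        (assoc C ?W ?X (?Y \<otimes>\<^sub>o ?Z) \<cdot> assoc C (?W \<otimes>\<^sub>o ?X) ?Y ?Z))"
      using X by (subst assoc_nat) (simp_all add: cmp_cmp)
    also have "\<dots> = ?end \<cdot> (assoc C ?W ?X (?Y \<otimes>\<^sub>o ?Z) \<cdot> assoc C (?W \<otimes>\<^sub>o ?X) ?Y ?Z)"
      using X by (simp add: rincl_def cmp_cmp tensor_cmp_tensor_cmp add.assoc)
    finally show ?thesis .
  qed
  have "?p \<cdot> ?q \<cdot> ?r \<cdot> ?e = ?p \<cdot> (?q \<cdot> (?r \<cdot> ?e))" "?s \<cdot> ?t \<cdot> ?e = ?s \<cdot> (?t \<cdot> ?e)"
    using X n by (simp_all add: cmp_cmp)
  moreover have "(?id ?W \<otimes>\<^sub>a assoc C ?X ?Y ?Z) \<cdot> (assoc C ?W (?X \<otimes>\<^sub>o ?Y) ?Z \<cdot> (assoc C ?W ?X ?Y \<otimes>\<^sub>a ?id ?Z))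
      = assoc C ?W ?X (?Y \<otimes>\<^sub>o ?Z) \<cdot> assoc C (?W \<otimes>\<^sub>o ?X) ?Y ?Z"
    using pentagon[of ?W ?X ?Y ?Z] X by (simp add: cmp_cmp)
  ultimately show "?p \<cdot> ?q \<cdot> ?r \<cdot> ?e = ?s \<cdot> ?t \<cdot> ?e"
    unfolding p s by simp
qed (use X in \<open>simp_all add: graded_map_chain_id\<close>)

definition commutes_with_dif :: "('o, 'm) chain_map \<Rightarrow> bool"
  where "commutes_with_dif f \<longleftrightarrow> (\<forall>i. comps f (i + 1) \<cdot> dif (src f) i = dif (tgt f) i \<cdot> comps f i)"

text \<open>
  The exponent of \<open>\<xi>\<close> depends on the degree \<open>i\<close> only, and morphisms preserve degrees.
\<close>

lemma tensor_commutes_with_dif: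
  assumes f: "graded_map f" "graded_map g" "commutes_with_dif f" "commutes_with_dif g"
    and d: "differential (src f)" "differential (tgt f)" "differential (src g)" "differential (tgt g)"
  shows "commutes_with_dif (f \<odot>\<^sub>a g)"
  unfolding commutes_with_dif_def src_tensor tgt_tensor
proof (intro allI, rule tensor_ext[of "src f" "src g"])
  fix n i j :: int assume n: "n = i + j"
  have c: "dif (tgt f) i \<cdot> comps f i = comps f (i + 1) \<cdot> dif (src f) i"
    "dif (tgt g) j \<cdot> comps g j = comps g (j + 1) \<cdot> dif (src g) j"
    using f by (simp_all add: commutes_with_dif_def)
  let ?l = "comps (f \<odot>\<^sub>a g) (n + 1) \<cdot> dif (src f \<odot> src g) n \<cdot> incl (src f) (src g) i j"
    and ?r = "dif (tgt f \<odot> tgt g) n \<cdot> comps (f \<odot>\<^sub>a g) n \<cdot> incl (src f) (src g) i j"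
  have "?l = comps (f \<odot>\<^sub>a g) (n + 1) \<cdot> (dif (src f \<odot> src g) n \<cdot> incl (src f) (src g) i j)"
    using f d n by (simp add: cmp_cmp)
  also have "\<dots> = madd C (incl (tgt f) (tgt g) (i + 1) j \<cdot> ((comps f (i + 1) \<cdot> dif (src f) i) \<otimes>\<^sub>a comps g j))
      (scale C (\<xi> [^]\<^bsub>R\<^esub> i) (incl (tgt f) (tgt g) i (j + 1) \<cdot> (comps f i \<otimes>\<^sub>a (comps g (j + 1) \<cdot> dif (src g) j))))"
    using f d n
    by (simp add: tensor_dif cmp_madd cmp_scale tensor_comps_cmp tensor_cmp_tensor algebra_simps)
  also have "\<dots> = madd C (incl (tgt f) (tgt g) (i + 1) j \<cdot> ((dif (tgt f) i \<cdot> comps f i) \<otimes>\<^sub>a comps g j))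
      (scale C (\<xi> [^]\<^bsub>R\<^esub> i) (incl (tgt f) (tgt g) i (j + 1) \<cdot> (comps f i \<otimes>\<^sub>a (dif (tgt g) j \<cdot> comps g j))))"
    unfolding c ..
  also have "\<dots> = (dif (tgt f \<odot> tgt g) n \<cdot> incl (tgt f) (tgt g) i j) \<cdot> (comps f i \<otimes>\<^sub>a comps g j)"
    using f d n
    by (simp add: tensor_dif madd_cmp scale_cmp cmp_cmp tensor_cmp_tensor algebra_simps)
  also have "\<dots> = ?r"
    using f d n by (simp add: cmp_cmp tensor_comps)
  finally show "?l = ?r" .
qed (use f d in simp_all)

lemma tensor_dif_cmp:
  assumes X: "differential X" "differential Y" "n = i + j"
    and x: "x \<in> Arr C" "Cod C x = ob X i \<otimes>\<^sub>o ob Y j"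
  shows "dif (X \<odot> Y) n \<cdot> (incl X Y i j \<cdot> x) =
      madd C (incl X Y (i + 1) j \<cdot> ((dif X i \<otimes>\<^sub>a Idm C (ob Y j)) \<cdot> x))
        (scale C (\<xi> [^]\<^bsub>R\<^esub> i) (incl X Y i (j + 1) \<cdot> ((Idm C (ob X i) \<otimes>\<^sub>a dif Y j) \<cdot> x)))"
proof -
  have "dif (X \<odot> Y) n \<cdot> (incl X Y i j \<cdot> x) = (dif (X \<odot> Y) n \<cdot> incl X Y i j) \<cdot> x"
    using assms by (subst cmp_cmp) auto
  then show ?thesis
    using assms by (simp add: tensor_dif madd_cmp scale_cmp cmp_cmp algebra_simps)
qed

text \<open>
  The differentials of the two triple tensor products have the same three terms. The last one has the
  power \<open>\<xi> ^ (i + j)\<close>, which arises directly on the left and as \<open>\<xi> ^ i \<xi> ^ j\<close> on the right.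
\<close>

lemma lincl_dif:
  assumes X: "differential X" "differential Y" "differential Z" and n: "n = i + j + k"
  shows "dif ((X \<odot> Y) \<odot> Z) n \<cdot> lincl X Y Z i j k =
    madd C (lincl X Y Z (i + 1) j k \<cdot> ((dif X i \<otimes>\<^sub>a Idm C (ob Y j)) \<otimes>\<^sub>a Idm C (ob Z k)))
      (madd C (scale C (\<xi> [^]\<^bsub>R\<^esub> i) (lincl X Y Z i (j + 1) k \<cdot> ((Idm C (ob X i) \<otimes>\<^sub>a dif Y j) \<otimes>\<^sub>a Idm C (ob Z k))))
        (scale C (\<xi> [^]\<^bsub>R\<^esub> (i + j)) (lincl X Y Z i j (k + 1) \<cdot> ((Idm C (ob X i) \<otimes>\<^sub>a Idm C (ob Y j)) \<otimes>\<^sub>a dif Z k))))"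
  using X n unfolding lincl_def
  by (simp add: tensor_dif_cmp tensor_cmp_tensor tensor_dif madd_tensor scale_tensor cmp_madd cmp_scale
      cmp_cmp madd_assoc algebra_simps)

lemma rincl_dif:
  assumes X: "differential X" "differential Y" "differential Z" and n: "n = i + j + k"
  shows "dif (X \<odot> (Y \<odot> Z)) n \<cdot> rincl X Y Z i j k =
    madd C (rincl X Y Z (i + 1) j k \<cdot> (dif X i \<otimes>\<^sub>a (Idm C (ob Y j) \<otimes>\<^sub>a Idm C (ob Z k))))
      (madd C (scale C (\<xi> [^]\<^bsub>R\<^esub> i) (rincl X Y Z i (j + 1) k \<cdot> (Idm C (ob X i) \<otimes>\<^sub>a (dif Y j \<otimes>\<^sub>a Idm C (ob Z k)))))
        (scale C (\<xi> [^]\<^bsub>R\<^esub> (i + j)) (rincl X Y Z i j (k + 1) \<cdot> (Idm C (ob X i) \<otimes>\<^sub>a (Idm C (ob Y j) \<otimes>\<^sub>a dif Z k)))))"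
  using X n unfolding rincl_def
  by (simp add: tensor_dif_cmp tensor_cmp_tensor tensor_dif tensor_madd tensor_scale cmp_madd cmp_scale
      cmp_cmp scale_madd scale_scale xi_pow_add algebra_simps)

lemma asc_commutes_with_dif:
  assumes X: "differential X" "differential Y" "differential Z"
  shows "commutes_with_dif (asc X Y Z)"
  unfolding commutes_with_dif_def src_asc tgt_asc
proof (intro allI, rule lincl_ext[of X Y Z])
  fix n i j k :: int assume n: "n = i + j + k"
  let ?a = "assoc C (ob X i) (ob Y j) (ob Z k)"
  let ?F = "dif X i \<otimes>\<^sub>a (Idm C (ob Y j) \<otimes>\<^sub>a Idm C (ob Z k))"
    and ?G = "Idm C (ob X i) \<otimes>\<^sub>a (dif Y j \<otimes>\<^sub>a Idm C (ob Z k))"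
    and ?H = "Idm C (ob X i) \<otimes>\<^sub>a (Idm C (ob Y j) \<otimes>\<^sub>a dif Z k)"
  have nat: "assoc C (ob X (i + 1)) (ob Y j) (ob Z k) \<cdot> ((dif X i \<otimes>\<^sub>a Idm C (ob Y j)) \<otimes>\<^sub>a Idm C (ob Z k)) = ?F \<cdot> ?a"
    "assoc C (ob X i) (ob Y (j + 1)) (ob Z k) \<cdot> ((Idm C (ob X i) \<otimes>\<^sub>a dif Y j) \<otimes>\<^sub>a Idm C (ob Z k)) = ?G \<cdot> ?a"
    "assoc C (ob X i) (ob Y j) (ob Z (k + 1)) \<cdot> ((Idm C (ob X i) \<otimes>\<^sub>a Idm C (ob Y j)) \<otimes>\<^sub>a dif Z k) = ?H \<cdot> ?a"
    using X by (subst assoc_nat, simp_all del: tensor_Idm)+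
  let ?l = "comps (asc X Y Z) (n + 1) \<cdot> dif ((X \<odot> Y) \<odot> Z) n \<cdot> lincl X Y Z i j k"
    and ?r = "dif (X \<odot> (Y \<odot> Z)) n \<cdot> comps (asc X Y Z) n \<cdot> lincl X Y Z i j k"
  have "?l = comps (asc X Y Z) (n + 1) \<cdot> (dif ((X \<odot> Y) \<odot> Z) n \<cdot> lincl X Y Z i j k)"
    using X n by (simp add: cmp_cmp)
  also have "\<dots> = madd C (rincl X Y Z (i + 1) j k \<cdot> (?F \<cdot> ?a))
      (madd C (scale C (\<xi> [^]\<^bsub>R\<^esub> i) (rincl X Y Z i (j + 1) k \<cdot> (?G \<cdot> ?a)))
        (scale C (\<xi> [^]\<^bsub>R\<^esub> (i + j)) (rincl X Y Z i j (k + 1) \<cdot> (?H \<cdot> ?a))))"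
    unfolding lincl_dif[OF X n] nat[symmetric] using X n
    by (simp add: cmp_madd cmp_scale asc_lincl_cmp algebra_simps)
  also have "\<dots> = dif (X \<odot> (Y \<odot> Z)) n \<cdot> rincl X Y Z i j k \<cdot> ?a"
    unfolding rincl_dif[OF X n] using X n
    by (simp add: madd_cmp scale_cmp cmp_cmp algebra_simps)
  also have "\<dots> = ?r"
    using X n by (simp add: cmp_cmp asc_lincl)
  finally show "?l = ?r" .
qed (use X in simp_all)

section \<open>The unit\<close>

context
  fixes Z0 :: 'o
  assumes Z0: "zero_object C Z0"
begin

text \<open>
  Every arrow out of a summand that involves a nonzero degree of the unit complex is determined,
  because the summand is a zero object. So arrows out of a tensor product with the unit are
  compared on a single summand in each degree.
\<close>

abbreviation (input) U where "U \<equiv> complex_unit C Z0"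

abbreviation lun where "lun X \<equiv> complex_lunit R C \<xi> S \<iota> Z0 X"

abbreviation run where "run X \<equiv> complex_runit R C \<xi> S \<iota> Z0 X"

lemma unit_ob_0 [simp]: "ob U 0 = unit_obj C"
  by (simp add: complex_unit_def Let_def)

lemma unit_ob_zero: "i \<noteq> 0 \<Longrightarrow> zero_object C (ob U i)"
  using Z0 by (simp add: complex_unit_def Let_def)

lemma unit_graded [simp]: "graded U"
  using Z0 by (simp add: graded_def complex_unit_def Let_def zero_object_def)

lemma unit_dif: "dif U i = mzero C (ob U i) (ob U (i + 1))"
  by (simp add: complex_unit_def Let_def)

lemma unit_differential [simp]: "differential U"
  by (simp add: differential_def[of U] unit_dif in_Hom)

lemma is_ncomplex_unit: "0 < N \<Longrightarrow> is_ncomplex C N U"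
  by (cases N) (simp_all add: is_ncomplex_iff unit_dif add.assoc del: of_nat_Suc, simp add: algebra_simps)

lemma arrows_from_zero_object:
  "\<lbrakk>zero_object C (Dom C h); h \<in> Arr C; h' \<in> Arr C; Dom C h' = Dom C h; Cod C h' = Cod C h\<rbrakk> \<Longrightarrow> h = h'"
  using from_zero_object[of h] from_zero_object[of h'] by simp

lemma unit_left_ext:
  assumes X: "graded X"
    and h: "h \<in> Arr C" "h' \<in> Arr C" "Dom C h = ob (U \<odot> X) n" "Dom C h' = ob (U \<odot> X) n" "Cod C h' = Cod C h"
    and eq: "h \<cdot> incl U X 0 n = h' \<cdot> incl U X 0 n"
  shows "h = h'"
proof (rule tensor_ext[of U X _ _ n])
  fix i j :: int assume n: "n = i + j"
  show "h \<cdot> incl U X i j = h' \<cdot> incl U X i j"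
  proof (cases "i = 0")
    case True
    then show ?thesis using eq n by simp
  next
    case False
    then have "zero_object C (ob U i \<otimes>\<^sub>o ob X j)"
      using X by (simp add: zero_object_tensor(2) unit_ob_zero)
    then show ?thesis using X h n by (intro arrows_from_zero_object) simp_all
  qed
qed (use X h in simp_all)

lemma unit_right_ext:
  assumes X: "graded X"
    and h: "h \<in> Arr C" "h' \<in> Arr C" "Dom C h = ob (X \<odot> U) n" "Dom C h' = ob (X \<odot> U) n" "Cod C h' = Cod C h"
    and eq: "h \<cdot> incl X U n 0 = h' \<cdot> incl X U n 0"
  shows "h = h'"
proof (rule tensor_ext[of X U _ _ n])
  fix i j :: int assume n: "n = i + j"
  show "h \<cdot> incl X U i j = h' \<cdot> incl X U i j"
  proof (cases "j = 0")
    case True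
    then show ?thesis using eq n by simp
  next
    case False
    then have "zero_object C (ob X i \<otimes>\<^sub>o ob U j)"
      using X by (simp add: zero_object_tensor(1) unit_ob_zero)
    then show ?thesis using X h n by (intro arrows_from_zero_object) simp_all
  qed
qed (use X h in simp_all)

lemma unit_middle_ext:
  assumes X: "graded X" "graded Y"
    and h: "h \<in> Arr C" "h' \<in> Arr C" "Dom C h = ob ((X \<odot> U) \<odot> Y) n"
      "Dom C h' = ob ((X \<odot> U) \<odot> Y) n" "Cod C h' = Cod C h"
    and eq: "\<And>i k. n = i + k \<Longrightarrow> h \<cdot> lincl X U Y i 0 k = h' \<cdot> lincl X U Y i 0 k"
  shows "h = h'"
proof (rule lincl_ext[of X U Y _ _ n])
  fix i j k :: int assume n: "n = i + j + k"
  show "h \<cdot> lincl X U Y i j k = h' \<cdot> lincl X U Y i j k"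
  proof (cases "j = 0")
    case True
    then show ?thesis using eq n by simp
  next
    case False
    then have "zero_object C ((ob X i \<otimes>\<^sub>o ob U j) \<otimes>\<^sub>o ob Y k)"
      using X by (simp add: zero_object_tensor unit_ob_zero)
    then show ?thesis using X h n by (intro arrows_from_zero_object) simp_all
  qed
qed (use X h in simp_all)

lemma src_lun [simp]: "src (lun X) = U \<odot> X" and tgt_lun [simp]: "tgt (lun X) = X"
  and src_run [simp]: "src (run X) = X \<odot> U" and tgt_run [simp]: "tgt (run X) = X"
  by (simp_all add: complex_lunit_def complex_runit_def)

lemma lun_props:
  assumes X: "graded X"
  shows "comps (lun X) n \<in> Hom C (ob (U \<odot> X) n) (ob X n)"
    and "comps (lun X) n \<cdot> incl U X 0 n = lunit C (ob X n)"
proof -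
  let ?W = "summands C U X n"
  let ?f = "\<lambda>i. if i = 0 then lunit C (ob X n) else mzero C (?W i) (ob X n)"
  have c: "comps (lun X) n = coprod_copair C S \<iota> ?W (ob X n) ?f"
    by (simp add: complex_lunit_def Let_def)
  have W: "?W i \<in> Obj C" "ob X n \<in> Obj C" for i using X by simp_all
  have W0: "?W 0 = unit_obj C \<otimes>\<^sub>o ob X n" by (simp add: summands_apply)
  have f: "?f i \<in> Arr C" "Dom C (?f i) = ?W i" "Cod C (?f i) = ob X n" for i
    using W by (auto simp: W0)
  note p = coprod_copair_props[of ?W "ob X n" ?f, OF W f, folded c]
  show "comps (lun X) n \<in> Hom C (ob (U \<odot> X) n) (ob X n)"
    using p by (simp add: in_Hom ob_tensor)
  show "comps (lun X) n \<cdot> incl U X 0 n = lunit C (ob X n)"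
    using p(4)[of 0] by (simp add: incl_def)
qed

lemma run_props:
  assumes X: "graded X"
  shows "comps (run X) n \<in> Hom C (ob (X \<odot> U) n) (ob X n)"
    and "comps (run X) n \<cdot> incl X U n 0 = runit C (ob X n)"
proof -
  let ?W = "summands C X U n"
  let ?f = "\<lambda>i. if i = n then runit C (ob X n) else mzero C (?W i) (ob X n)"
  have c: "comps (run X) n = coprod_copair C S \<iota> ?W (ob X n) ?f"
    by (simp add: complex_runit_def Let_def)
  have W: "?W i \<in> Obj C" "ob X n \<in> Obj C" for i using X by simp_all
  have W0: "?W n = ob X n \<otimes>\<^sub>o unit_obj C" by (simp add: summands_apply)
  have f: "?f i \<in> Arr C" "Dom C (?f i) = ?W i" "Cod C (?f i) = ob X n" for i
    using W by (auto simp: W0)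
  note p = coprod_copair_props[of ?W "ob X n" ?f, OF W f, folded c]
  show "comps (run X) n \<in> Hom C (ob (X \<odot> U) n) (ob X n)"
    using p by (simp add: in_Hom ob_tensor)
  show "comps (run X) n \<cdot> incl X U n 0 = runit C (ob X n)"
    using p(4)[of n] by (simp add: incl_def)
qed

lemma graded_map_lun [simp]: "graded X \<Longrightarrow> graded_map (lun X)"
  and graded_map_run [simp]: "graded X \<Longrightarrow> graded_map (run X)"
  by (simp_all add: graded_map_def[of "lun X"] graded_map_def[of "run X"] lun_props run_props)

lemma lun_incl_cmp:
  assumes X: "graded X" and x: "x \<in> Arr C" "Cod C x = unit_obj C \<otimes>\<^sub>o ob X n"
  shows "comps (lun X) n \<cdot> (incl U X 0 n \<cdot> x) = lunit C (ob X n) \<cdot> x"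
proof -
  have "comps (lun X) n \<cdot> (incl U X 0 n \<cdot> x) = (comps (lun X) n \<cdot> incl U X 0 n) \<cdot> x"
    using assms by (subst cmp_cmp) simp_all
  then show ?thesis using X by (simp add: lun_props)
qed

lemma run_incl_cmp:
  assumes X: "graded X" and x: "x \<in> Arr C" "Cod C x = ob X n \<otimes>\<^sub>o unit_obj C"
  shows "comps (run X) n \<cdot> (incl X U n 0 \<cdot> x) = runit C (ob X n) \<cdot> x"
proof -
  have "comps (run X) n \<cdot> (incl X U n 0 \<cdot> x) = (comps (run X) n \<cdot> incl X U n 0) \<cdot> x"
    using assms by (subst cmp_cmp) simp_all
  then show ?thesis using X by (simp add: run_props)
qed

lemma lun_iso:
  assumes X: "graded X"
  shows "is_iso C (comps (lun X) n)"
proof (rule is_isoI)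
  let ?l = "lunit C (ob X n)"
  have iso: "is_iso C ?l" using X by (intro lunit_iso) simp
  show "comps (lun X) n \<in> Hom C (ob (U \<odot> X) n) (ob X n)" by (rule lun_props[OF X])
  show "incl U X 0 n \<cdot> inv_arrow C ?l \<in> Hom C (ob X n) (ob (U \<odot> X) n)"
    using X iso by (simp add: in_Hom)
  show "comps (lun X) n \<cdot> (incl U X 0 n \<cdot> inv_arrow C ?l) = Idm C (ob X n)"
    using X iso by (simp add: lun_incl_cmp)
  show "incl U X 0 n \<cdot> inv_arrow C ?l \<cdot> comps (lun X) n = Idm C (ob (U \<odot> X) n)"
    by (rule unit_left_ext[OF X, where n = n]) (use X iso in \<open>simp_all add: cmp_cmp lun_props\<close>)
qed

lemma run_iso:
  assumes X: "graded X"
  shows "is_iso C (comps (run X) n)"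
proof (rule is_isoI)
  let ?l = "runit C (ob X n)"
  have iso: "is_iso C ?l" using X by (intro runit_iso) simp
  show "comps (run X) n \<in> Hom C (ob (X \<odot> U) n) (ob X n)" by (rule run_props[OF X])
  show "incl X U n 0 \<cdot> inv_arrow C ?l \<in> Hom C (ob X n) (ob (X \<odot> U) n)"
    using X iso by (simp add: in_Hom)
  show "comps (run X) n \<cdot> (incl X U n 0 \<cdot> inv_arrow C ?l) = Idm C (ob X n)"
    using X iso by (simp add: run_incl_cmp)
  show "incl X U n 0 \<cdot> inv_arrow C ?l \<cdot> comps (run X) n = Idm C (ob (X \<odot> U) n)"
    by (rule unit_right_ext[OF X, where n = n]) (use X iso in \<open>simp_all add: cmp_cmp run_props\<close>)
qed

lemma lunit_nat: "f \<in> Arr C \<Longrightarrow> lunit C (Cod C f) \<cdot> (Idm C (unit_obj C) \<otimes>\<^sub>a f) = f \<cdot> lunit C (Dom C f)"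
  and runit_nat: "f \<in> Arr C \<Longrightarrow> runit C (Cod C f) \<cdot> (f \<otimes>\<^sub>a Idm C (unit_obj C)) = f \<cdot> runit C (Dom C f)"
  using lunit_natural[of f "Dom C f" "Cod C f"] runit_natural[of f "Dom C f" "Cod C f"]
  by (simp_all add: in_Hom)

lemma lun_natural:
  assumes f: "graded_map f"
  shows "comps (lun (tgt f)) n \<cdot> comps (chain_id U \<odot>\<^sub>a f) n = comps f n \<cdot> comps (lun (src f)) n"
proof (rule unit_left_ext[of "src f" _ _ n])
  let ?l = "comps (lun (tgt f)) n \<cdot> comps (chain_id U \<odot>\<^sub>a f) n \<cdot> incl U (src f) 0 n"
    and ?r = "comps f n \<cdot> comps (lun (src f)) n \<cdot> incl U (src f) 0 n"
  have "?l = lunit C (ob (tgt f) n) \<cdot> (Idm C (unit_obj C) \<otimes>\<^sub>a comps f n)"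
    using f by (simp add: cmp_cmp tensor_comps graded_map_chain_id lun_incl_cmp)
  also have "\<dots> = comps f n \<cdot> lunit C (ob (src f) n)"
    using lunit_nat[of "comps f n"] f by simp
  also have "\<dots> = ?r"
    using f by (simp add: cmp_cmp lun_props)
  finally show "?l = ?r" .
qed (use f in \<open>simp_all add: graded_map_chain_id\<close>)

lemma run_natural:
  assumes f: "graded_map f"
  shows "comps (run (tgt f)) n \<cdot> comps (f \<odot>\<^sub>a chain_id U) n = comps f n \<cdot> comps (run (src f)) n"
proof (rule unit_right_ext[of "src f" _ _ n])
  let ?l = "comps (run (tgt f)) n \<cdot> comps (f \<odot>\<^sub>a chain_id U) n \<cdot> incl (src f) U n 0"
    and ?r = "comps f n \<cdot> comps (run (src f)) n \<cdot> incl (src f) U n 0"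
  have "?l = runit C (ob (tgt f) n) \<cdot> (comps f n \<otimes>\<^sub>a Idm C (unit_obj C))"
    using f by (simp add: cmp_cmp tensor_comps graded_map_chain_id run_incl_cmp)
  also have "\<dots> = comps f n \<cdot> runit C (ob (src f) n)"
    using runit_nat[of "comps f n"] f by simp
  also have "\<dots> = ?r"
    using f by (simp add: cmp_cmp run_props)
  finally show "?l = ?r" .
qed (use f in \<open>simp_all add: graded_map_chain_id\<close>)

lemma lun_commutes_with_dif:
  assumes X: "differential X"
  shows "commutes_with_dif (lun X)"
  unfolding commutes_with_dif_def src_lun tgt_lun
proof (intro allI, rule unit_left_ext[of X])
  fix n :: int
  let ?l = "comps (lun X) (n + 1) \<cdot> dif (U \<odot> X) n \<cdot> incl U X 0 n"
    and ?r = "dif X n \<cdot> comps (lun X) n \<cdot> incl U X 0 n"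
  have "?l = lunit C (ob X (n + 1)) \<cdot> (Idm C (unit_obj C) \<otimes>\<^sub>a dif X n)"
    using X tensor_dif[OF unit_differential X, of n 0 n]
    by (simp add: cmp_cmp unit_dif lun_incl_cmp add.commute[of 1 n])
  also have "\<dots> = dif X n \<cdot> lunit C (ob X n)"
    using lunit_nat[of "dif X n"] X by simp
  also have "\<dots> = ?r"
    using X by (simp add: cmp_cmp lun_props)
  finally show "?l = ?r" .
qed (use X in simp_all)

lemma run_commutes_with_dif:
  assumes X: "differential X"
  shows "commutes_with_dif (run X)"
  unfolding commutes_with_dif_def src_run tgt_run
proof (intro allI, rule unit_right_ext[of X])
  fix n :: int
  let ?l = "comps (run X) (n + 1) \<cdot> dif (X \<odot> U) n \<cdot> incl X U n 0"
    and ?r = "dif X n \<cdot> comps (run X) n \<cdot> incl X U n 0"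
  have "?l = runit C (ob X (n + 1)) \<cdot> (dif X n \<otimes>\<^sub>a Idm C (unit_obj C))"
    using X tensor_dif[OF X unit_differential, of n n 0]
    by (simp add: cmp_cmp unit_dif run_incl_cmp)
  also have "\<dots> = dif X n \<cdot> runit C (ob X n)"
    using runit_nat[of "dif X n"] X by simp
  also have "\<dots> = ?r"
    using X by (simp add: cmp_cmp run_props)
  finally show "?l = ?r" .
qed (use X in simp_all)

lemma unit_triangle:
  assumes X: "graded X" "graded Y"
  shows "comps (chain_id X \<odot>\<^sub>a lun Y) n \<cdot> comps (asc X U Y) n = comps (run X \<odot>\<^sub>a chain_id Y) n"
proof (rule unit_middle_ext[OF X, of _ _ n])
  fix i k :: int assume n: "n = i + k"
  note [simp] = graded_map_chain_id
  let ?l = "comps (chain_id X \<odot>\<^sub>a lun Y) n \<cdot> comps (asc X U Y) n \<cdot> lincl X U Y i 0 k"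
    and ?r = "comps (run X \<odot>\<^sub>a chain_id Y) n \<cdot> lincl X U Y i 0 k"
  have "?l = comps (chain_id X \<odot>\<^sub>a lun Y) n \<cdot> (rincl X U Y i 0 k \<cdot> assoc C (ob X i) (unit_obj C) (ob Y k))"
    using X n by (simp add: cmp_cmp asc_lincl)
  also have "\<dots> = incl X Y i k \<cdot> ((Idm C (ob X i) \<otimes>\<^sub>a lunit C (ob Y k)) \<cdot> assoc C (ob X i) (unit_obj C) (ob Y k))"
    using X n by (simp add: rincl_def cmp_cmp tensor_comps_cmp tensor_cmp_tensor_cmp lun_props)
  also have "\<dots> = incl X Y i k \<cdot> (runit C (ob X i) \<otimes>\<^sub>a Idm C (ob Y k))"
    using X by (simp add: triangle)
  also have "\<dots> = ?r"
    using X n by (simp add: lincl_def tensor_comps_cmp tensor_cmp_tensor run_props)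
  finally show "?l = ?r" .
qed (use X in \<open>simp_all add: graded_map_chain_id\<close>)

end

end

section \<open>The monoidal category of \<open>N\<close>-complexes\<close>

text \<open>
  Apart from making \<open>\<xi>\<close> invertible, the twisted Leibniz rule enters only through the vanishing of the inner Gaussian binomial
  coefficients on arrows.
\<close>

locale ncomplex_tensor = graded_tensor R C \<xi> S \<iota>
  for R :: "('r, 'y) ring_scheme"
    and C :: "('o, 'm, 'r, 'x) linear_monoidal_category_scheme" (structure)
    and \<xi> :: 'r and S :: "(int \<Rightarrow> 'o) \<Rightarrow> 'o" and \<iota> :: "(int \<Rightarrow> 'o) \<Rightarrow> int \<Rightarrow> 'm" +
  fixes N :: nat and Z0 :: 'o
  assumes Z0: "zero_object C Z0" and N: "0 < N"
    and qbinomial_vanishes: "\<And>a f. \<lbrakk>0 < a; a < N; f \<in> Arr C\<rbrakk>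
      \<Longrightarrow> scale C (qbinomial R \<xi> N a) f = mzero C (Dom C f) (Cod C f)"
begin

abbreviation M where "M \<equiv> ncomplexes_monoidal R C N \<xi> S \<iota> Z0"

lemmas M_defs = ncomplexes_monoidal_def ncomplexes_def preadditive_category.defs monoidal_category.defs

lemma M_sel [simp]:
  "Obj M = {X. is_ncomplex C N X}" "Arr M = {f. is_chain_map C N f}" "Dom M = src" "Cod M = tgt"
  "Idm M = chain_id" "cmp M g f = chain_cmp g f"
  "madd M f g = \<lparr>src = src f, tgt = tgt f, comps = (\<lambda>i. madd C (comps f i) (comps g i))\<rparr>"
  "mzero M X Y = \<lparr>src = X, tgt = Y, comps = (\<lambda>i. mzero C (ob X i) (ob Y i))\<rparr>"
  "tensor_obj M X Y = X \<odot> Y" "tensor_arr M f g = f \<odot>\<^sub>a g" "unit_obj M = complex_unit C Z0"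
  "assoc M X Y Z = asc X Y Z" "lunit M X = complex_lunit R C \<xi> S \<iota> Z0 X"
  "runit M X = complex_runit R C \<xi> S \<iota> Z0 X"
  by (simp_all add: M_defs)

lemma ncomplex_differential [simp]: "is_ncomplex C N X \<Longrightarrow> differential X"
  by (simp add: is_ncomplex_iff)

lemma is_chain_map_iff: "is_chain_map C N f \<longleftrightarrow> graded_map f \<and> commutes_with_dif f \<and>
    is_ncomplex C N (src f) \<and> is_ncomplex C N (tgt f)"
  unfolding is_chain_map_def graded_map_def commutes_with_dif_def
  by (auto simp: is_ncomplex_iff)

lemma Hom_M: "f \<in> Hom M X Y \<longleftrightarrow> graded_map f \<and> commutes_with_dif f \<and>
    is_ncomplex C N X \<and> is_ncomplex C N Y \<and> src f = X \<and> tgt f = Y"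
  by (auto simp: in_Hom is_chain_map_iff)

lemma graded_mapI:
  "\<lbrakk>graded (src f); graded (tgt f); \<And>i. comps f i \<in> Hom C (ob (src f) i) (ob (tgt f) i)\<rbrakk> \<Longrightarrow> graded_map f"
  unfolding graded_map_def by blast

lemma chain_map_eqI:
  assumes "src f = src g" "tgt f = tgt g" "\<And>n. comps f n = comps g n"
  shows "(f :: ('o, 'm) chain_map) = g"
  using assms by (intro chain_map.equality ext) simp_all

lemma commutes_with_difD: "commutes_with_dif f \<Longrightarrow> comps f (i + 1) \<cdot> dif (src f) i = dif (tgt f) i \<cdot> comps f i"
  by (simp add: commutes_with_dif_def)

lemma chain_id_commutes: "differential X \<Longrightarrow> commutes_with_dif (chain_id X)"
  by (simp add: commutes_with_dif_def)

lemma graded_map_chain_cmp: "\<lbrakk>graded_map f; graded_map g; src g = tgt f\<rbrakk> \<Longrightarrow> graded_map (chain_cmp g f)"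
  by (rule graded_mapI) (simp_all add: in_Hom)

lemma chain_cmp_commutes:
  assumes "graded_map f" "graded_map g" "src g = tgt f" "commutes_with_dif f" "commutes_with_dif g"
    and "differential (src f)" "differential (tgt f)" "differential (tgt g)"
  shows "commutes_with_dif (chain_cmp g f)"
  unfolding commutes_with_dif_def
proof
  fix i
  note cf = commutes_with_difD[OF assms(4), of i] and cg = commutes_with_difD[OF assms(5), of i]
  have "comps g (i + 1) \<cdot> comps f (i + 1) \<cdot> dif (src f) i = comps g (i + 1) \<cdot> (dif (tgt f) i \<cdot> comps f i)"
    using assms by (simp add: cmp_cmp cf)
  also have "\<dots> = (comps g (i + 1) \<cdot> dif (src g) i) \<cdot> comps f i"
    using assms by (simp add: cmp_cmp)
  also have "\<dots> = dif (tgt g) i \<cdot> (comps g i \<cdot> comps f i)"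
    unfolding cg using assms by (subst cmp_cmp) simp_all
  finally show "comps (chain_cmp g f) (i + 1) \<cdot> dif (src (chain_cmp g f)) i = dif (tgt (chain_cmp g f)) i \<cdot> comps (chain_cmp g f) i"
    by simp
qed

lemma category_M: "category M"
proof
  show "Dom M f \<in> Obj M" "Cod M f \<in> Obj M" if "f \<in> Arr M" for f
    using that by (simp_all add: is_chain_map_iff)
  show "Idm M A \<in> Hom M A A" if "A \<in> Obj M" for A
    using that by (simp add: Hom_M graded_map_chain_id chain_id_commutes)
  show "cmp M g f \<in> Hom M A D" if "f \<in> Hom M A B" "g \<in> Hom M B D" for f g A B D
    using that graded_map_chain_cmp[of f g] chain_cmp_commutes[of f g] by (auto simp: Hom_M)
  show "cmp M (Idm M B) f = f" "cmp M f (Idm M A) = f" if "f \<in> Hom M A B" for f A B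
    using that by (auto simp: Hom_M intro!: chain_map_eqI)
  show "cmp M (cmp M h g) f = cmp M h (cmp M g f)"
    if "f \<in> Hom M A B" "g \<in> Hom M B D" "h \<in> Hom M D E" for f g h A B D E
    using that by (auto simp: Hom_M cmp_cmp intro!: chain_map_eqI)
qed

text \<open>
  Degreewise inverses commute with the differentials automatically.
\<close>

lemma is_iso_M:
  assumes f: "is_chain_map C N f" and iso: "\<And>n. is_iso C (comps f n)"
  shows "is_iso M f"
proof (rule category.is_isoI[OF category_M])
  let ?g = "\<lparr>src = tgt f, tgt = src f, comps = (\<lambda>n. inv_arrow C (comps f n))\<rparr>"
  have f': "graded_map f" "commutes_with_dif f" "is_ncomplex C N (src f)" "is_ncomplex C N (tgt f)"
    using f by (simp_all add: is_chain_map_iff)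
  have g: "graded_map ?g"
    using f' iso by (intro graded_mapI) (simp_all add: in_Hom)
  have "commutes_with_dif ?g"
    unfolding commutes_with_dif_def
  proof
    fix i
    let ?h = "inv_arrow C (comps f i)" and ?h' = "inv_arrow C (comps f (i + 1))"
    have "?h' \<cdot> dif (tgt f) i = ?h' \<cdot> (dif (tgt f) i \<cdot> comps f i) \<cdot> ?h"
      using f' iso by (simp add: cmp_cmp)
    also have "\<dots> = ?h' \<cdot> (comps f (i + 1) \<cdot> dif (src f) i) \<cdot> ?h"
      unfolding commutes_with_difD[OF f'(2)] ..
    also have "\<dots> = (?h' \<cdot> comps f (i + 1)) \<cdot> (dif (src f) i \<cdot> ?h)"
      using f' iso by (simp add: cmp_cmp del: inv_arrow_cmp)
    also have "\<dots> = dif (src f) i \<cdot> ?h"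
      using f' iso by simp
    finally show "comps ?g (i + 1) \<cdot> dif (src ?g) i = dif (tgt ?g) i \<cdot> comps ?g i" by simp
  qed
  then show "?g \<in> Hom M (tgt f) (src f)" "f \<in> Hom M (src f) (tgt f)"
    using f' g by (simp_all add: Hom_M)
  show "cmp M ?g f = Idm M (src f)" "cmp M f ?g = Idm M (tgt f)"
    using f' iso by (auto intro!: chain_map_eqI)
qed

lemma is_iso_M_comps:
  assumes "is_iso M f"
  shows "is_iso C (comps f n)"
proof -
  obtain g where g: "inverse_arrows M f g" using assms unfolding is_iso_def by blast
  then have h: "is_chain_map C N f" "is_chain_map C N g" "src g = tgt f" "tgt g = src f"
    and e: "chain_cmp g f = chain_id (src f)" "chain_cmp f g = chain_id (tgt f)"
    by (simp_all add: inverse_arrows_def in_Hom)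
  have "comps (chain_cmp g f) n = comps (chain_id (src f)) n" "comps (chain_cmp f g) n = comps (chain_id (tgt f)) n"
    unfolding e by (rule refl)+
  then show ?thesis
    using h by (intro is_isoI[of _ "ob (src f) n" "ob (tgt f) n" "comps g n"]) (simp_all add: is_chain_map_iff in_Hom)
qed

lemma preadditive_M: "preadditive_category M"
proof (rule preadditive_category.intro[OF category_M], rule preadditive_category_axioms.intro)
  fix A B assume A: "A \<in> Obj M" and B: "B \<in> Obj M"
  let ?H = "hom_group M A B"
  have H: "f \<in> carrier ?H \<longleftrightarrow> graded_map f \<and> commutes_with_dif f \<and> src f = A \<and> tgt f = B" for f
    using A B by (auto simp: hom_group_def Hom_M)
  have add: "add ?H f g = \<lparr>src = src f, tgt = tgt f, comps = (\<lambda>i. madd C (comps f i) (comps g i))\<rparr>" for f g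
    by (simp add: hom_group_def)
  have zero: "zero ?H = \<lparr>src = A, tgt = B, comps = (\<lambda>i. mzero C (ob A i) (ob B i))\<rparr>"
    by (simp add: hom_group_def)
  have d: "differential A" "differential B" using A B by simp_all
  show "abelian_group ?H"
  proof (rule abelian_groupI)
    show "add ?H f g \<in> carrier ?H" if "f \<in> carrier ?H" "g \<in> carrier ?H" for f g
    proof -
      have c: "graded_map f" "graded_map g" "src f = A" "src g = A" "tgt f = B" "tgt g = B"
        "\<And>i. comps f (i + 1) \<cdot> dif A i = dif B i \<cdot> comps f i"
        "\<And>i. comps g (i + 1) \<cdot> dif A i = dif B i \<cdot> comps g i"
        using that commutes_with_difD[of f] commutes_with_difD[of g] by (auto simp: H)
      have "graded_map (add ?H f g)"
        unfolding add using c d by (intro graded_mapI) (simp_all add: in_Hom)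
      moreover have "commutes_with_dif (add ?H f g)"
        unfolding add using c d by (simp add: commutes_with_dif_def cmp_madd madd_cmp)
      ultimately show ?thesis using c by (simp add: H) (simp add: add)
    qed
    have "graded_map (zero ?H)"
      unfolding zero using d by (intro graded_mapI) (simp_all add: in_Hom)
    moreover have "commutes_with_dif (zero ?H)"
      unfolding zero using d by (simp add: commutes_with_dif_def)
    ultimately show "zero ?H \<in> carrier ?H" by (simp add: H) (simp add: zero)
    show "add ?H (add ?H f g) h = add ?H f (add ?H g h)"
      if "f \<in> carrier ?H" "g \<in> carrier ?H" "h \<in> carrier ?H" for f g h
      using that by (auto simp: H add madd_assoc)
    show "add ?H f g = add ?H g f" if "f \<in> carrier ?H" "g \<in> carrier ?H" for f g
      using that by (auto simp: H add intro!: madd_commute)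
    show "add ?H (zero ?H) f = f" if "f \<in> carrier ?H" for f
      using that by (auto simp: H add zero intro!: chain_map_eqI)
    show "\<exists>g \<in> carrier ?H. add ?H g f = zero ?H" if f: "f \<in> carrier ?H" for f
    proof
      let ?g = "\<lparr>src = A, tgt = B, comps = (\<lambda>i. mneg (comps f i))\<rparr>"
      have c: "graded_map f" "src f = A" "tgt f = B" "\<And>i. comps f (i + 1) \<cdot> dif A i = dif B i \<cdot> comps f i"
        using f commutes_with_difD[of f] by (auto simp: H)
      have "graded_map ?g" using c d by (intro graded_mapI) (simp_all add: in_Hom)
      moreover have "commutes_with_dif ?g"
        using c d by (simp add: commutes_with_dif_def flip: mneg_cmp)
      ultimately show "?g \<in> carrier ?H" by (simp add: H)
      have "madd C (mneg (comps f i)) (comps f i) = mzero C (ob A i) (ob B i)" for i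
        using c madd_mneg[of "comps f i"] madd_commute[of "comps f i" "mneg (comps f i)"] by simp
      then show "add ?H ?g f = zero ?H" by (simp add: add zero)
    qed
  qed
next
  show "cmp M (madd M g h) f = madd M (cmp M g f) (cmp M h f)"
    if "f \<in> Hom M A B" "g \<in> Hom M B D" "h \<in> Hom M B D" for f g h A B D
    using that by (auto simp: Hom_M madd_cmp)
  show "cmp M h (madd M f g) = madd M (cmp M h f) (cmp M h g)"
    if "f \<in> Hom M A B" "g \<in> Hom M A B" "h \<in> Hom M B D" for f g h A B D
    using that by (auto simp: Hom_M cmp_madd)
qed

lemma zero_object_M_iff:
  "zero_object M Z \<longleftrightarrow> is_ncomplex C N Z \<and> (\<forall>n. zero_object C (ob Z n))"
proof -
  have "chain_id Z = mzero M Z Z \<longleftrightarrow> (\<forall>n. Idm C (ob Z n) = mzero C (ob Z n) (ob Z n))"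
    by (auto simp: fun_eq_iff)
  then show ?thesis
    unfolding preadditive_category.zero_object_iff[OF preadditive_M] zero_object_iff
    by (auto simp: is_ncomplex_iff simp del: M_sel(8))
qed

lemma ex_zero_object_M: "zero_object M \<lparr>ob = (\<lambda>_. Z0), dif = (\<lambda>_. mzero C Z0 Z0)\<rparr>" (is "zero_object M ?Z")
proof -
  have Z: "Z0 \<in> Obj C" using Z0 by (simp add: zero_object_def)
  have d: "differential ?Z" using Z by (simp add: differential_def graded_def in_Hom)
  then have "dif_pow C ?Z N n = mzero C (ob ?Z n) (ob ?Z (n + int N))" for n
    using into_zero_object[of "dif_pow C ?Z N n"] dif_pow_Hom[OF d, of N n] Z0 by (simp add: in_Hom)
  then show ?thesis using d Z0 by (simp add: zero_object_M_iff is_ncomplex_iff)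
qed

lemma monoidal_M: "monoidal_category M"
proof (rule monoidal_category.intro[OF category_M], unfold_locales)
  note nc = is_ncomplex_tensor[OF _ _ qbinomial_vanishes]
  show "tensor_obj M X Y \<in> Obj M" if "X \<in> Obj M" "Y \<in> Obj M" for X Y
    using that nc by simp
  show "tensor_arr M f g \<in> Hom M (tensor_obj M X Y) (tensor_obj M X' Y')"
    if "f \<in> Hom M X X'" "g \<in> Hom M Y Y'" for f g X X' Y Y'
    using that nc by (auto simp: Hom_M intro: tensor_commutes_with_dif)
  show "tensor_arr M (Idm M X) (Idm M Y) = Idm M (tensor_obj M X Y)" if "X \<in> Obj M" "Y \<in> Obj M" for X Y
    using that by (auto simp: tensor_chain_id intro!: chain_map_eqI)
  show "tensor_arr M (cmp M f' f) (cmp M g' g) = cmp M (tensor_arr M f' g') (tensor_arr M f g)"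
    if "f \<in> Hom M X X'" "f' \<in> Hom M X' X''" "g \<in> Hom M Y Y'" "g' \<in> Hom M Y' Y''"
    for f f' g g' X X' X'' Y Y' Y''
    using that by (auto simp: Hom_M tensor_chain_cmp intro!: chain_map_eqI)
  show "unit_obj M \<in> Obj M" using is_ncomplex_unit[OF Z0 N] by simp
  fix X Y Z assume X: "X \<in> Obj M" and Y: "Y \<in> Obj M" and Z: "Z \<in> Obj M"
  show asc: "assoc M X Y Z \<in> Hom M (tensor_obj M (tensor_obj M X Y) Z) (tensor_obj M X (tensor_obj M Y Z))"
    using X Y Z nc by (simp add: Hom_M asc_commutes_with_dif)
  show "is_iso M (assoc M X Y Z)"
    by (rule is_iso_M) (use asc X Y Z in \<open>simp_all add: asc_iso in_Hom\<close>)
next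
  show "cmp M (assoc M X' Y' Z') (tensor_arr M (tensor_arr M f g) h)
      = cmp M (tensor_arr M f (tensor_arr M g h)) (assoc M X Y Z)"
    if "f \<in> Hom M X X'" "g \<in> Hom M Y Y'" "h \<in> Hom M Z Z'" for f g h X X' Y Y' Z Z'
    using that asc_natural[of f g h] by (auto simp: Hom_M intro!: chain_map_eqI)
next
  note nc = is_ncomplex_tensor[OF _ _ qbinomial_vanishes] is_ncomplex_unit[OF Z0 N]
  fix X assume X: "X \<in> Obj M"
  show l: "lunit M X \<in> Hom M (tensor_obj M (unit_obj M) X) X"
    using X nc Z0 by (simp add: Hom_M lun_commutes_with_dif graded_map_lun)
  show "is_iso M (lunit M X)"
    by (rule is_iso_M) (use l X Z0 in \<open>simp_all add: lun_iso in_Hom\<close>)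
  show r: "runit M X \<in> Hom M (tensor_obj M X (unit_obj M)) X"
    using X nc Z0 by (simp add: Hom_M run_commutes_with_dif graded_map_run)
  show "is_iso M (runit M X)"
    by (rule is_iso_M) (use r X Z0 in \<open>simp_all add: run_iso in_Hom\<close>)
next
  show "cmp M (lunit M X') (tensor_arr M (Idm M (unit_obj M)) f) = cmp M f (lunit M X)"
    if "f \<in> Hom M X X'" for f X X'
    using that lun_natural[OF Z0, of f] by (auto simp: Hom_M src_lun[OF Z0] tgt_lun[OF Z0] intro!: chain_map_eqI)
  show "cmp M (runit M X') (tensor_arr M f (Idm M (unit_obj M))) = cmp M f (runit M X)"
    if "f \<in> Hom M X X'" for f X X'
    using that run_natural[OF Z0, of f] by (auto simp: Hom_M src_run[OF Z0] tgt_run[OF Z0] intro!: chain_map_eqI)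
  show "cmp M (cmp M (tensor_arr M (Idm M W) (assoc M X Y Z)) (assoc M W (tensor_obj M X Y) Z))
        (tensor_arr M (assoc M W X Y) (Idm M Z))
      = cmp M (assoc M W X (tensor_obj M Y Z)) (assoc M (tensor_obj M W X) Y Z)"
    if "W \<in> Obj M" "X \<in> Obj M" "Y \<in> Obj M" "Z \<in> Obj M" for W X Y Z
    using that by (auto simp: asc_pentagon intro!: chain_map_eqI)
  show "cmp M (tensor_arr M (Idm M X) (lunit M Y)) (assoc M X (unit_obj M) Y)
      = tensor_arr M (runit M X) (Idm M Y)" if "X \<in> Obj M" "Y \<in> Obj M" for X Y
    using that by (auto simp: unit_triangle[OF Z0] src_lun[OF Z0] tgt_lun[OF Z0] src_run[OF Z0] tgt_run[OF Z0] intro!: chain_map_eqI)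
qed

section \<open>Coproducts and distributivity\<close>

lemma Hom_M_comps: "f \<in> Hom M X Y \<Longrightarrow> comps f n \<in> Hom C (ob X n) (ob Y n)"
  unfolding Hom_M by (auto simp: in_Hom)

lemma coproduct_M_if_degreewise:
  assumes P: "is_ncomplex C N P" and \<kappa>: "\<And>i. i \<in> I \<Longrightarrow> \<kappa> i \<in> Hom M (Y i) P"
    and cop: "\<And>n. is_coproduct C I (\<lambda>i. ob (Y i) n) (ob P n) (\<lambda>i. comps (\<kappa> i) n)"
  shows "is_coproduct M I Y P \<kappa>"
proof (rule category.is_coproductI[OF category_M])
  show "P \<in> Obj M" using P by simp
  show "\<kappa> i \<in> Hom M (Y i) P" if "i \<in> I" for i by (rule \<kappa>[OF that])
  have k: "graded_map (\<kappa> i)" "commutes_with_dif (\<kappa> i)" "src (\<kappa> i) = Y i" "tgt (\<kappa> i) = P" "is_ncomplex C N (Y i)"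
    if "i \<in> I" for i
    using \<kappa>[OF that] by (auto simp: Hom_M)
  show "\<exists>h \<in> Hom M P T. \<forall>i \<in> I. cmp M h (\<kappa> i) = f i"
    if T: "T \<in> Obj M" and f: "\<And>i. i \<in> I \<Longrightarrow> f i \<in> Hom M (Y i) T" for T f
  proof -
    have T': "is_ncomplex C N T" "differential T" using T by simp_all
    have f': "graded_map (f i)" "commutes_with_dif (f i)" "src (f i) = Y i" "tgt (f i) = T" if "i \<in> I" for i
      using f[OF that] by (auto simp: Hom_M)
    let ?h = "\<lambda>n. copair C I (ob P n) (\<lambda>i. comps (\<kappa> i) n) (ob T n) (\<lambda>i. comps (f i) n)"
    have fH: "comps (f i) n \<in> Hom C (ob (Y i) n) (ob T n)" if "i \<in> I" for i n
      using f'[OF that] by (simp add: in_Hom)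
    have To: "ob T n \<in> Obj C" for n using T' by simp
    have h: "?h n \<in> Hom C (ob P n) (ob T n)" "i \<in> I \<Longrightarrow> ?h n \<cdot> comps (\<kappa> i) n = comps (f i) n" for n i
      using copair_props[OF cop To fH] by simp_all
    let ?H = "\<lparr>src = P, tgt = T, comps = ?h\<rparr>"
    have hA: "?h n \<in> Arr C" "Dom C (?h n) = ob P n" "Cod C (?h n) = ob T n" for n
      using h(1)[of n] by (simp_all add: in_Hom)
    have "graded_map ?H"
      using P T' h(1) by (intro graded_mapI) simp_all
    moreover have "commutes_with_dif ?H"
      unfolding commutes_with_dif_def
    proof
      fix n
      show "comps ?H (n + 1) \<cdot> dif (src ?H) n = dif (tgt ?H) n \<cdot> comps ?H n"
      proof (rule coproduct_ext[OF cop])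
        show "comps ?H (n + 1) \<cdot> dif (src ?H) n \<in> Hom C (ob P n) (ob T (n + 1))"
          "dif (tgt ?H) n \<cdot> comps ?H n \<in> Hom C (ob P n) (ob T (n + 1))"
          using P T' hA by (simp_all add: in_Hom)
        fix i assume i: "i \<in> I"
        have "?h (n + 1) \<cdot> dif P n \<cdot> comps (\<kappa> i) n = ?h (n + 1) \<cdot> (dif P n \<cdot> comps (\<kappa> i) n)"
          using k[OF i] P hA by (simp add: cmp_cmp)
        also have "\<dots> = ?h (n + 1) \<cdot> (comps (\<kappa> i) (n + 1) \<cdot> dif (Y i) n)"
          using commutes_with_difD[OF k(2)[OF i], of n] k[OF i] by simp
        also have "\<dots> = (?h (n + 1) \<cdot> comps (\<kappa> i) (n + 1)) \<cdot> dif (Y i) n"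
          using k[OF i] hA by (simp add: cmp_cmp)
        also have "\<dots> = comps (f i) (n + 1) \<cdot> dif (Y i) n"
          using h(2)[OF i, of "n + 1"] by simp
        also have "\<dots> = dif T n \<cdot> comps (f i) n"
          using commutes_with_difD[OF f'(2)[OF i], of n] f'[OF i] by simp
        also have "\<dots> = dif T n \<cdot> (?h n \<cdot> comps (\<kappa> i) n)"
          using h(2)[OF i, of n] by simp
        also have "\<dots> = dif T n \<cdot> ?h n \<cdot> comps (\<kappa> i) n"
          using k[OF i] T' hA by (simp add: cmp_cmp)
        finally show "comps ?H (n + 1) \<cdot> dif (src ?H) n \<cdot> comps (\<kappa> i) n
            = dif (tgt ?H) n \<cdot> comps ?H n \<cdot> comps (\<kappa> i) n" by simp
      qed
    qed
    ultimately have "?H \<in> Hom M P T" using P T' by (simp add: Hom_M)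
    moreover have "cmp M ?H (\<kappa> i) = f i" if "i \<in> I" for i
      using k[OF that] f'[OF that] h(2)[OF that] by (intro chain_map_eqI) simp_all
    ultimately show ?thesis by blast
  qed
  show "h = h'" if h: "h \<in> Hom M P T" "h' \<in> Hom M P T"
    and eq: "\<And>i. i \<in> I \<Longrightarrow> cmp M h (\<kappa> i) = cmp M h' (\<kappa> i)" for T h h'
  proof (rule chain_map_eqI)
    show "src h = src h'" "tgt h = tgt h'" using h by (auto simp: Hom_M)
    fix n
    show "comps h n = comps h' n"
    proof (rule coproduct_ext[OF cop])
      show "comps h n \<in> Hom C (ob P n) (ob T n)" "comps h' n \<in> Hom C (ob P n) (ob T n)"
        using h by (simp_all only: Hom_M_comps)
      show "comps h n \<cdot> comps (\<kappa> i) n = comps h' n \<cdot> comps (\<kappa> i) n" if "i \<in> I" for i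
        using arg_cong[OF eq[OF that], of "\<lambda>f. comps f n"] by simp
    qed
  qed
qed

text \<open>
  The differential of the coproduct is induced by those of the summands, and so are its powers.
\<close>

lemma ex_degreewise_coproduct:
  assumes ex: "\<And>y. (\<And>i. i \<in> I \<Longrightarrow> y i \<in> Obj C) \<Longrightarrow> \<exists>P \<kappa>. is_coproduct C I y P \<kappa>"
    and Y: "\<And>i. i \<in> I \<Longrightarrow> is_ncomplex C N (Y i)"
  shows "\<exists>P \<kappa>. is_ncomplex C N P \<and> (\<forall>i \<in> I. \<kappa> i \<in> Hom M (Y i) P) \<and>
    (\<forall>n. is_coproduct C I (\<lambda>i. ob (Y i) n) (ob P n) (\<lambda>i. comps (\<kappa> i) n))"
proof -
  have "\<forall>n. \<exists>Q k. is_coproduct C I (\<lambda>i. ob (Y i) n) Q k"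
    using Y by (intro allI ex) simp
  then obtain Q k where cop: "\<And>n. is_coproduct C I (\<lambda>i. ob (Y i) n) (Q n) (k n)"
    by metis
  note k = coproduct_incl_Arr[OF cop] coproduct_incl_Dom[OF cop] coproduct_incl_Cod[OF cop]
  let ?d = "\<lambda>n. copair C I (Q n) (k n) (Q (n + 1)) (\<lambda>i. k (n + 1) i \<cdot> dif (Y i) n)"
  have Q: "Q n \<in> Obj C" for n by (rule coproduct_Obj[OF cop])
  have kd: "k (n + 1) i \<cdot> dif (Y i) n \<in> Hom C (ob (Y i) n) (Q (n + 1))" if "i \<in> I" for i n
    using k that Y by (simp add: in_Hom)
  have d: "?d n \<in> Hom C (Q n) (Q (n + 1))" "i \<in> I \<Longrightarrow> ?d n \<cdot> k n i = k (n + 1) i \<cdot> dif (Y i) n" for n i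
    using copair_props[OF cop Q kd] by simp_all
  let ?P = "\<lparr>ob = Q, dif = ?d\<rparr>"
  have dP: "differential ?P"
    using Q d(1) by (simp add: differential_def graded_def)
  have pow: "dif_pow C ?P m n \<cdot> k n i = k (n + int m) i \<cdot> dif_pow C (Y i) m n" if i: "i \<in> I" for m n i
  proof (induction m)
    case 0
    then show ?case using k[OF i] Q by simp
  next
    case (Suc m)
    let ?n = "n + int m"
    have "dif_pow C ?P (Suc m) n \<cdot> k n i = ?d ?n \<cdot> (dif_pow C ?P m n \<cdot> k n i)"
      using dP k[OF i] dif_Arr[OF dP, of ?n] dif_Dom[OF dP, of ?n] dif_pow_Hom[OF dP, of m n]
      by (simp add: in_Hom cmp_cmp)
    also have "\<dots> = (?d ?n \<cdot> k ?n i) \<cdot> dif_pow C (Y i) m n"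
      unfolding Suc.IH using d(1)[of ?n] k[OF i] Y[OF i] by (simp add: in_Hom cmp_cmp)
    also have "\<dots> = (k (?n + 1) i \<cdot> dif (Y i) ?n) \<cdot> dif_pow C (Y i) m n"
      using d(2)[OF i] by simp
    also have "\<dots> = k (n + int (Suc m)) i \<cdot> dif_pow C (Y i) (Suc m) n"
      using k[OF i] Y[OF i] by (simp add: cmp_cmp algebra_simps)
    finally show ?case .
  qed
  have "dif_pow C ?P N n = mzero C (ob ?P n) (ob ?P (n + int N))" for n
  proof (rule coproduct_ext[OF cop])
    show "dif_pow C ?P N n \<in> Hom C (Q n) (Q (n + int N))" using dif_pow_Hom[OF dP, of N n] by simp
    show "mzero C (ob ?P n) (ob ?P (n + int N)) \<in> Hom C (Q n) (Q (n + int N))"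
      using Q by (simp add: in_Hom)
    show "dif_pow C ?P N n \<cdot> k n i = mzero C (ob ?P n) (ob ?P (n + int N)) \<cdot> k n i" if i: "i \<in> I" for i
      using pow[OF i, of N n] Y[OF i] k[OF i] Q by (simp add: is_ncomplex_iff)
  qed
  then have P: "is_ncomplex C N ?P" using dP by (simp add: is_ncomplex_iff)
  let ?k = "\<lambda>i. \<lparr>src = Y i, tgt = ?P, comps = (\<lambda>n. k n i)\<rparr>"
  have "?k i \<in> Hom M (Y i) ?P" if i: "i \<in> I" for i
  proof -
    have "graded_map (?k i)"
      using Y[OF i] P coproduct_incl[OF cop i] by (intro graded_mapI) simp_all
    moreover have "commutes_with_dif (?k i)"
      using d(2)[OF i] by (simp add: commutes_with_dif_def)
    ultimately show ?thesis using P Y[OF i] by (simp add: Hom_M)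
  qed
  then show ?thesis
    using P cop by (intro exI[of _ ?P] exI[of _ ?k]) simp
qed

text \<open>
  Since degreewise coproducts exist and are coproducts of complexes, an arbitrary coproduct of
  complexes is isomorphic to a degreewise one and hence is degreewise itself. This is needed
  because distributivity refers to all coproducts, not to chosen ones.
\<close>

lemma coproduct_M_degreewise:
  assumes ex: "\<And>y. (\<And>i. i \<in> I \<Longrightarrow> y i \<in> Obj C) \<Longrightarrow> \<exists>P \<kappa>. is_coproduct C I y P \<kappa>"
    and P: "is_coproduct M I Y P \<kappa>"
  shows "is_coproduct C I (\<lambda>i. ob (Y i) n) (ob P n) (\<lambda>i. comps (\<kappa> i) n)"
proof -
  note M = category_M
  have Y: "is_ncomplex C N (Y i)" if "i \<in> I" for i
    using category.coproduct_summand_Obj[OF M P that] by simp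
  obtain P' \<kappa>' where P': "is_ncomplex C N P'" "\<And>i. i \<in> I \<Longrightarrow> \<kappa>' i \<in> Hom M (Y i) P'"
    and cop: "\<And>n. is_coproduct C I (\<lambda>i. ob (Y i) n) (ob P' n) (\<lambda>i. comps (\<kappa>' i) n)"
    using ex_degreewise_coproduct[of I Y, OF ex Y] by blast
  note Q = coproduct_M_if_degreewise[OF P' cop]
  let ?u = "copair M I P' \<kappa>' P \<kappa>"
  note iso = is_iso_M_comps[OF category.copair_iso[OF M Q P], of n]
  have u: "?u \<in> Hom M P' P" "i \<in> I \<Longrightarrow> cmp M ?u (\<kappa>' i) = \<kappa> i" for i
    using category.copair_props[OF M Q category.coproduct_Obj[OF M P] category.coproduct_incl[OF M P]] by blast+
  have u1: "graded_map ?u" "src ?u = P'" "tgt ?u = P" using u(1) by (simp_all add: Hom_M)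
  have u2: "comps ?u n \<cdot> comps (\<kappa>' i) n = comps (\<kappa> i) n" if "i \<in> I" for i
    using arg_cong[OF u(2)[OF that], of "\<lambda>f. comps f n"] by simp
  have "is_coproduct C I (\<lambda>i. ob (Y i) n) (Cod C (comps ?u n)) (\<lambda>i. comps ?u n \<cdot> comps (\<kappa>' i) n)"
    by (rule coproduct_iso_target[OF cop iso]) (use u1 in simp_all)
  then have "is_coproduct C I (\<lambda>i. ob (Y i) n) (ob P n) (\<lambda>i. comps ?u n \<cdot> comps (\<kappa>' i) n)"
    using u1 by simp
  then show ?thesis
    by (rule is_coproduct_cong) (use u2 in simp_all)
qed

text \<open>
  In degree \<open>n\<close> the tensor product is the coproduct over \<open>i + j = n\<close> of \<open>X\<^sup>i \<otimes> P\<^sup>j\<close>. Each of these is a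
  coproduct over the index set in question by distributivity in the base category, and the two kinds
  of coproducts commute.
\<close>

lemma tensor_M_coproduct:
  assumes ex: "\<And>y. (\<And>i. i \<in> I \<Longrightarrow> y i \<in> Obj C) \<Longrightarrow> \<exists>P \<kappa>. is_coproduct C I y P \<kappa>"
    and dist: "\<And>B y. \<lbrakk>B \<in> Obj C; \<And>i. i \<in> I \<Longrightarrow> y i \<in> Obj C\<rbrakk> \<Longrightarrow> distributes C I B y"
    and X: "is_ncomplex C N X" and P: "is_coproduct M I Y P \<kappa>"
  shows "is_coproduct M I (\<lambda>i. X \<odot> Y i) (X \<odot> P) (\<lambda>i. chain_id X \<odot>\<^sub>a \<kappa> i)"
    and "is_coproduct M I (\<lambda>i. Y i \<odot> X) (P \<odot> X) (\<lambda>i. \<kappa> i \<odot>\<^sub>a chain_id X)"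
proof -
  note M = category_M
  have P': "is_ncomplex C N P" using category.coproduct_Obj[OF M P] by simp
  have k: "\<kappa> i \<in> Hom M (Y i) P" if "i \<in> I" for i by (rule category.coproduct_incl[OF M P that])
  have k': "graded_map (\<kappa> i)" "src (\<kappa> i) = Y i" "tgt (\<kappa> i) = P" "is_ncomplex C N (Y i)" if "i \<in> I" for i
    using k[OF that] by (auto simp: Hom_M)
  note cop = coproduct_M_degreewise[OF ex P]
  have idX: "chain_id X \<in> Hom M X X" "graded_map (chain_id X)" using X by (simp_all add: Hom_M graded_map_chain_id chain_id_commutes)
  show "is_coproduct M I (\<lambda>i. X \<odot> Y i) (X \<odot> P) (\<lambda>i. chain_id X \<odot>\<^sub>a \<kappa> i)"
  proof (rule coproduct_M_if_degreewise)
    show "is_ncomplex C N (X \<odot> P)"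
      using monoidal_category.tensor_obj_closed[OF monoidal_M, of X P] X P' by simp
    show km: "chain_id X \<odot>\<^sub>a \<kappa> i \<in> Hom M (X \<odot> Y i) (X \<odot> P)" if "i \<in> I" for i
      using monoidal_category.tensor_arr_closed[OF monoidal_M idX(1) k[OF that]] by simp
    fix n
    show "is_coproduct C I (\<lambda>i. ob (X \<odot> Y i) n) (ob (X \<odot> P) n) (\<lambda>i. comps (chain_id X \<odot>\<^sub>a \<kappa> i) n)"
    proof (rule coproduct_interchange[OF tensor_coproduct])
      show "is_coproduct C I (\<lambda>a. (case p of (i, j) \<Rightarrow> ob X i \<otimes>\<^sub>o ob (Y a) j))
          (case p of (i, j) \<Rightarrow> ob X i \<otimes>\<^sub>o ob P j)
          (\<lambda>a. (case p of (i, j) \<Rightarrow> Idm C (ob X i) \<otimes>\<^sub>a comps (\<kappa> a) j))" for p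
        using X k' by (cases p) (simp, intro tensor_left_coproduct dist cop ex; simp)
      show "is_coproduct C (antidiagonal n) (\<lambda>(i, j). ob X i \<otimes>\<^sub>o ob (Y a) j) (ob (X \<odot> Y a) n)
          (\<lambda>(i, j). incl X (Y a) i j)" if "a \<in> I" for a
        using X k'[OF that] by (intro tensor_coproduct) simp_all
      show "comps (chain_id X \<odot>\<^sub>a \<kappa> a) n \<in> Hom C (ob (X \<odot> Y a) n) (ob (X \<odot> P) n)" if "a \<in> I" for a
        by (rule Hom_M_comps[OF km[OF that]])
      show "comps (chain_id X \<odot>\<^sub>a \<kappa> a) n \<cdot> (case p of (i, j) \<Rightarrow> incl X (Y a) i j) =
          (case p of (i, j) \<Rightarrow> incl X P i j) \<cdot> (case p of (i, j) \<Rightarrow> Idm C (ob X i) \<otimes>\<^sub>a comps (\<kappa> a) j)"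
        if "a \<in> I" "p \<in> antidiagonal n" for a p
        using that(2) k'[OF that(1)] idX by (auto simp: antidiagonal_def tensor_comps)
    qed (use X P' in simp_all)
  qed
  show "is_coproduct M I (\<lambda>i. Y i \<odot> X) (P \<odot> X) (\<lambda>i. \<kappa> i \<odot>\<^sub>a chain_id X)"
  proof (rule coproduct_M_if_degreewise)
    show "is_ncomplex C N (P \<odot> X)"
      using monoidal_category.tensor_obj_closed[OF monoidal_M, of P X] X P' by simp
    show km: "\<kappa> i \<odot>\<^sub>a chain_id X \<in> Hom M (Y i \<odot> X) (P \<odot> X)" if "i \<in> I" for i
      using monoidal_category.tensor_arr_closed[OF monoidal_M k[OF that] idX(1)] by simp
    fix n
    show "is_coproduct C I (\<lambda>i. ob (Y i \<odot> X) n) (ob (P \<odot> X) n) (\<lambda>i. comps (\<kappa> i \<odot>\<^sub>a chain_id X) n)"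
    proof (rule coproduct_interchange[OF tensor_coproduct])
      show "is_coproduct C I (\<lambda>a. (case p of (i, j) \<Rightarrow> ob (Y a) i \<otimes>\<^sub>o ob X j))
          (case p of (i, j) \<Rightarrow> ob P i \<otimes>\<^sub>o ob X j)
          (\<lambda>a. (case p of (i, j) \<Rightarrow> comps (\<kappa> a) i \<otimes>\<^sub>a Idm C (ob X j)))" for p
        using X k' by (cases p) (simp, intro tensor_right_coproduct dist cop ex; simp)
      show "is_coproduct C (antidiagonal n) (\<lambda>(i, j). ob (Y a) i \<otimes>\<^sub>o ob X j) (ob (Y a \<odot> X) n)
          (\<lambda>(i, j). incl (Y a) X i j)" if "a \<in> I" for a
        using X k'[OF that] by (intro tensor_coproduct) simp_all
      show "comps (\<kappa> a \<odot>\<^sub>a chain_id X) n \<in> Hom C (ob (Y a \<odot> X) n) (ob (P \<odot> X) n)" if "a \<in> I" for a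
        by (rule Hom_M_comps[OF km[OF that]])
      show "comps (\<kappa> a \<odot>\<^sub>a chain_id X) n \<cdot> (case p of (i, j) \<Rightarrow> incl (Y a) X i j) =
          (case p of (i, j) \<Rightarrow> incl P X i j) \<cdot> (case p of (i, j) \<Rightarrow> comps (\<kappa> a) i \<otimes>\<^sub>a Idm C (ob X j))"
        if "a \<in> I" "p \<in> antidiagonal n" for a p
        using that(2) k'[OF that(1)] idX by (auto simp: antidiagonal_def tensor_comps)
    qed (use X P' in simp_all)
  qed
qed

lemma distributes_M:
  assumes ex: "\<And>y. (\<And>i. i \<in> I \<Longrightarrow> y i \<in> Obj C) \<Longrightarrow> \<exists>P \<kappa>. is_coproduct C I y P \<kappa>"
    and dist: "\<And>B y. \<lbrakk>B \<in> Obj C; \<And>i. i \<in> I \<Longrightarrow> y i \<in> Obj C\<rbrakk> \<Longrightarrow> distributes C I B y"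
    and X: "X \<in> Obj M"
  shows "distributes M I X Y"
proof -
  have X': "is_ncomplex C N X" using X by simp
  show ?thesis
  proof (rule monoidal_category.distributesI[OF monoidal_M])
    fix P \<kappa> assume P: "is_coproduct M I Y P \<kappa>"
    note t = tensor_M_coproduct[OF ex dist X' P]
    show "is_coproduct M I (\<lambda>i. tensor_obj M X (Y i)) (tensor_obj M X P) (\<lambda>i. tensor_arr M (Idm M X) (\<kappa> i))"
      using t(1) by simp
    show "is_coproduct M I (\<lambda>i. tensor_obj M (Y i) X) (tensor_obj M P X) (\<lambda>i. tensor_arr M (\<kappa> i) (Idm M X))"
      using t(2) by simp
  qed
qed

lemma zero_object_ob_tensor:
  assumes X: "graded X" "graded Y" and zero: "\<And>i j. zero_object C (ob X i \<otimes>\<^sub>o ob Y j)"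
  shows "zero_object C (ob (X \<odot> Y) n)"
proof -
  have "Idm C (ob (X \<odot> Y) n) = mzero C (ob (X \<odot> Y) n) (ob (X \<odot> Y) n)"
    by (rule tensor_ext[OF X, of _ _ n]) (use X zero in \<open>auto intro!: arrows_from_zero_object[OF Z0]\<close>)
  then show ?thesis using X by (simp add: zero_object_iff[of "ob (X \<odot> Y) n"])
qed

lemma tensor_zero_M:
  assumes X: "X \<in> Obj M" and Z: "zero_object M Z"
  shows "isomorphic M (tensor_obj M X Z) Z \<and> isomorphic M (tensor_obj M Z X) Z"
proof -
  have X': "is_ncomplex C N X" using X by simp
  have Z': "is_ncomplex C N Z" "zero_object C (ob Z n)" for n using Z by (simp_all add: zero_object_M_iff)
  have nc: "is_ncomplex C N (X \<odot> Z)" "is_ncomplex C N (Z \<odot> X)"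
    using monoidal_category.tensor_obj_closed[OF monoidal_M, of X Z]
      monoidal_category.tensor_obj_closed[OF monoidal_M, of Z X] X' Z' by simp_all
  have "zero_object C (ob (X \<odot> Z) n)" "zero_object C (ob (Z \<odot> X) n)" for n
    using X' Z' by (simp_all add: zero_object_ob_tensor zero_object_tensor)
  then have "zero_object M (X \<odot> Z)" "zero_object M (Z \<odot> X)"
    using nc by (simp_all add: zero_object_M_iff)
  then show ?thesis
    using preadditive_category.zero_objects_isomorphic[OF preadditive_M _ Z] by simp
qed

lemma ex_coproduct_M:
  assumes ex: "\<And>y. (\<And>i. i \<in> I \<Longrightarrow> y i \<in> Obj C) \<Longrightarrow> \<exists>P \<kappa>. is_coproduct C I y P \<kappa>"
    and Y: "\<And>i. i \<in> I \<Longrightarrow> Y i \<in> Obj M"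
  shows "\<exists>P \<kappa>. is_coproduct M I Y P \<kappa>"
proof -
  have "is_ncomplex C N (Y i)" if "i \<in> I" for i using Y[OF that] by simp
  then obtain P \<kappa> where "is_ncomplex C N P" "\<forall>i \<in> I. \<kappa> i \<in> Hom M (Y i) P"
    and "\<forall>n. is_coproduct C I (\<lambda>i. ob (Y i) n) (ob P n) (\<lambda>i. comps (\<kappa> i) n)"
    using ex_degreewise_coproduct[of I Y, OF ex] by metis
  then have "is_coproduct M I Y P \<kappa>"
    by (intro coproduct_M_if_degreewise) simp_all
  then show ?thesis by blast
qed

theorem countable_distributive_M: "countable_distributive_monoidal_category M"
proof -
  have bool: "\<exists>P \<kappa>. is_coproduct C (UNIV :: bool set) y P \<kappa>" if "\<And>i. i \<in> UNIV \<Longrightarrow> y i \<in> Obj C" for y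
    using ex_binary_coproduct[of y] that by auto
  have int: "\<exists>P \<kappa>. is_coproduct C (I :: int set) y P \<kappa>" if "\<And>i. i \<in> I \<Longrightarrow> y i \<in> Obj C" for y I
    using countable_coproducts that unfolding has_countable_coproducts_def by auto
  have additive: "additive_category M"
  proof (rule additive_category.intro[OF preadditive_M], rule additive_category_axioms.intro)
    show "\<exists>Z. zero_object M Z" using ex_zero_object_M by blast
    show "\<exists>P \<kappa>. is_coproduct M (UNIV :: bool set) Y P \<kappa>" if "range Y \<subseteq> Obj M" for Y
      by (rule ex_coproduct_M[OF bool]) (use that in blast)+
  qed
  have dist: "distributive_monoidal_category M"
  proof (rule distributive_monoidal_category.intro[OF monoidal_M additive],
      rule distributive_monoidal_category_axioms.intro)
    show "distributes M (UNIV :: bool set) X Y" if "X \<in> Obj M" "range Y \<subseteq> Obj M" for X Y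
      by (rule distributes_M[OF bool finite_distributes that(1)]) auto
    show "isomorphic M (tensor_obj M X Z) Z \<and> isomorphic M (tensor_obj M Z X) Z"
      if "X \<in> Obj M" "zero_object M Z" for X Z
      by (rule tensor_zero_M[OF that])
  qed
  show ?thesis
  proof (rule countable_distributive_monoidal_category.intro[OF dist],
      rule countable_distributive_monoidal_category_axioms.intro)
    show "has_countable_coproducts M"
      unfolding has_countable_coproducts_def
      by (intro allI impI ex_coproduct_M[OF int]) blast+
    show "distributes M (UNIV :: int set) X Y" if "X \<in> Obj M" "range Y \<subseteq> Obj M" for X Y
      by (rule distributes_M[OF int countable_distributes that(1)]) auto
  qed
qed

end

section \<open>The main result\<close>

lemma (in domain) primitive_root_Units:
  assumes "primitive_root R k q" "0 < k"
  shows "q \<in> Units R"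
proof -
  obtain m where k: "k = Suc m" using assms(2) by (cases k) auto
  have q: "q \<in> carrier R" "q [^] m \<otimes> q = \<one>"
    using assms(1) unfolding primitive_root_def k by simp_all
  then show ?thesis
    using m_comm[of "q [^] m" q] by (auto simp: Units_def)
qed

text \<open>
  The exponent \<open>n = 0\<close> covers a primitive \<open>N\<close>-th root of unity, where no prime has to act as zero.
\<close>

lemma (in graded_tensor) qbinomial_annihilates:
  assumes k: "primitive_root R k \<xi>" and N: "N = p ^ n * k" "0 < N"
    and p: "n = 0 \<or> prime p \<and> annihilates_arrows p C"
    and a: "0 < a" "a < N" and f: "f \<in> Arr C"
  shows "scale C (qbinomial R \<xi> N a) f = mzero C (Dom C f) (Cod C f)"
  using p
proof
  assume "n = 0"
  then have "qbinomial R \<xi> N a = \<zero>\<^bsub>R\<^esub>"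
    using R.qbinomial_primitive_root[OF k a(1)] N(1) a(2) by simp
  then show ?thesis using f by simp
next
  assume p: "prime p \<and> annihilates_arrows p C"
  obtain y where y: "y \<in> carrier R" "qbinomial R \<xi> N a = add_pow R p y"
    using R.qbinomial_prime_power_multiple[OF k, of p a n] p a N by auto
  have "scale C y f \<in> Hom C (Dom C f) (Cod C f)" using y(1) f by (simp add: in_Hom)
  then show ?thesis
    using p f unfolding y(2) scale_add_pow[OF y(1) f] annihilates_arrows_def by simp
qed

theorem corollary4p10:
  fixes R :: "('r, 'y) ring_scheme"
    and C :: "('o, 'm, 'r, 'x) linear_monoidal_category_scheme"
    and \<xi> :: 'r and N :: nat
    and S :: "(int \<Rightarrow> 'o) \<Rightarrow> 'o" and \<iota> :: "(int \<Rightarrow> 'o) \<Rightarrow> int \<Rightarrow> 'm" and Z0 :: 'o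
  assumes "domain R"
    and "linear_monoidal_category R C"
    and "countable_distributive_monoidal_category C"
    and "coproduct_choice C S \<iota>"
    and "zero_object C Z0"
    and "\<xi> \<in> carrier R"
    and "N > 0"
    and "allows_twisted_Leibniz R C N \<xi>"
  shows "countable_distributive_monoidal_category (ncomplexes_monoidal R C N \<xi> S \<iota> Z0)"
proof -
  interpret R: domain R by fact
  \<comment> \<open>\<open>\<xi> = 1\<close> is a primitive root with \<open>k = 1\<close>, and a primitive \<open>N\<close>-th root of unity has \<open>n = 0\<close>\<close>
  have "primitive_root R 1 \<one>\<^bsub>R\<^esub>" by (auto simp: primitive_root_def)
  then obtain p k n where k: "primitive_root R k \<xi>" and N: "N = p ^ n * k"
    and p: "n = 0 \<or> prime p \<and> annihilates_arrows p C"
    using assms(8) unfolding allows_twisted_Leibniz_def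
    by (elim disjE exE conjE) (metis mult.right_neutral, metis mult_1 power_0, metis)
  have "0 < k" using N assms(7) by (cases k) auto
  then have "\<xi> \<in> Units R" by (rule R.primitive_root_Units[OF k])
  then interpret graded_tensor R C \<xi> S \<iota>
    using assms(1-4) by (intro graded_tensor.intro graded_tensor_axioms.intro)
  interpret ncomplex_tensor R C \<xi> S \<iota> N Z0
    using assms(5,7) qbinomial_annihilates[OF k N assms(7) p]
    by unfold_locales auto
  show ?thesis by (rule countable_distributive_M)
qed

end
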